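(* Let $\Gamma$ be a finite connected graph not homeomorphic to $[0,1]$ and let $u,v\in V(\Gamma)$ be two distinct vertices which are not connected by an edge in $\Gamma$. Let $\hat\Gamma$ be obtained from $\Gamma$ by adding an edge $e$ connecting $u$ and $v$, and let $\Gamma_0$ be the graph obtained from $\Gamma$ by removing $u$, $v$ and all edges emanating from $u$ and $v$. Let $i:F(\Gamma,2)\to F(\hat\Gamma,2)$ be the inclusion, and regard the homology groups $H_*(F(\Gamma,2))$ and $H_*(F(\hat\Gamma,2))$ as $\mathbf{Z}[\mathbf{Z}_2]$-modules via the action $\tau_*$ induced by the involution $\tau(x,y)=(y,x)$. (a) There exists a short exact sequence of $\mathbf{Z}[\mathbf{Z}_2]$-modules $$0\to H_2(F(\Gamma,2))\xrightarrow{i_*}H_2(F(\hat\Gamma,2))\to X\to 0,$$ where $X$ is the subgroup of $H_1(\Gamma_0)\oplus H_1(\Gamma_0)$ consisting of the elements $z\oplus z'$ such that $\mathrm{Lk}_{v,u}(z)+\tau_*(\mathrm{Lk}_{v,u}(z'))=0\in Q_\Gamma$. The involution $\tau$ acts on $X$ by $\tau(z\oplus z')=z'\oplus z$. (b) There is an exact sequence $$H_1(\Gamma_0)\oplus H_1(\Gamma_0)\xrightarrow{F}H_1(F(\Gamma,2))\xrightarrow{i_*}H_1(F(\hat\Gamma,2))\xrightarrow{k}H_0(\Gamma_0)\oplus H_0(\Gamma_0)\to 0,$$ where $F$ acts by the formula $$F(z\oplus z')=\partial_*\mathrm{Lk}_{v,u}(z)+\tau_*\partial_*\mathrm{Lk}_{v,u}(z'),\qquad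 z,z'\in H_1(\Gamma_0).$$
   Context: A graph means a finite 1-dimensional simplicial complex (the auxiliary graph $\Gamma_0$ may have isolated vertices). Homology is with integer coefficients. $F(X,2)=\{(x,y)\in X\times X:x\ne y\}$. For $x\in\Gamma$, $\mathrm{supp}\{x\}$ is the closure of the cell containing $x$. The discrete configuration space is $D(\Gamma,2)=\{(x,y)\in\Gamma\times\Gamma:\mathrm{supp}\{x\}\cap\mathrm{supp}\{y\}=\emptyset\}$; $F(\Gamma,2)$ deformation retracts onto it, so their homology groups are identified. $N_\Gamma=\overline{\Gamma\times\Gamma-D(\Gamma,2)}$ is the union of all $e\times e'$ with $e,e'$ closed edges with $e\cap e'\ne\emptyset$, and $\partial N_\Gamma=N_\Gamma\cap D(\Gamma,2)$; by excision $H_2(N_\Gamma,\partial N_\Gamma)=H_2(\Gamma\times\Gamma,D(\Gamma,2))$. The intersection form $I_\Gamma:H_1(\Gamma)\otimes H_1(\Gamma)\to H_2(N_\Gamma,\partial N_\Gamma)$ is the homomorphism $H_2(\Gamma\times\Gamma)\to H_2(\Gamma\times\Gamma,D(\Gamma,2))$ composed with the Künneth isomorphism $H_1(\Gamma)\otimes H_1(\Gamma)\cong H_2(\Gamma\times\Gamma)$ and excision; $Q_\Gamma=\mathrm{coker}\, I_\Gamma$. The involution $\tau(x,y)=(y,x)$ acts on $(\Gamma\times\Gamma,D(\Gamma,2))$ and, since $I_\Gamma(z\otimes z')=-\tau_*I_\Gamma(z'\otimes z)$, induces $\tau_*$ on $Q_\Gamma$. The connecting homomorphism $H_2(\Gamma\times\Gamma,D(\Gamma,2))\to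 H_1(D(\Gamma,2))$ induces an injection $\partial_*:Q_\Gamma\to H_1(D(\Gamma,2))=H_1(F(\Gamma,2))$. The linking homomorphism $\mathrm{Lk}_{v,u}:H_1(\Gamma_0)\to Q_\Gamma$: given $z\in H_1(\Gamma_0)$ represented by the cellular cycle $c\in C_1(\Gamma_0)$, choose a chain $a\in C_1(\Gamma)$ with $\partial a=u-v$. The product chain $ac=a\times c\in C_2(\Gamma\times\Gamma)$ satisfies $\partial(ac)=uc-vc\in C_1(D(\Gamma,2))$, so it is a relative cycle of $(\Gamma\times\Gamma,D(\Gamma,2))$; $\mathrm{Lk}_{v,u}(z)$ is the image in $Q_\Gamma$ of its class in $H_2(N_\Gamma,\partial N_\Gamma)$. It does not depend on the choice of $a$. *)

theory Defs
  imports "HOL-Homology.Homology"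
begin

text \<open>
  A graph is a finite abstract simplicial complex of dimension at most one, given by its set of
  (nonempty) simplices; the vertices are the \<open>w\<close> with \<open>{w} \<in> K\<close>. Its realization consists of
  barycentric coordinate functions, so the realization of a subcomplex is literally a subspace.
\<close>

definition graph :: "'a set set \<Rightarrow> bool" where
  "graph K \<longleftrightarrow> finite K \<and>
     (\<forall>s\<in>K. finite s \<and> 1 \<le> card s \<and> card s \<le> 2 \<and> (\<forall>t. t \<subseteq> s \<and> t \<noteq> {} \<longrightarrow> t \<in> K))"

definition add_edge :: "'a set set \<Rightarrow> 'a \<Rightarrow> 'a \<Rightarrow> 'a set set" where
  "add_edge K u v = insert {u, v} K"

definition remove_vertices :: "'a set set \<Rightarrow> 'a \<Rightarrow> 'a \<Rightarrow> 'a set set" where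
  "remove_vertices K u v = {s \<in> K. u \<notin> s \<and> v \<notin> s}"

definition realization :: "'a set set \<Rightarrow> ('a \<Rightarrow> real) topology" where
  "realization K = top_of_set
     {x. (\<forall>w. 0 \<le> x w) \<and> {w. x w \<noteq> 0} \<in> K \<and> (\<Sum>w | x w \<noteq> 0. x w) = 1}"

definition vertex_point :: "'a \<Rightarrow> 'a \<Rightarrow> real" where
  "vertex_point u = (\<lambda>w. if w = u then 1 else 0)"

definition open_cell :: "'a set set \<Rightarrow> 'a set \<Rightarrow> ('a \<Rightarrow> real) set" where
  "open_cell K s = {x \<in> topspace (realization K). {w. x w \<noteq> 0} = s}"

definition supp :: "'a set set \<Rightarrow> ('a \<Rightarrow> real) \<Rightarrow> ('a \<Rightarrow> real) set" where
  "supp K x = realization K closure_of open_cell K {w. x w \<noteq> 0}"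

definition square :: "'b topology \<Rightarrow> ('b \<times> 'b) topology" where
  "square X = prod_topology X X"

definition conf2 :: "'b topology \<Rightarrow> ('b \<times> 'b) topology" where
  "conf2 X = subtopology (square X) {(x, y). x \<noteq> y}"

definition disc_conf2 :: "'a set set \<Rightarrow> (('a \<Rightarrow> real) \<times> ('a \<Rightarrow> real)) set" where
  "disc_conf2 K = {(x, y) \<in> topspace (square (realization K)). supp K x \<inter> supp K y = {}}"

text \<open>
  When no vertex is isolated, this closure is the union of the products of intersecting closed edges.
\<close>

definition diag_nbhd :: "'a set set \<Rightarrow> (('a \<Rightarrow> real) \<times> ('a \<Rightarrow> real)) set" where
  "diag_nbhd K = square (realization K) closure_of
     (topspace (square (realization K)) - disc_conf2 K)"

definition diag_bdry :: "'a set set \<Rightarrow> (('a \<Rightarrow> real) \<times> ('a \<Rightarrow> real)) set" where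
  "diag_bdry K = diag_nbhd K \<inter> disc_conf2 K"

text \<open>The degeneracy map collapsing the edge between vertices \<open>j\<close> and \<open>j + 1\<close>.\<close>

definition degen :: "nat \<Rightarrow> (nat \<Rightarrow> real) \<Rightarrow> nat \<Rightarrow> real" where
  "degen j x = (\<lambda>i. if i < j then x i else if i = j then x j + x (Suc j) else x (Suc i))"

text \<open>
  The Eilenberg--Zilber product of two singular 1-simplices: the square is cut along its diagonal
  into two triangles. With this sign,
  \<open>\<partial>(a \<times> c) = \<partial>a \<times> c - a \<times> \<partial>c\<close> for 1-chains \<open>a\<close> and \<open>c\<close>.
\<close>

definition product_simplex ::
  "((nat \<Rightarrow> real) \<Rightarrow> 'b) \<Rightarrow> ((nat \<Rightarrow> real) \<Rightarrow> 'c) \<Rightarrow> ('b \<times> 'c) chain" where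
  "product_simplex \<sigma> \<tau> =
     frag_of (restrict (\<lambda>x. (\<sigma> (degen 1 x), \<tau> (degen 0 x))) (standard_simplex 2)) -
     frag_of (restrict (\<lambda>x. (\<sigma> (degen 0 x), \<tau> (degen 1 x))) (standard_simplex 2))"

definition product_chain :: "'b chain \<Rightarrow> 'c chain \<Rightarrow> ('b \<times> 'c) chain" where
  "product_chain a c = frag_extend (\<lambda>\<sigma>. frag_extend (\<lambda>\<tau>. product_simplex \<sigma> \<tau>) c) a"

definition point_chain :: "'b \<Rightarrow> 'b chain" where
  "point_chain x = frag_of (restrict (\<lambda>_. x) (standard_simplex 0))"

text \<open>
  The restriction of the Kuenneth isomorphism to pure tensors. A homology class is the set of
  cycles representing it.
\<close>

definition homology_cross ::
  "'b topology \<Rightarrow> 'b chain set \<Rightarrow> 'b chain set \<Rightarrow> ('b \<times> 'b) chain set" where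
  "homology_cross X z z' =
     (THE w. \<exists>c\<in>z. \<exists>c'\<in>z'. w = homologous_rel_set 2 (square X) {} (product_chain c c'))"

definition H2_square_rel ::
  "'a set set \<Rightarrow> (('a \<Rightarrow> real) \<times> ('a \<Rightarrow> real)) chain set monoid" where
  "H2_square_rel K = relative_homology_group 2 (square (realization K)) (disc_conf2 K)"

definition H2_nbhd ::
  "'a set set \<Rightarrow> (('a \<Rightarrow> real) \<times> ('a \<Rightarrow> real)) chain set monoid" where
  "H2_nbhd K =
     relative_homology_group 2 (subtopology (square (realization K)) (diag_nbhd K)) (diag_bdry K)"

text \<open>The excision isomorphism \<open>H\<^sub>2(N, \<partial>N) \<rightarrow> H\<^sub>2(\<Gamma> \<times> \<Gamma>, D(\<Gamma>, 2))\<close> and its inverse.\<close>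

definition excise ::
  "'a set set \<Rightarrow> (('a \<Rightarrow> real) \<times> ('a \<Rightarrow> real)) chain set
     \<Rightarrow> (('a \<Rightarrow> real) \<times> ('a \<Rightarrow> real)) chain set" where
  "excise K = hom_induced 2
     (subtopology (square (realization K)) (diag_nbhd K)) (diag_bdry K)
     (square (realization K)) (disc_conf2 K) id"

definition excise_inv ::
  "'a set set \<Rightarrow> (('a \<Rightarrow> real) \<times> ('a \<Rightarrow> real)) chain set
     \<Rightarrow> (('a \<Rightarrow> real) \<times> ('a \<Rightarrow> real)) chain set" where
  "excise_inv K = inv_into (carrier (H2_nbhd K)) (excise K)"

text \<open>
  The intersection form as a bilinear map; the image of the induced homomorphism on the tensor
  product is the subgroup generated by its values.
\<close>

definition intersection_form ::
  "'a set set \<Rightarrow> ('a \<Rightarrow> real) chain set \<Rightarrow> ('a \<Rightarrow> real) chain set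
     \<Rightarrow> (('a \<Rightarrow> real) \<times> ('a \<Rightarrow> real)) chain set" where
  "intersection_form K z z' = excise_inv K
     (hom_induced 2 (square (realization K)) {} (square (realization K)) (disc_conf2 K) id
       (homology_cross (realization K) z z'))"

definition intersection_image ::
  "'a set set \<Rightarrow> (('a \<Rightarrow> real) \<times> ('a \<Rightarrow> real)) chain set set" where
  "intersection_image K = generate (H2_nbhd K)
     {intersection_form K z z' | z z'.
        z \<in> carrier (homology_group 1 (realization K)) \<and>
        z' \<in> carrier (homology_group 1 (realization K))}"

definition Q_group ::
  "'a set set \<Rightarrow> (('a \<Rightarrow> real) \<times> ('a \<Rightarrow> real)) chain set set monoid" where
  "Q_group K = H2_nbhd K Mod intersection_image K"

text \<open>
  The maps induced on \<open>Q\<close>. Elements of \<open>Q\<close> are cosets in \<open>H\<^sub>2(N, \<partial>N)\<close>; the involution carries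
  cosets to cosets, and the connecting homomorphism is constant on each coset.
\<close>

definition Q_tau ::
  "'a set set \<Rightarrow> (('a \<Rightarrow> real) \<times> ('a \<Rightarrow> real)) chain set set
     \<Rightarrow> (('a \<Rightarrow> real) \<times> ('a \<Rightarrow> real)) chain set set" where
  "Q_tau K q =
     hom_induced 2
       (subtopology (square (realization K)) (diag_nbhd K)) (diag_bdry K)
       (subtopology (square (realization K)) (diag_nbhd K)) (diag_bdry K) prod.swap ` q"

definition Q_boundary ::
  "'a set set \<Rightarrow> (('a \<Rightarrow> real) \<times> ('a \<Rightarrow> real)) chain set set
     \<Rightarrow> (('a \<Rightarrow> real) \<times> ('a \<Rightarrow> real)) chain set" where
  "Q_boundary K q = the_elem
     ((\<lambda>w. hom_induced 1
              (subtopology (square (realization K)) (disc_conf2 K)) {}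
              (conf2 (realization K)) {} id
              (hom_boundary 2 (square (realization K)) (disc_conf2 K) (excise K w))) ` q)"

text \<open>
  \<open>z\<close> is a class in \<open>H\<^sub>1(\<Gamma>\<^sub>0)\<close> and \<open>c\<close> a cycle representing it, viewed as a chain in \<open>\<Gamma>\<close>.
\<close>

definition Lk ::
  "'a set set \<Rightarrow> 'a \<Rightarrow> 'a \<Rightarrow> ('a \<Rightarrow> real) chain set
     \<Rightarrow> (('a \<Rightarrow> real) \<times> ('a \<Rightarrow> real)) chain set set" where
  "Lk K v u z = (THE q. \<exists>c\<in>z. \<exists>a.
     singular_chain 1 (realization K) a \<and>
     chain_boundary 1 a = point_chain (vertex_point u) - point_chain (vertex_point v) \<and>
     q = intersection_image K #>\<^bsub>H2_nbhd K\<^esub>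
           excise_inv K
             (homologous_rel_set 2 (square (realization K)) (disc_conf2 K) (product_chain a c)))"

text \<open>A module over this ring is an abelian group with an automorphism whose square is 1.\<close>

definition Z2_module :: "('g, 'm) monoid_scheme \<Rightarrow> ('g \<Rightarrow> 'g) \<Rightarrow> bool" where
  "Z2_module G t \<longleftrightarrow> comm_group G \<and> t \<in> hom G G \<and> (\<forall>x\<in>carrier G. t (t x) = x)"

definition Z2_hom ::
  "('g, 'm) monoid_scheme \<Rightarrow> ('g \<Rightarrow> 'g) \<Rightarrow> ('h, 'n) monoid_scheme \<Rightarrow> ('h \<Rightarrow> 'h) \<Rightarrow> ('g \<Rightarrow> 'h) set"
  where
  "Z2_hom G t H s = {f \<in> hom G H. \<forall>x\<in>carrier G. f (t x) = s (f x)}"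

definition tau :: "int \<Rightarrow> ('b \<times> 'b) topology \<Rightarrow> ('b \<times> 'b) chain set \<Rightarrow> ('b \<times> 'b) chain set" where
  "tau p Y = hom_induced p Y {} Y {} prod.swap"

text \<open>
  \<open>exact_seq\<close> of the library requires all groups to have the same type, hence this notion of
  exactness of \<open>A \<rightarrow> B \<rightarrow> C\<close> at \<open>B\<close>.
\<close>

definition exact_at ::
  "('a, 'm) monoid_scheme \<Rightarrow> ('a \<Rightarrow> 'b) \<Rightarrow> ('b, 'n) monoid_scheme \<Rightarrow> ('b \<Rightarrow> 'c)
     \<Rightarrow> ('c, 'k) monoid_scheme \<Rightarrow> bool" where
  "exact_at A f B g C \<longleftrightarrow>
     group_hom A B f \<and> group_hom B C g \<and> kernel B C g = f ` carrier A"

definition conf2_incl ::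
  "int \<Rightarrow> 'a set set \<Rightarrow> 'a \<Rightarrow> 'a \<Rightarrow> (('a \<Rightarrow> real) \<times> ('a \<Rightarrow> real)) chain set
     \<Rightarrow> (('a \<Rightarrow> real) \<times> ('a \<Rightarrow> real)) chain set" where
  "conf2_incl p K u v = hom_induced p
     (conf2 (realization K)) {} (conf2 (realization (add_edge K u v))) {} id"

abbreviation H_Gamma0_sq ::
  "int \<Rightarrow> 'a set set \<Rightarrow> 'a \<Rightarrow> 'a \<Rightarrow> (('a \<Rightarrow> real) chain set \<times> ('a \<Rightarrow> real) chain set) monoid" where
  "H_Gamma0_sq p K u v \<equiv>
     homology_group p (realization (remove_vertices K u v)) \<times>\<times>
     homology_group p (realization (remove_vertices K u v))"

definition X_set ::
  "'a set set \<Rightarrow> 'a \<Rightarrow> 'a \<Rightarrow> (('a \<Rightarrow> real) chain set \<times> ('a \<Rightarrow> real) chain set) set" where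
  "X_set K u v = {(z, z') \<in> carrier (H_Gamma0_sq 1 K u v).
     Lk K v u z \<otimes>\<^bsub>Q_group K\<^esub> Q_tau K (Lk K v u z') = \<one>\<^bsub>Q_group K\<^esub>}"

abbreviation X_group ::
  "'a set set \<Rightarrow> 'a \<Rightarrow> 'a \<Rightarrow> (('a \<Rightarrow> real) chain set \<times> ('a \<Rightarrow> real) chain set) monoid" where
  "X_group K u v \<equiv> (H_Gamma0_sq 1 K u v)\<lparr>carrier := X_set K u v\<rparr>"

definition F_map ::
  "'a set set \<Rightarrow> 'a \<Rightarrow> 'a \<Rightarrow> ('a \<Rightarrow> real) chain set \<times> ('a \<Rightarrow> real) chain set
     \<Rightarrow> (('a \<Rightarrow> real) \<times> ('a \<Rightarrow> real)) chain set" where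
  "F_map K u v = (\<lambda>(z, z').
     Q_boundary K (Lk K v u z)
       \<otimes>\<^bsub>homology_group 1 (conf2 (realization K))\<^esub>
     tau 1 (conf2 (realization K)) (Q_boundary K (Lk K v u z')))"

end

theory Submission
  imports Defs
begin

text \<open>
  Two distinct points of a graph can be pushed apart until their closed cells are disjoint: subtract
  from the barycentric coordinates of each point a multiple of the minimum of the two, and
  renormalize. Hence \<open>F(\<Gamma>, 2)\<close> deforms onto \<open>D(\<Gamma>, 2)\<close> (\<open>iso_disc_conf2\<close>). When the edge \<open>e\<close> is added
  to \<open>\<Gamma>\<close>, the discrete configuration space grows by \<open>e \<times> \<Gamma>\<^sub>0\<close> and \<open>\<Gamma>\<^sub>0 \<times> e\<close>, that is, by cylinders over
  \<open>\<Gamma>\<^sub>0\<close> whose ends are glued to \<open>D(\<Gamma>, 2)\<close>. The relative homology of such a tube is the homology of its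
  base shifted by one degree: a class \<open>z\<close> corresponds to the relative class with boundary the
  difference of the two copies of \<open>z\<close> at the ends (\<open>iso_cylinder_class\<close>, \<open>iso_tube\<close>). So the exact
  sequence of the pair reads
  \<open>H\<^sub>p(\<Gamma>\<^sub>0)\<^sup>2 \<rightarrow> H\<^sub>p(F(\<Gamma>, 2)) \<rightarrow> H\<^sub>p(F(\<Gamma>', 2)) \<rightarrow> H\<^sub>p\<^sub>-\<^sub>1(\<Gamma>\<^sub>0)\<^sup>2 \<rightarrow> H\<^sub>p\<^sub>-\<^sub>1(F(\<Gamma>, 2))\<close>, where \<open>\<Gamma>'\<close> is the graph with
  the added edge and the outer maps send \<open>z \<oplus> z'\<close> to \<open>(u \<times> z - v \<times> z) + \<tau>(u \<times> z' - v \<times> z')\<close>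
  (\<open>kernel_i\<close>, \<open>kernel_cut\<close>, \<open>image_cut\<close>). Both parts of the theorem are segments of this sequence.
  For \<open>p = 2\<close> its first term is zero, because a graph has no homology above dimension one. For
  \<open>p = 1\<close> its last map is zero, because \<open>F(\<Gamma>, 2)\<close> is path connected: two tokens on a connected graph
  can be moved from any position to any other unless the graph is a path
  (\<open>path_or_tokens_connected\<close>), and a path is homeomorphic to the unit interval.

  It remains to see that the outer map in degree one is \<open>F\<close> and that its kernel is \<open>X\<close>. A chain \<open>a\<close>
  from \<open>v\<close> to \<open>u\<close> and a cycle \<open>c\<close> satisfy \<open>\<partial>(a \<times> c) = u \<times> c - v \<times> c\<close>, so the connecting homomorphism
  takes the linking class of \<open>z\<close> to \<open>u \<times> z - v \<times> z\<close>. What makes this decisive is that the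
  connecting homomorphism is injective on \<open>Q\<close>; the same fact shows that the linking class does not
  depend on \<open>a\<close> and \<open>c\<close>. Injectivity means that a class of \<open>H\<^sub>2(N, \<partial>N)\<close> with zero boundary comes from
  the intersection form (\<open>kernel_beta\<close>). By exactness it comes from \<open>H\<^sub>2(\<Gamma> \<times> \<Gamma>)\<close>, and this group is
  generated by cross products of one-dimensional classes (\<open>kuenneth_surjective\<close>). That half of the
  Kuenneth theorem is proved by building the second factor one vertex or edge at a time; a new edge
  again attaches a tube.
\<close>

section \<open>Exact sequences and excision\<close>

lemma group_hom_hom_induced [simp]:
  "group_hom (relative_homology_group p X S) (relative_homology_group p Y T) (hom_induced p X S Y T f)"
  by (simp add: group_hom_def group_hom_axioms_def hom_induced_hom)

lemma group_hom_hom_boundary [simp]: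
  "group_hom (relative_homology_group p X S) (homology_group (p-1) (subtopology X S)) (hom_boundary p X S)"
  by (simp add: group_hom_def group_hom_axioms_def hom_boundary_hom)

lemma kernel_hom_boundary:
  "kernel (relative_homology_group p X S) (homology_group (p-1) (subtopology X S)) (hom_boundary p X S)
   = hom_induced p X {} X S id ` carrier (homology_group p X)"
  using homology_exactness_axiom_1 [of p X S] by simp

lemma kernel_hom_induced_subspace:
  "kernel (homology_group p (subtopology X S)) (homology_group p X)
     (hom_induced p (subtopology X S) {} X {} id)
   = hom_boundary (p+1) X S ` carrier (relative_homology_group (p+1) X S)"
  using homology_exactness_axiom_2 [of "p+1" X S] by simp

lemma kernel_hom_induced_relativization:
  "kernel (homology_group p X) (relative_homology_group p X S) (hom_induced p X {} X S id)
   = hom_induced p (subtopology X S) {} X {} id ` carrier (homology_group p (subtopology X S))"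
  using homology_exactness_axiom_3 [of p X S] by simp

text \<open>
  In the exact sequence of a triple every third term vanishes.
\<close>
lemma iso_relative_enlarge:
  assumes "S \<subseteq> T" and triv: "\<And>p. trivial_group (relative_homology_group p (subtopology X T) S)"
  shows "hom_induced p X S X T id \<in> iso (relative_homology_group p X S) (relative_homology_group p X T)"
proof -
  let ?G = "relative_homology_group p X S" and ?H = "relative_homology_group p X T"
  let ?h = "hom_induced p X S X T id"
  have k: "kernel ?G ?H ?h = {\<one>\<^bsub>?G\<^esub>}"
  proof -
    have "kernel ?G ?H ?h =
        hom_induced p (subtopology X T) S X S id ` carrier (relative_homology_group p (subtopology X T) S)"
      using homology_exactness_triple_3 [OF assms(1), of p X] by simp
    also have "\<dots> = {\<one>\<^bsub>?G\<^esub>}"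
      using triv [of p] group_hom.hom_one [OF group_hom_hom_induced]
      by (simp add: trivial_group_def)
    finally show ?thesis .
  qed
  have i: "?h ` carrier ?G = carrier ?H"
  proof -
    have "kernel ?H (relative_homology_group (p-1) (subtopology X T) S) (hom_relboundary p X T S) = ?h ` carrier ?G"
      using homology_exactness_triple_1 [OF assms(1), of p X] by simp
    moreover have "hom_relboundary p X T S x = \<one>\<^bsub>relative_homology_group (p-1) (subtopology X T) S\<^esub>" for x
      using triv [of "p-1"] hom_relboundary[of p X T S x] by (simp add: trivial_group_def)
    ultimately show ?thesis by (auto simp: kernel_def)
  qed
  have "inj_on ?h (carrier ?G)"
    using k by (metis group_hom.trivial_ker_imp_inj group_hom_hom_induced)
  with i show ?thesis by (simp add: iso_def hom_induced_hom bij_betw_def)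
qed

text \<open>
  Lets one homotopy serve for a space and for a subspace that it preserves.
\<close>
lemma homotopic_with_subtopology_id:
  assumes "homotopic_with P (subtopology X S) (subtopology X S) f id"
    and "\<And>k. P k \<Longrightarrow> k ` T \<subseteq> T \<and> Q k" and "T \<subseteq> S"
  shows "homotopic_with Q (subtopology X T) (subtopology X T) f id"
proof -
  obtain h where h: "continuous_map (prod_topology (top_of_set {0..1}) (subtopology X S)) (subtopology X S) h"
    "\<And>x. h (0::real, x) = f x" "\<And>x. h (1, x) = id x" "\<And>t. t \<in> {0..1} \<Longrightarrow> P (\<lambda>x. h (t,x))"
    using assms(1) unfolding homotopic_with_def by blast
  have "continuous_map (prod_topology (top_of_set {0..1}) (subtopology X T)) (subtopology X S) h"
  proof -
    have "prod_topology (top_of_set {0..1}) (subtopology X T)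
       = subtopology (prod_topology (top_of_set {0..1}) (subtopology X S)) (UNIV \<times> T)"
    proof -
      have "T \<inter> (S \<inter> topspace X) = T \<inter> topspace X" using assms(3) by blast
      then show ?thesis
        by (simp add: prod_topology_subtopology subtopology_subtopology Times_Int_Times Int_commute Int_left_commute)
    qed
    then show ?thesis using continuous_map_from_subtopology[OF h(1)] by metis
  qed
  moreover have "h \<in> topspace (prod_topology (top_of_set {0..1}) (subtopology X T)) \<rightarrow> T"
    using h(4) assms(2) by fastforce
  ultimately have "continuous_map (prod_topology (top_of_set {0..1}) (subtopology X T)) (subtopology X T) h"
    by (auto simp: continuous_map_in_subtopology image_subset_iff_funcset)
  then show ?thesis unfolding homotopic_with_def using h assms(2) by blast
qed

text \<open>
  The excision axiom asks for a closure inside an interior, which fails for closed \<open>D\<close> and \<open>N\<close>.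
  Enlarging \<open>D\<close> to a neighbourhood \<open>P\<close> that deforms into \<open>D\<close>, inside \<open>N\<close> as well as in the whole
  space, changes neither relative group and makes room for the axiom.
\<close>
lemma iso_excision_deformation:
  assumes D: "closedin X D" and P: "openin X P" and "D \<subseteq> P"
    and N: "topspace X - N \<subseteq> D"
    and f: "f ` P \<subseteq> D"
    and hom: "homotopic_with (\<lambda>k. k ` D \<subseteq> D \<and> k ` (N \<inter> P) \<subseteq> N \<inter> P) (subtopology X P) (subtopology X P) f id"
  shows "hom_induced p (subtopology X N) (N \<inter> D) X D id
    \<in> iso (relative_homology_group p (subtopology X N) (N \<inter> D)) (relative_homology_group p X D)"
proof -
  have PX: "P \<subseteq> topspace X" using P openin_subset by blast
  have contf: "continuous_map (subtopology X P) (subtopology X P) f"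
    using hom homotopic_with_imp_continuous_maps by blast
  have a: "trivial_group (relative_homology_group p (subtopology X P) D)" for p
  proof (rule trivial_relative_homology_group_alt)
    show "continuous_map (subtopology X P) (subtopology (subtopology X P) D) f"
      using contf f by (auto simp: continuous_map_in_subtopology)
    show "homotopic_with (\<lambda>k. k ` D \<subseteq> D) (subtopology X P) (subtopology X P) f id"
      using hom by (rule homotopic_with_mono) auto
  qed
  have homN: "homotopic_with (\<lambda>k. k ` (N \<inter> D) \<subseteq> N \<inter> D) (subtopology X (N \<inter> P)) (subtopology X (N \<inter> P)) f id"
    by (rule homotopic_with_subtopology_id[OF hom]) (use \<open>D \<subseteq> P\<close> in blast)+
  have b: "trivial_group (relative_homology_group p (subtopology (subtopology X N) (N \<inter> P)) (N \<inter> D))" for p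
  proof (rule trivial_relative_homology_group_alt)
    have eq: "subtopology (subtopology X N) (N \<inter> P) = subtopology X (N \<inter> P)"
      by (simp add: subtopology_subtopology flip: Int_assoc)
    have "continuous_map (subtopology X (N \<inter> P)) (subtopology X (N \<inter> P)) f"
      using homN homotopic_with_imp_continuous_maps by blast
    then show "continuous_map (subtopology (subtopology X N) (N \<inter> P))
        (subtopology (subtopology (subtopology X N) (N \<inter> P)) (N \<inter> D)) f"
      using f unfolding eq by (auto simp: continuous_map_in_subtopology Pi_iff image_subset_iff)
    show "homotopic_with (\<lambda>k. k ` (N \<inter> D) \<subseteq> N \<inter> D) (subtopology (subtopology X N) (N \<inter> P))
       (subtopology (subtopology X N) (N \<inter> P)) f id"
      using homN unfolding eq .
  qed
  have i1: "hom_induced p X D X P id \<in> iso (relative_homology_group p X D) (relative_homology_group p X P)"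
    by (rule iso_relative_enlarge[OF \<open>D \<subseteq> P\<close> a])
  have i2: "hom_induced p (subtopology X N) (N \<inter> D) (subtopology X N) (N \<inter> P) id
     \<in> iso (relative_homology_group p (subtopology X N) (N \<inter> D)) (relative_homology_group p (subtopology X N) (N \<inter> P))"
    by (rule iso_relative_enlarge[OF _ b]) (use \<open>D \<subseteq> P\<close> in auto)
  have i3: "hom_induced p (subtopology X N) (N \<inter> P) X P id
     \<in> iso (relative_homology_group p (subtopology X N) (N \<inter> P)) (relative_homology_group p X P)"
  proof -
    let ?U = "topspace X - N"
    have "X closure_of ?U \<subseteq> D" using D N by (simp add: closure_of_minimal)
    then have "X closure_of ?U \<subseteq> X interior_of P" using P \<open>D \<subseteq> P\<close> by (auto simp: interior_of_openin)
    from homology_excision_axiom[OF this PX, of p]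
    have "hom_induced p (subtopology X (topspace X - ?U)) (P - ?U) X P id
      \<in> iso (relative_homology_group p (subtopology X (topspace X - ?U)) (P - ?U)) (relative_homology_group p X P)"
      by simp
    moreover have "topspace X - ?U = topspace X \<inter> N" "P - ?U = N \<inter> P" using PX by auto
    ultimately show ?thesis by (simp add: subtopology_restrict)
  qed
  let ?h = "hom_induced p (subtopology X N) (N \<inter> D) X D id"
  let ?G = "relative_homology_group p (subtopology X N) (N \<inter> D)" and ?H = "relative_homology_group p X D"
  have sq: "hom_induced p X D X P id (?h x) =
     hom_induced p (subtopology X N) (N \<inter> P) X P id
       (hom_induced p (subtopology X N) (N \<inter> D) (subtopology X N) (N \<inter> P) id x)" for x
  proof -
    have "hom_induced p X D X P id (?h x) = hom_induced p (subtopology X N) (N \<inter> D) X P (id \<circ> id) x"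
      by (rule hom_induced_compose') (use \<open>D \<subseteq> P\<close> in auto)
    moreover have "hom_induced p (subtopology X N) (N \<inter> P) X P id
       (hom_induced p (subtopology X N) (N \<inter> D) (subtopology X N) (N \<inter> P) id x) =
       hom_induced p (subtopology X N) (N \<inter> D) X P (id \<circ> id) x"
      by (rule hom_induced_compose') (use \<open>D \<subseteq> P\<close> in auto)
    ultimately show ?thesis by simp
  qed
  have "bij_betw (hom_induced p X D X P id \<circ> ?h) (carrier ?G) (carrier (relative_homology_group p X P))"
  proof -
    have "bij_betw (hom_induced p (subtopology X N) (N \<inter> P) X P id \<circ>
        hom_induced p (subtopology X N) (N \<inter> D) (subtopology X N) (N \<inter> P) id)
        (carrier ?G) (carrier (relative_homology_group p X P))"
      using i2 i3 by (auto simp: iso_def intro: bij_betw_trans)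
    moreover have "hom_induced p X D X P id \<circ> ?h = hom_induced p (subtopology X N) (N \<inter> P) X P id \<circ>
        hom_induced p (subtopology X N) (N \<inter> D) (subtopology X N) (N \<inter> P) id"
      using sq by auto
    ultimately show ?thesis by simp
  qed
  then have "bij_betw ?h (carrier ?G) (carrier ?H)"
    using i1 by (subst bij_betw_comp_iff2[of "hom_induced p X D X P id" "carrier ?H" "carrier (relative_homology_group p X P)"])
      (auto simp: iso_def hom_induced_carrier)
  then show ?thesis by (simp add: iso_def hom_induced_hom)
qed

section \<open>Cylinders\<close>

text \<open>
  Additivity for a space that is a disjoint union of two embedded open pieces.
\<close>
lemma iso_homology_two_pieces:
  assumes f: "embedding_map A Z f" and g: "embedding_map B Z g"
    and S: "openin Z (f ` topspace A)" and T: "openin Z (g ` topspace B)"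
    and disj: "f ` topspace A \<inter> g ` topspace B = {}"
    and cover: "topspace Z \<subseteq> f ` topspace A \<union> g ` topspace B"
  shows "(\<lambda>(a, b). hom_induced p A {} Z {} f a \<otimes>\<^bsub>homology_group p Z\<^esub> hom_induced p B {} Z {} g b)
    \<in> iso (homology_group p A \<times>\<times> homology_group p B) (homology_group p Z)"
proof -
  let ?S = "f ` topspace A" and ?T = "g ` topspace B"
  let ?f = "hom_induced p A {} (subtopology Z ?S) {} f"
  let ?g = "hom_induced p B {} (subtopology Z ?T) {} g"
  have "?f \<in> iso (homology_group p A) (homology_group p (subtopology Z ?S))"
    "?g \<in> iso (homology_group p B) (homology_group p (subtopology Z ?T))"
    using f g by (auto simp: embedding_map_def intro: homeomorphic_map_homology_iso)
  then have 1: "(\<lambda>(x, y). (?f x, ?g y)) \<in> iso (homology_group p A \<times>\<times> homology_group p B)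
      (homology_group p (subtopology Z ?S) \<times>\<times> homology_group p (subtopology Z ?T))"
    by (simp add: iso_paired2)
  have "?S \<union> ?T = topspace Z"
    using cover S T openin_subset by blast
  then have 2: "(\<lambda>(a, b). hom_induced p (subtopology Z ?S) {} Z {} id a
         \<otimes>\<^bsub>homology_group p Z\<^esub> hom_induced p (subtopology Z ?T) {} Z {} id b)
      \<in> iso (homology_group p (subtopology Z ?S) \<times>\<times> homology_group p (subtopology Z ?T)) (homology_group p Z)"
    using homology_additivity_explicit[OF S T] disj by (simp add: disjnt_def)
  have cf: "continuous_map A (subtopology Z ?S) f" "continuous_map B (subtopology Z ?T) g"
    using f g by (auto simp: embedding_map_def homeomorphic_imp_continuous_map)
  have e: "hom_induced p (subtopology Z ?S) {} Z {} id (?f x) = hom_induced p A {} Z {} f x"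
    "hom_induced p (subtopology Z ?T) {} Z {} id (?g y) = hom_induced p B {} Z {} g y" for x y
    using hom_induced_compose'[OF cf(1), of "{}" "{}" Z id "{}"] hom_induced_compose'[OF cf(2), of "{}" "{}" Z id "{}"]
    by simp_all
  show ?thesis
    using iso_set_trans[OF 1 2] by (simp add: o_def case_prod_unfold e)
qed

definition cylinder :: "'m topology \<Rightarrow> ('m \<times> real) topology" where
  "cylinder M = prod_topology M (top_of_set {0..1})"

definition cylinder_ends :: "'m topology \<Rightarrow> ('m \<times> real) set" where
  "cylinder_ends M = topspace M \<times> {0, 1}"

lemma topspace_cylinder [simp]: "topspace (cylinder M) = topspace M \<times> {0..1}"
  by (simp add: cylinder_def)

lemma cylinder_ends_subset: "cylinder_ends M \<subseteq> topspace (cylinder M)"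
  by (auto simp: cylinder_ends_def)

lemma continuous_map_cylinder_level:
  assumes "t \<in> {0..1}"
  shows "continuous_map M (cylinder M) (\<lambda>m. (m, t))"
  using assms by (simp add: cylinder_def continuous_map_pairwise o_def)

lemma homotopic_cylinder_levels:
  assumes "s \<in> {0..1}" "t \<in> {0..1}"
  shows "homotopic_with (\<lambda>_. True) M (cylinder M) (\<lambda>m. (m, s)) (\<lambda>m. (m, t))"
proof -
  have "continuous_map (prod_topology (top_of_set {0..1}) M) (cylinder M) (\<lambda>(r, m). (m, (1 - r) * s + r * t))"
  proof -
    have c: "continuous_map (prod_topology (top_of_set {0..1::real}) M) euclideanreal (\<lambda>x. (1 - fst x) * s + fst x * t)"
      by (intro continuous_intros continuous_map_fst[THEN continuous_map_into_fulltopology])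
    have "(1 - r) * s + r * t \<in> {0..1}" if "r \<in> {0..1}" for r
      using that assms convex_bound_le[of s 1 t "1 - r" r] by auto
    then have "(\<lambda>x. (1 - fst x) * s + fst x * t) \<in> topspace (prod_topology (top_of_set {0..1}) M) \<rightarrow> {0..1}"
      by (simp add: Pi_iff mem_Times_iff)
    from continuous_map_into_subtopology[OF c this] show ?thesis
      unfolding cylinder_def case_prod_unfold
      by (intro continuous_map_pairedI continuous_map_snd)
  qed
  then show ?thesis
    unfolding homotopic_with_def by (intro exI[of _ "\<lambda>(r, m). (m, (1 - r) * s + r * t)"]) auto
qed

lemma hom_induced_cylinder_levels_eq:
  assumes "s \<in> {0..1}" "t \<in> {0..1}"
  shows "hom_induced p M {} (cylinder M) {} (\<lambda>m. (m, s)) = hom_induced p M {} (cylinder M) {} (\<lambda>m. (m, t))"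
  by (intro homology_homotopy_empty homotopic_cylinder_levels assms)

lemma iso_cylinder_level:
  assumes "t \<in> {0..1}"
  shows "hom_induced p M {} (cylinder M) {} (\<lambda>m. (m, t)) \<in> iso (homology_group p M) (homology_group p (cylinder M))"
proof (rule homotopy_equivalence_homology_group_isomorphism)
  show "continuous_map M (cylinder M) (\<lambda>m. (m, t))"
    by (rule continuous_map_cylinder_level[OF assms])
  show "continuous_map (cylinder M) M fst"
    by (simp add: cylinder_def continuous_map_fst)
  show "homotopic_with (\<lambda>x. True) M M (fst \<circ> (\<lambda>m. (m, t))) id"
    by (simp add: o_def id_def)
  show "homotopic_with (\<lambda>k. True) (cylinder M) (cylinder M) ((\<lambda>m. (m, t)) \<circ> fst) id"
  proof -
    have "continuous_map (prod_topology (top_of_set {0..1}) (cylinder M)) (cylinder M) (\<lambda>(r, m). (fst m, (1 - r) * t + r * snd m))"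
    proof -
      have "continuous_map (prod_topology (top_of_set {0..1::real}) (prod_topology M (top_of_set {0..1}))) euclideanreal
          (\<lambda>x. (1 - fst x) * t + fst x * snd (snd x))"
      proof -
        have "continuous_map (prod_topology (top_of_set {0..1::real}) (prod_topology M (top_of_set {0..1}))) euclideanreal (snd \<circ> snd)"
          using continuous_map_into_fulltopology[OF continuous_map_snd] by (rule continuous_map_compose[OF continuous_map_snd])
        then show ?thesis
          by (intro continuous_intros continuous_map_fst[THEN continuous_map_into_fulltopology])
             (auto simp: o_def)
      qed
      moreover have "(1 - r) * t + r * s \<in> {0..1}" if "r \<in> {0..1}" "s \<in> {0..1}" for r s
        using that assms convex_bound_le[of t 1 s "1 - r" r] by auto
      ultimately show ?thesis
        unfolding cylinder_def case_prod_unfold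
        by (intro continuous_map_pairedI continuous_map_into_subtopology
            continuous_map_compose[OF continuous_map_snd continuous_map_fst, unfolded o_def]) auto
    qed
    then show ?thesis
      unfolding homotopic_with_def
      by (intro exI[of _ "\<lambda>(r, m). (fst m, (1 - r) * t + r * snd m)"]) auto
  qed
qed

lemma embedding_map_cylinder_end:
  assumes "t \<in> {0, 1}"
  shows "embedding_map M (subtopology (cylinder M) (cylinder_ends M)) (\<lambda>m. (m, t))"
proof -
  have "embedding_map M (cylinder M) (\<lambda>m. (m, t))"
    unfolding cylinder_def embedding_map_graph using assms by auto
  then show ?thesis using assms by (auto simp: embedding_map_in_subtopology cylinder_ends_def)
qed

lemma openin_cylinder_end:
  assumes "t \<in> {0, 1}"
  shows "openin (subtopology (cylinder M) (cylinder_ends M)) ((\<lambda>m. (m, t)) ` topspace M)"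
proof -
  have "openin (cylinder M) (topspace M \<times> ({0..1} \<inter> ball t (1/2)))"
    unfolding cylinder_def by (intro openin_prod_Times_iff[THEN iffD2]) (auto simp: openin_open)
  moreover have "(\<lambda>m. (m, t)) ` topspace M = cylinder_ends M \<inter> (topspace M \<times> ({0..1} \<inter> ball t (1/2)))"
    using assms by (auto simp: cylinder_ends_def dist_real_def)
  ultimately show ?thesis by (metis openin_subtopology_Int2)
qed

text \<open>
  For \<open>t = 0\<close> and \<open>t = 1\<close> these are the two copies of \<open>M\<close> that make up the ends of the cylinder.
\<close>
definition end_map :: "int \<Rightarrow> 'm topology \<Rightarrow> real \<Rightarrow> 'm chain set \<Rightarrow> ('m \<times> real) chain set" where
  "end_map p M t = hom_induced p M {} (subtopology (cylinder M) (cylinder_ends M)) {} (\<lambda>m. (m, t))"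

lemma iso_cylinder_ends:
  "(\<lambda>(a, b). end_map p M 0 a \<otimes>\<^bsub>homology_group p (subtopology (cylinder M) (cylinder_ends M))\<^esub> end_map p M 1 b)
   \<in> iso (homology_group p M \<times>\<times> homology_group p M) (homology_group p (subtopology (cylinder M) (cylinder_ends M)))"
  unfolding end_map_def
  by (rule iso_homology_two_pieces)
     (auto simp: embedding_map_cylinder_end openin_cylinder_end, auto simp: cylinder_ends_def)

lemma end_map_hom: "end_map p M t \<in> hom (homology_group p M) (homology_group p (subtopology (cylinder M) (cylinder_ends M)))"
  by (simp add: end_map_def hom_induced_hom)

lemma end_map_incl:
  assumes "t \<in> {0, 1}"
  shows "hom_induced p (subtopology (cylinder M) (cylinder_ends M)) {} (cylinder M) {} id (end_map p M t a)
    = hom_induced p M {} (cylinder M) {} (\<lambda>m. (m, 0)) a"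
proof -
  have "hom_induced p (subtopology (cylinder M) (cylinder_ends M)) {} (cylinder M) {} id (end_map p M t a)
    = hom_induced p M {} (cylinder M) {} (id \<circ> (\<lambda>m. (m, t))) a"
    unfolding end_map_def
    by (rule hom_induced_compose')
       (use assms continuous_map_cylinder_level[of t M] in \<open>auto simp: continuous_map_in_subtopology cylinder_ends_def\<close>)
  then show ?thesis
    using hom_induced_cylinder_levels_eq[of t 0 p M] assms by (force simp: o_def)
qed

definition ends_difference :: "int \<Rightarrow> 'm topology \<Rightarrow> 'm chain set \<Rightarrow> ('m \<times> real) chain set" where
  "ends_difference p M z = end_map p M 0 z
     \<otimes>\<^bsub>homology_group p (subtopology (cylinder M) (cylinder_ends M))\<^esub>
       inv\<^bsub>homology_group p (subtopology (cylinder M) (cylinder_ends M))\<^esub> end_map p M 1 z"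

lemma hom_mult_inv:
  assumes "f \<in> hom G H" "g \<in> hom G H" "comm_group H" "group G"
  shows "(\<lambda>z. f z \<otimes>\<^bsub>H\<^esub> inv\<^bsub>H\<^esub> g z) \<in> hom G H"
proof (rule homI)
  interpret H: comm_group H by fact
  interpret f: group_hom G H f using assms by (simp add: group_hom_def group_hom_axioms_def H.is_group)
  interpret g: group_hom G H g using assms by (simp add: group_hom_def group_hom_axioms_def H.is_group)
  fix x y assume "x \<in> carrier G" "y \<in> carrier G"
  then show "f (x \<otimes>\<^bsub>G\<^esub> y) \<otimes>\<^bsub>H\<^esub> inv\<^bsub>H\<^esub> g (x \<otimes>\<^bsub>G\<^esub> y) = f x \<otimes>\<^bsub>H\<^esub> inv\<^bsub>H\<^esub> g x \<otimes>\<^bsub>H\<^esub> (f y \<otimes>\<^bsub>H\<^esub> inv\<^bsub>H\<^esub> g y)"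
    by (simp add: H.inv_mult H.m_ac)
next
  fix x assume "x \<in> carrier G"
  with assms show "f x \<otimes>\<^bsub>H\<^esub> inv\<^bsub>H\<^esub> g x \<in> carrier H"
    by (metis comm_group_def group.inv_closed hom_in_carrier monoid.m_closed group.is_monoid)
qed

lemma ends_difference_hom:
  "ends_difference p M \<in> hom (homology_group p M) (homology_group p (subtopology (cylinder M) (cylinder_ends M)))"
  using hom_mult_inv[OF end_map_hom[of p M 0] end_map_hom[of p M 1]]
  by (simp add: ends_difference_def[abs_def])

text \<open>
  The homology of the ends consists of two copies of that of \<open>M\<close>, which the inclusion into the
  cylinder adds up. Its kernel, the image of the boundary, is therefore the antidiagonal.
\<close>
lemma bij_betw_ends_difference:
  "bij_betw (ends_difference (p-1) M) (carrier (homology_group (p-1) M))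
     (hom_boundary p (cylinder M) (cylinder_ends M) ` carrier (relative_homology_group p (cylinder M) (cylinder_ends M)))"
proof -
  define q where "q = p - 1"
  let ?E = "subtopology (cylinder M) (cylinder_ends M)"
  let ?G = "homology_group q M" and ?H = "homology_group q ?E"
  let ?C = "homology_group q (cylinder M)"
  let ?i = "hom_induced q ?E {} (cylinder M) {} id"
  let ?l = "hom_induced q M {} (cylinder M) {} (\<lambda>m. (m, 0))"
  interpret H: comm_group ?H by simp
  interpret C: comm_group ?C by simp
  interpret G: comm_group ?G by simp
  interpret i: group_hom ?H ?C ?i by simp
  interpret l: group_hom ?G ?C ?l by simp
  interpret e0: group_hom ?G ?H "end_map q M 0"
    by (simp add: group_hom_def group_hom_axioms_def end_map_hom)
  interpret e1: group_hom ?G ?H "end_map q M 1"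
    by (simp add: group_hom_def group_hom_axioms_def end_map_hom)
  let ?\<phi> = "\<lambda>(a, b). end_map q M 0 a \<otimes>\<^bsub>?H\<^esub> end_map q M 1 b"
  have \<phi>: "bij_betw ?\<phi> (carrier ?G \<times> carrier ?G) (carrier ?H)"
    using iso_cylinder_ends[of q M] by (simp add: iso_def)
  have l: "bij_betw ?l (carrier ?G) (carrier ?C)"
    using iso_cylinder_level[of 0 q M] by (simp add: iso_def)
  have d: "ends_difference q M z = ?\<phi> (z, inv\<^bsub>?G\<^esub> z)" if "z \<in> carrier ?G" for z
    using that by (simp add: ends_difference_def)
  have inj: "inj_on (ends_difference q M) (carrier ?G)"
  proof (rule inj_onI)
    fix x y assume xy: "x \<in> carrier ?G" "y \<in> carrier ?G" "ends_difference q M x = ends_difference q M y"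
    then have "?\<phi> (x, inv\<^bsub>?G\<^esub> x) = ?\<phi> (y, inv\<^bsub>?G\<^esub> y)"
      by (simp only: d)
    then show "x = y"
      using \<phi> xy inj_onD[of ?\<phi> "carrier ?G \<times> carrier ?G" "(x, inv\<^bsub>?G\<^esub> x)" "(y, inv\<^bsub>?G\<^esub> y)"]
      by (simp add: bij_betw_def)
  qed
  have "ends_difference q M ` carrier ?G = kernel ?H ?C ?i"
  proof (intro equalityI subsetI)
    fix w assume "w \<in> ends_difference q M ` carrier ?G"
    then obtain z where z: "z \<in> carrier ?G" "w = ends_difference q M z" by blast
    then have "?i w = \<one>\<^bsub>?C\<^esub>"
      by (simp add: ends_difference_def end_map_incl)
    then show "w \<in> kernel ?H ?C ?i"
      using z by (simp add: kernel_def ends_difference_def)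
  next
    fix w assume "w \<in> kernel ?H ?C ?i"
    then have w: "w \<in> carrier ?H" "?i w = \<one>\<^bsub>?C\<^esub>" by (auto simp: kernel_def)
    have "w \<in> ?\<phi> ` (carrier ?G \<times> carrier ?G)" using \<phi> w by (simp add: bij_betw_def)
    then obtain a b where ab: "a \<in> carrier ?G" "b \<in> carrier ?G" "w = ?\<phi> (a, b)"
      by fast
    then have "?l (a \<otimes>\<^bsub>?G\<^esub> b) = ?l \<one>\<^bsub>?G\<^esub>"
      using w by (simp add: end_map_incl)
    then have "a \<otimes>\<^bsub>?G\<^esub> b = \<one>\<^bsub>?G\<^esub>"
      using l ab unfolding bij_betw_def inj_on_def by blast
    then have "b = inv\<^bsub>?G\<^esub> a" using ab by (metis G.inv_equality G.m_comm)
    then show "w \<in> ends_difference q M ` carrier ?G" using ab d by auto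
  qed
  with inj kernel_hom_induced_subspace[of q "cylinder M" "cylinder_ends M"] show ?thesis
    by (simp add: bij_betw_def q_def)
qed

text \<open>
  Already one end carries the homology of the cylinder, so absolute classes die relative to the ends.
\<close>
lemma inj_on_cylinder_boundary:
  "inj_on (hom_boundary p (cylinder M) (cylinder_ends M)) (carrier (relative_homology_group p (cylinder M) (cylinder_ends M)))"
proof -
  let ?E = "subtopology (cylinder M) (cylinder_ends M)"
  let ?R = "relative_homology_group p (cylinder M) (cylinder_ends M)"
  have surj: "hom_induced p ?E {} (cylinder M) {} id ` carrier (homology_group p ?E) = carrier (homology_group p (cylinder M))"
  proof (intro equalityI subsetI)
    fix y assume "y \<in> carrier (homology_group p (cylinder M))"
    then obtain a where "a \<in> carrier (homology_group p M)" "y = hom_induced p M {} (cylinder M) {} (\<lambda>m. (m, 0)) a"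
      using iso_cylinder_level[of 0 p M] by (auto simp: iso_def bij_betw_def)
    then show "y \<in> hom_induced p ?E {} (cylinder M) {} id ` carrier (homology_group p ?E)"
      by (metis end_map_incl[of 0 p M a] end_map_def hom_induced_carrier imageI insertI1)
  qed (auto simp: hom_induced_carrier)
  have "hom_induced p (cylinder M) {} (cylinder M) (cylinder_ends M) id ` carrier (homology_group p (cylinder M)) = {\<one>\<^bsub>?R\<^esub>}"
  proof -
    have "hom_induced p (cylinder M) {} (cylinder M) (cylinder_ends M) id y = \<one>\<^bsub>?R\<^esub>"
      if "y \<in> carrier (homology_group p (cylinder M))" for y
      using that kernel_hom_induced_relativization[of p "cylinder M" "cylinder_ends M"] surj
      by (auto simp: kernel_def)
    then show ?thesis
      by (auto simp: image_iff) (metis group.is_monoid group_relative_homology_group monoid.one_closed)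
  qed
  then have "kernel ?R (homology_group (p-1) ?E) (hom_boundary p (cylinder M) (cylinder_ends M)) = {\<one>\<^bsub>?R\<^esub>}"
    by (simp add: kernel_hom_boundary)
  then show ?thesis by (metis group_hom.trivial_ker_imp_inj group_hom_hom_boundary)
qed

text \<open>
  The suspension of \<open>z\<close>: up to sign, its cross product with the unit interval. Characterizing it by
  its boundary makes naturality a consequence of uniqueness.
\<close>
definition cylinder_class :: "int \<Rightarrow> 'm topology \<Rightarrow> 'm chain set \<Rightarrow> ('m \<times> real) chain set" where
  "cylinder_class p M z = (THE w. w \<in> carrier (relative_homology_group p (cylinder M) (cylinder_ends M)) \<and>
     hom_boundary p (cylinder M) (cylinder_ends M) w = ends_difference (p-1) M z)"

lemma cylinder_class_unique:
  assumes "w \<in> carrier (relative_homology_group p (cylinder M) (cylinder_ends M))"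
    "hom_boundary p (cylinder M) (cylinder_ends M) w = ends_difference (p-1) M z"
  shows "cylinder_class p M z = w"
  unfolding cylinder_class_def
  by (rule the_equality) (use assms inj_on_cylinder_boundary[of p M] in \<open>auto simp: inj_on_def\<close>)

lemma cylinder_class:
  assumes "z \<in> carrier (homology_group (p-1) M)"
  shows "cylinder_class p M z \<in> carrier (relative_homology_group p (cylinder M) (cylinder_ends M))"
    and "hom_boundary p (cylinder M) (cylinder_ends M) (cylinder_class p M z) = ends_difference (p-1) M z"
proof -
  obtain w where "w \<in> carrier (relative_homology_group p (cylinder M) (cylinder_ends M))"
    "hom_boundary p (cylinder M) (cylinder_ends M) w = ends_difference (p-1) M z"
    using bij_betw_imp_surj_on[OF bij_betw_ends_difference[of p M]] assms by (metis (no_types) imageE imageI)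
  then show "cylinder_class p M z \<in> carrier (relative_homology_group p (cylinder M) (cylinder_ends M))"
    and "hom_boundary p (cylinder M) (cylinder_ends M) (cylinder_class p M z) = ends_difference (p-1) M z"
    using cylinder_class_unique[of w p M z] by simp_all
qed

lemma iso_cylinder_class:
  "cylinder_class p M \<in> iso (homology_group (p-1) M) (relative_homology_group p (cylinder M) (cylinder_ends M))"
proof -
  let ?G = "homology_group (p-1) M" and ?R = "relative_homology_group p (cylinder M) (cylinder_ends M)"
  let ?E = "homology_group (p-1) (subtopology (cylinder M) (cylinder_ends M))"
  let ?b = "hom_boundary p (cylinder M) (cylinder_ends M)"
  interpret R: comm_group ?R by simp
  interpret b: group_hom ?R ?E ?b by simp
  interpret e: group_hom ?G ?E "ends_difference (p-1) M"
    by (simp add: group_hom_def group_hom_axioms_def ends_difference_hom)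
  have h: "cylinder_class p M \<in> hom ?G ?R"
  proof (rule homI)
    fix x y assume xy: "x \<in> carrier ?G" "y \<in> carrier ?G"
    show "cylinder_class p M (x \<otimes>\<^bsub>?G\<^esub> y) = cylinder_class p M x \<otimes>\<^bsub>?R\<^esub> cylinder_class p M y"
    proof (rule cylinder_class_unique)
      show "cylinder_class p M x \<otimes>\<^bsub>?R\<^esub> cylinder_class p M y \<in> carrier ?R"
        using xy by (simp add: cylinder_class)
      show "?b (cylinder_class p M x \<otimes>\<^bsub>?R\<^esub> cylinder_class p M y) = ends_difference (p-1) M (x \<otimes>\<^bsub>?G\<^esub> y)"
        using xy by (simp add: cylinder_class)
    qed
  qed (simp add: cylinder_class)
  have "bij_betw (cylinder_class p M) (carrier ?G) (carrier ?R)"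
  proof (rule bij_betw_imageI)
    show "inj_on (cylinder_class p M) (carrier ?G)"
    proof (rule inj_onI)
      fix x y assume xy: "x \<in> carrier ?G" "y \<in> carrier ?G" "cylinder_class p M x = cylinder_class p M y"
      then have "ends_difference (p-1) M x = ends_difference (p-1) M y"
        by (metis cylinder_class(2))
      with xy show "x = y"
        using bij_betw_imp_inj_on[OF bij_betw_ends_difference[of p M]] by (simp add: inj_on_eq_iff)
    qed
    show "cylinder_class p M ` carrier ?G = carrier ?R"
    proof (intro equalityI subsetI)
      fix w assume w: "w \<in> carrier ?R"
      then obtain z where "z \<in> carrier ?G" "?b w = ends_difference (p-1) M z"
        using bij_betw_imp_surj_on[OF bij_betw_ends_difference[of p M]] by (metis (no_types) imageE imageI)
      with w show "w \<in> cylinder_class p M ` carrier ?G"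
        using cylinder_class_unique[of w p M z] by blast
    qed (auto simp: cylinder_class)
  qed
  with h show ?thesis by (simp add: iso_def)
qed

section \<open>Tubes\<close>

text \<open>
  Moves every parameter other than \<open>1/2\<close> to the nearer end of the unit interval as \<open>s\<close> decreases
  from 1 to 0: subtract from \<open>t\<close> and \<open>1 - t\<close> the multiple \<open>1 - s\<close> of their minimum and renormalize.
\<close>
definition squeeze :: "real \<Rightarrow> real \<Rightarrow> real" where
  "squeeze s t = (t - (1 - s) * min t (1 - t)) / (1 - 2 * (1 - s) * min t (1 - t))"

lemma squeeze_denominator:
  fixes s t :: real
  assumes "0 \<le> s" "s \<le> 1" "t \<noteq> 1/2"
  shows "0 < 1 - 2 * (1 - s) * min t (1 - t)"
proof -
  have "min t (1 - t) < 1/2" using assms(3) by linarith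
  then have "(1 - s) * min t (1 - t) < 1/2"
    using assms mult_right_mono[of "1 - s" 1 "min t (1 - t)"] mult_nonneg_nonpos[of "1 - s" "min t (1 - t)"]
    by (cases "0 \<le> min t (1 - t)") (simp_all del: min_less_iff_conj)
  then show ?thesis by (simp only: mult.assoc)
qed

lemma squeeze_range:
  assumes "0 \<le> s" "s \<le> 1" "0 \<le> t" "t \<le> 1" "t \<noteq> 1/2"
  shows "0 \<le> squeeze s t" "squeeze s t \<le> 1" "squeeze s t \<noteq> 1/2"
proof -
  have d: "0 < 1 - 2 * (1 - s) * min t (1 - t)" by (rule squeeze_denominator) (use assms in auto)
  have m: "0 \<le> min t (1 - t)" "min t (1 - t) \<le> t" "min t (1 - t) \<le> 1 - t" using assms by auto
  have c: "(1 - s) * min t (1 - t) \<le> min t (1 - t)" using assms(1) mult_right_mono[of "1 - s" 1, OF _ m(1)] by simp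
  show "0 \<le> squeeze s t" unfolding squeeze_def by (intro divide_nonneg_pos d) (use c m in linarith)
  have "t - (1 - s) * min t (1 - t) \<le> 1 - 2 * (1 - s) * min t (1 - t)" using c m by linarith
  then show "squeeze s t \<le> 1" unfolding squeeze_def using d by (simp only: divide_le_eq_1_pos)
  show "squeeze s t \<noteq> 1/2"
  proof
    assume "squeeze s t = 1/2"
    then have "2 * (t - (1 - s) * min t (1 - t)) = 1 - 2 * (1 - s) * min t (1 - t)"
      using d by (simp add: squeeze_def frac_eq_eq del: mult_minus_right)
    moreover have "2 * (t - a) = 1 - 2 * a \<Longrightarrow> 2 * t = 1" for a :: real by simp
    ultimately have "2 * t = 1" by (simp only: mult.assoc)
    with assms(5) show False by simp
  qed
qed

lemma squeeze_simps: 
  "squeeze 1 t = t" "squeeze s 0 = 0" "squeeze s 1 = 1"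
  "t \<noteq> 1/2 \<Longrightarrow> squeeze 0 t = 0 \<or> squeeze 0 t = 1"
  by (auto simp: squeeze_def min_def divide_eq_eq)

text \<open>
  A space \<open>X\<close> made from a closed subspace \<open>D\<close> by attaching a cylinder \<open>N\<close> over \<open>M\<close> along its two
  ends. The inverse \<open>\<gamma>\<close> of the parametrization \<open>\<kappa>\<close> is a parameter because the deformation below is
  written with it.
\<close>
locale tube =
  fixes M :: "'m topology" and X :: "'x topology" and D N :: "'x set"
    and \<kappa> :: "'m \<times> real \<Rightarrow> 'x" and \<gamma> :: "'x \<Rightarrow> 'm \<times> real"
  assumes closedin_D: "closedin X D" and closedin_N: "closedin X N"
    and cover: "topspace X \<subseteq> D \<union> N"
    and tube_homeo: "homeomorphic_maps (cylinder M) (subtopology X N) \<kappa> \<gamma>"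
    and tube_ends: "\<And>m t. \<lbrakk>m \<in> topspace M; 0 \<le> t; t \<le> 1\<rbrakk> \<Longrightarrow> \<kappa> (m, t) \<in> D \<longleftrightarrow> t = 0 \<or> t = 1"
begin

lemma N_subset: "N \<subseteq> topspace X" and D_subset: "D \<subseteq> topspace X"
  using closedin_D closedin_N closedin_subset by blast+

lemma kappa_cont: "continuous_map (cylinder M) X \<kappa>"
  using tube_homeo by (auto simp: homeomorphic_maps_def continuous_map_in_subtopology)

lemma gamma_cont: "continuous_map (subtopology X N) (cylinder M) \<gamma>"
  using tube_homeo by (auto simp: homeomorphic_maps_def)

lemma kappa_in: "\<lbrakk>m \<in> topspace M; 0 \<le> t; t \<le> 1\<rbrakk> \<Longrightarrow> \<kappa> (m, t) \<in> N"
  using tube_homeo by (force simp: homeomorphic_maps_def continuous_map_def)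

lemma gamma_kappa: "\<lbrakk>m \<in> topspace M; 0 \<le> t; t \<le> 1\<rbrakk> \<Longrightarrow> \<gamma> (\<kappa> (m, t)) = (m, t)"
  using tube_homeo by (auto simp: homeomorphic_maps_def)

lemma kappa_gamma: "x \<in> N \<Longrightarrow> \<kappa> (\<gamma> x) = x"
  using tube_homeo N_subset by (auto simp: homeomorphic_maps_def)

lemma gamma_in: "x \<in> N \<Longrightarrow> fst (\<gamma> x) \<in> topspace M \<and> 0 \<le> snd (\<gamma> x) \<and> snd (\<gamma> x) \<le> 1"
  using gamma_cont N_subset by (force simp: continuous_map_def)

lemma gamma_ends: "x \<in> N \<Longrightarrow> x \<in> D \<longleftrightarrow> snd (\<gamma> x) = 0 \<or> snd (\<gamma> x) = 1"
  using tube_ends[of "fst (\<gamma> x)" "snd (\<gamma> x)"] gamma_in kappa_gamma by simp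

lemma kappa_ends_image: "\<kappa> ` cylinder_ends M = N \<inter> D"
proof (intro equalityI subsetI)
  fix x assume "x \<in> N \<inter> D"
  then show "x \<in> \<kappa> ` cylinder_ends M"
    using gamma_in[of x] gamma_ends[of x] kappa_gamma[of x]
    by (intro image_eqI[of _ _ "\<gamma> x"]) (auto simp: cylinder_ends_def mem_Times_iff)
qed (auto simp: cylinder_ends_def kappa_in tube_ends)

definition core_complement :: "'x set" where
  "core_complement = topspace X - \<kappa> ` (topspace M \<times> {1/2})"

lemma core_complement_iff: "x \<in> N \<Longrightarrow> x \<in> core_complement \<longleftrightarrow> snd (\<gamma> x) \<noteq> 1/2"
proof -
  assume x: "x \<in> N"
  have "x \<in> \<kappa> ` (topspace M \<times> {1/2}) \<longleftrightarrow> snd (\<gamma> x) = 1/2"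
  proof
    assume "snd (\<gamma> x) = 1/2"
    then show "x \<in> \<kappa> ` (topspace M \<times> {1/2})"
      using x gamma_in[of x] kappa_gamma[of x] by (intro image_eqI[of _ _ "\<gamma> x"]) (auto simp: mem_Times_iff)
  qed (auto simp: gamma_kappa)
  then show ?thesis using x N_subset by (auto simp: core_complement_def)
qed

lemma D_core_complement: "D \<subseteq> core_complement"
  using D_subset tube_ends by (auto simp: core_complement_def)

lemma openin_core_complement: "openin X core_complement"
proof -
  have "closedin (cylinder M) (topspace M \<times> {1/2})"
    by (auto simp: cylinder_def closedin_prod_Times_iff)
  then have "closedin (subtopology X N) (\<kappa> ` (topspace M \<times> {1/2}))"
    using tube_homeo homeomorphic_maps_imp_map homeomorphic_imp_closed_map
    by (metis closed_map_def)
  then have "closedin X (\<kappa> ` (topspace M \<times> {1/2}))"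
    using closedin_N closedin_trans_full by blast
  then show ?thesis by (auto simp: core_complement_def)
qed

definition squeeze_homotopy :: "real \<times> 'x \<Rightarrow> 'x" where
  "squeeze_homotopy = (\<lambda>(s, x). if x \<in> N then \<kappa> (fst (\<gamma> x), squeeze s (snd (\<gamma> x))) else x)"

text \<open>
  Continuity is checked on the closed pieces \<open>D\<close> and \<open>N\<close>; on their intersection the homotopy is
  constant.
\<close>
lemma squeeze_homotopy_cont:
  "continuous_map (prod_topology (top_of_set {0..1::real}) (subtopology X core_complement)) (subtopology X core_complement) squeeze_homotopy"
proof -
  let ?P = core_complement
  let ?Z = "prod_topology (top_of_set {0..1::real}) (subtopology X ?P)"
  have inP: "squeeze_homotopy (s, x) \<in> ?P" if "0 \<le> s" "s \<le> 1" "x \<in> ?P" for s x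
  proof (cases "x \<in> N")
    case True
    with that have "snd (\<gamma> x) \<noteq> 1/2" by (simp add: core_complement_iff)
    with True that show ?thesis
      using gamma_in[of x] squeeze_range[of s "snd (\<gamma> x)"] core_complement_iff[OF kappa_in]
      by (simp add: squeeze_homotopy_def gamma_kappa)
  qed (use that in \<open>simp add: squeeze_homotopy_def\<close>)
  have "continuous_map ?Z X squeeze_homotopy"
  proof (rule pasting_lemma_closed[where I = "{True, False}" and T = "\<lambda>b. {0..1::real} \<times> (?P \<inter> (if b then N else D))"
        and f = "\<lambda>b. if b then \<lambda>(s, x). \<kappa> (fst (\<gamma> x), squeeze s (snd (\<gamma> x))) else snd"])
    show "closedin ?Z ({0..1} \<times> (?P \<inter> (if b then N else D)))" for b
    proof -
      have "closedin (subtopology X ?P) (?P \<inter> (if b then N else D))"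
        using closedin_N closedin_D by (auto simp: closedin_subtopology_Int_closed)
      then show ?thesis by (auto simp: closedin_prod_Times_iff)
    qed
    show "continuous_map (subtopology ?Z ({0..1} \<times> (?P \<inter> (if b then N else D)))) X
        (if b then \<lambda>(s, x). \<kappa> (fst (\<gamma> x), squeeze s (snd (\<gamma> x))) else snd)" for b
    proof (cases b)
      case True
      let ?W = "subtopology ?Z ({0..1} \<times> (?P \<inter> N))"
      have g: "continuous_map ?W (cylinder M) (\<lambda>z. \<gamma> (snd z))"
      proof -
        have "continuous_map ?W (subtopology X N) snd"
          by (auto simp: continuous_map_in_subtopology continuous_map_from_subtopology
              intro!: continuous_map_from_subtopology continuous_map_into_fulltopology[OF continuous_map_snd])
        then show ?thesis using continuous_map_compose[OF _ gamma_cont] by (auto simp: o_def)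
      qed
      then have g1: "continuous_map ?W M (\<lambda>z. fst (\<gamma> (snd z)))"
        and g2: "continuous_map ?W (top_of_set {0..1}) (\<lambda>z. snd (\<gamma> (snd z)))"
        by (auto simp: cylinder_def continuous_map_pairwise o_def)
      have s: "continuous_map ?W euclideanreal fst"
        by (intro continuous_map_from_subtopology continuous_map_into_fulltopology[OF continuous_map_fst])
      have g2': "continuous_map ?W euclideanreal (\<lambda>z. snd (\<gamma> (snd z)))"
        using g2 continuous_map_into_fulltopology by blast
      have top: "0 \<le> fst z \<and> fst z \<le> 1 \<and> snd z \<in> N \<and> snd (\<gamma> (snd z)) \<noteq> 1/2" if "z \<in> topspace ?W" for z
        using that core_complement_iff[of "snd z"] by auto
      have "continuous_map ?W euclideanreal (\<lambda>z. squeeze (fst z) (snd (\<gamma> (snd z))))"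
        unfolding squeeze_def
      proof (rule continuous_map_real_divide)
        show "1 - 2 * (1 - fst z) * min (snd (\<gamma> (snd z))) (1 - snd (\<gamma> (snd z))) \<noteq> 0" if "z \<in> topspace ?W" for z
          using top[OF that] squeeze_denominator[of "fst z" "snd (\<gamma> (snd z))"] by auto
      qed (intro continuous_map_diff continuous_map_real_mult continuous_map_real_min s g2', simp_all)+
      moreover have "squeeze (fst z) (snd (\<gamma> (snd z))) \<in> {0..1}" if "z \<in> topspace ?W" for z
        using top[OF that] gamma_in[of "snd z"] squeeze_range[of "fst z" "snd (\<gamma> (snd z))"] by auto
      ultimately have "continuous_map ?W (cylinder M) (\<lambda>z. (fst (\<gamma> (snd z)), squeeze (fst z) (snd (\<gamma> (snd z)))))"
        using g1 by (auto simp: cylinder_def continuous_map_pairwise o_def continuous_map_in_subtopology)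
      then show ?thesis
        using True continuous_map_compose[OF _ kappa_cont] by (auto simp: o_def case_prod_unfold)
    qed (auto intro!: continuous_map_from_subtopology continuous_map_into_fulltopology[OF continuous_map_snd])
  next
    fix i j z
    assume ij: "i \<in> {True, False}" "j \<in> {True, False}"
      and z: "z \<in> topspace ?Z \<inter> {0..1} \<times> (?P \<inter> (if i then N else D)) \<inter> {0..1} \<times> (?P \<inter> (if j then N else D))"
    have e: "\<kappa> (fst (\<gamma> (snd z)), squeeze (fst z) (snd (\<gamma> (snd z)))) = snd z" if "snd z \<in> N" "snd z \<in> D"
      using gamma_ends[OF that(1)] that kappa_gamma[OF that(1)]
      by (metis prod.collapse squeeze_simps(2,3))
    show "(if i then \<lambda>(s, x). \<kappa> (fst (\<gamma> x), squeeze s (snd (\<gamma> x))) else snd) z =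
          (if j then \<lambda>(s, x). \<kappa> (fst (\<gamma> x), squeeze s (snd (\<gamma> x))) else snd) z"
      using z e by (auto simp: case_prod_unfold split: if_splits)
  next
    fix z assume z: "z \<in> topspace ?Z"
    then show "\<exists>j. j \<in> {True, False} \<and> z \<in> {0..1} \<times> (?P \<inter> (if j then N else D)) \<and>
       squeeze_homotopy z = (if j then \<lambda>(s, x). \<kappa> (fst (\<gamma> x), squeeze s (snd (\<gamma> x))) else snd) z"
      using cover by (cases "snd z \<in> N")
        (auto simp: squeeze_homotopy_def case_prod_unfold mem_Times_iff intro!: exI[of _ "snd z \<in> N"])
  qed auto
  then show ?thesis
    using inP by (auto simp: continuous_map_in_subtopology)
qed

text \<open>
  Away from its middle level the tube can be squeezed into \<open>D\<close>, so excision applies.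
\<close>
lemma iso_tube: "hom_induced p (cylinder M) (cylinder_ends M) X D \<kappa> 
    \<in> iso (relative_homology_group p (cylinder M) (cylinder_ends M)) (relative_homology_group p X D)"
proof -
  let ?P = core_complement
  have i1: "hom_induced p (cylinder M) (cylinder_ends M) (subtopology X N) (N \<inter> D) \<kappa>
    \<in> iso (relative_homology_group p (cylinder M) (cylinder_ends M)) (relative_homology_group p (subtopology X N) (N \<inter> D))"
  proof (rule homeomorphic_map_relative_homology_iso)
    show "homeomorphic_map (cylinder M) (subtopology X N) \<kappa>"
      using tube_homeo homeomorphic_maps_map by metis
  qed (simp_all only: cylinder_ends_subset kappa_ends_image)
  have fix_D: "squeeze_homotopy (s, x) = x" if "x \<in> D" for s x
    using gamma_ends[of x] that kappa_gamma[of x]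
    by (auto simp: squeeze_homotopy_def) (metis prod.collapse squeeze_simps(2,3))+
  have i2: "hom_induced p (subtopology X N) (N \<inter> D) X D id
    \<in> iso (relative_homology_group p (subtopology X N) (N \<inter> D)) (relative_homology_group p X D)"
  proof (rule iso_excision_deformation[OF closedin_D openin_core_complement D_core_complement])
    show "(\<lambda>x. squeeze_homotopy (0, x)) ` ?P \<subseteq> D"
    proof clarify
      fix x assume x: "x \<in> ?P"
      show "squeeze_homotopy (0, x) \<in> D"
      proof (cases "x \<in> N")
        case True
        with x show ?thesis
          using gamma_in[of x] squeeze_simps(4)[of "snd (\<gamma> x)"]
          by (auto simp: squeeze_homotopy_def core_complement_iff tube_ends)
      next
        case False
        then show ?thesis using x cover by (auto simp: squeeze_homotopy_def core_complement_def)
      qed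
    qed
    have NP: "squeeze_homotopy (s, x) \<in> N" if "s \<in> {0..1}" "x \<in> N \<inter> ?P" for s x
      using that gamma_in[of x] squeeze_range[of s "snd (\<gamma> x)"] 
      by (auto simp: squeeze_homotopy_def core_complement_iff kappa_in)
    have P: "squeeze_homotopy (s, x) \<in> ?P" if "s \<in> {0..1}" "x \<in> ?P" for s x
    proof -
      have "squeeze_homotopy \<in> topspace (prod_topology (top_of_set {0..1}) (subtopology X ?P)) \<rightarrow> topspace (subtopology X ?P)"
        by (rule continuous_map_funspace[OF squeeze_homotopy_cont])
      moreover have "(s, x) \<in> topspace (prod_topology (top_of_set {0..1}) (subtopology X ?P))"
        using that by (auto simp: core_complement_def)
      ultimately show ?thesis by auto
    qed
    show "homotopic_with (\<lambda>k. k ` D \<subseteq> D \<and> k ` (N \<inter> ?P) \<subseteq> N \<inter> ?P)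
        (subtopology X ?P) (subtopology X ?P) (\<lambda>x. squeeze_homotopy (0, x)) id"
      unfolding homotopic_with_def
    proof (intro exI[of _ squeeze_homotopy] conjI ballI allI squeeze_homotopy_cont)
      show "squeeze_homotopy (1, x) = id x" for x
        using kappa_gamma by (simp add: squeeze_homotopy_def squeeze_simps)
    qed (use fix_D NP P in auto)
  qed (use cover in auto)
  have "hom_induced p (cylinder M) (cylinder_ends M) X D (id \<circ> \<kappa>) =
     hom_induced p (subtopology X N) (N \<inter> D) X D id \<circ> hom_induced p (cylinder M) (cylinder_ends M) (subtopology X N) (N \<inter> D) \<kappa>"
    by (rule hom_induced_compose)
       (use tube_homeo kappa_ends_image in \<open>auto simp: homeomorphic_maps_def\<close>)
  then show ?thesis using iso_set_trans[OF i1 i2] by simp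
qed

definition tube_class :: "int \<Rightarrow> 'm chain set \<Rightarrow> 'x chain set" where
  "tube_class p z = hom_induced p (cylinder M) (cylinder_ends M) X D \<kappa> (cylinder_class p M z)"

lemma iso_tube_class: "tube_class p \<in> iso (homology_group (p-1) M) (relative_homology_group p X D)"
  using iso_set_trans[OF iso_cylinder_class iso_tube] by (simp add: tube_class_def[abs_def] o_def)

lemma end_cont: "t \<in> {0, 1} \<Longrightarrow> continuous_map M (subtopology X D) (\<lambda>m. \<kappa> (m, t))"
  using continuous_map_compose[OF continuous_map_cylinder_level kappa_cont, of t] tube_ends
  by (auto simp: continuous_map_in_subtopology o_def)

lemma hom_boundary_tube_class:
  assumes z: "z \<in> carrier (homology_group (p-1) M)"
  shows "hom_boundary p X D (tube_class p z) =
    hom_induced (p-1) M {} (subtopology X D) {} (\<lambda>m. \<kappa> (m, 0)) z \<otimes>\<^bsub>homology_group (p-1) (subtopology X D)\<^esub>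
    inv\<^bsub>homology_group (p-1) (subtopology X D)\<^esub> hom_induced (p-1) M {} (subtopology X D) {} (\<lambda>m. \<kappa> (m, 1)) z"
proof -
  let ?E = "subtopology (cylinder M) (cylinder_ends M)" and ?D = "subtopology X D"
  let ?k = "hom_induced (p-1) ?E {} ?D {} \<kappa>"
  have "\<kappa> \<in> cylinder_ends M \<rightarrow> D" using kappa_ends_image by blast
  then have "hom_boundary p X D (tube_class p z) = ?k (ends_difference (p-1) M z)"
    using naturality_hom_induced[OF kappa_cont, of "cylinder_ends M" D p] cylinder_class(2)[OF z]
    by (simp add: tube_class_def fun_eq_iff)
  moreover have "?k (end_map (p-1) M t z) = hom_induced (p-1) M {} ?D {} (\<lambda>m. \<kappa> (m, t)) z" if "t \<in> {0,1}" for t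
  proof -
    have "continuous_map M ?E (\<lambda>m. (m, t))"
      using that continuous_map_cylinder_level[of t M] by (auto simp: continuous_map_in_subtopology cylinder_ends_def)
    moreover have "continuous_map ?E ?D \<kappa>"
      using kappa_ends_image kappa_cont by (auto simp: continuous_map_in_subtopology continuous_map_from_subtopology)
    ultimately show ?thesis
      unfolding end_map_def by (subst hom_induced_compose') (auto simp: o_def)
  qed
  moreover have "?k (a \<otimes>\<^bsub>homology_group (p-1) ?E\<^esub> inv\<^bsub>homology_group (p-1) ?E\<^esub> b)
     = ?k a \<otimes>\<^bsub>homology_group (p-1) ?D\<^esub> inv\<^bsub>homology_group (p-1) ?D\<^esub> ?k b"
    if "a \<in> carrier (homology_group (p-1) ?E)" "b \<in> carrier (homology_group (p-1) ?E)" for a b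
  proof -
    interpret k: group_hom "homology_group (p-1) ?E" "homology_group (p-1) ?D" ?k by simp
    show ?thesis using that by simp
  qed
  ultimately show ?thesis by (simp add: ends_difference_def end_map_def hom_induced_carrier)
qed

end

section \<open>Product chains\<close>

lemma frag_extend_diff_fun:
  "frag_extend (\<lambda>x. f x - g x) c = frag_extend f c - frag_extend g c"
  using subset_UNIV by (induction c rule: frag_induction) (auto simp: frag_extend_diff)

definition origin :: "nat \<Rightarrow> real" where "origin = (\<lambda>i. if i = 0 then 1 else 0)"

lemma standard_simplex_0_origin: "standard_simplex 0 = {origin}"
  by (simp add: standard_simplex_0 origin_def)

text \<open>
  The simplicial identities. They reduce the boundaries of product chains to formal computations.
\<close>
lemma degen_face_same: "degen j (simplical_face j x) = x" "degen j (simplical_face (Suc j) x) = x"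
  by (auto simp: degen_def simplical_face_def fun_eq_iff)

lemma degen_face_less: "k < j \<Longrightarrow> degen j (simplical_face k x) = simplical_face k (degen (j - 1) x)"
  by (rule ext) (auto simp: degen_def simplical_face_def Suc_diff_Suc numeral_2_eq_2 split: nat_diff_split)

lemma degen_face_greater: "Suc j < k \<Longrightarrow> degen j (simplical_face k x) = simplical_face (k - 1) (degen j x)"
  by (rule ext) (auto simp: degen_def simplical_face_def)

lemma sum_degen: "j \<le> p \<Longrightarrow> (\<Sum>i\<le>p. degen j x i) = (\<Sum>i\<le>Suc p. x i)"
proof (induction p rule: dec_induct)
  case base
  have "(\<Sum>i<j. degen j x i) = (\<Sum>i<j. x i)" by (rule sum.cong) (auto simp: degen_def)
  then show ?case by (simp add: degen_def flip: lessThan_Suc_atMost)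
qed (auto simp: degen_def)

lemma degen_in_standard_simplex:
  assumes x: "x \<in> standard_simplex (Suc p)" and "j \<le> p"
  shows "degen j x \<in> standard_simplex p"
proof -
  have nn: "0 \<le> x i" for i using x by (simp add: standard_simplex_def)
  have nd: "0 \<le> degen j x i" for i using nn by (simp add: degen_def)
  have z: "degen j x i = 0" if "i > p" for i using x that assms(2) by (auto simp: degen_def standard_simplex_def)
  have s: "(\<Sum>i\<le>p. degen j x i) = 1" using x sum_degen[OF assms(2)] by (simp add: standard_simplex_def)
  have "degen j x i \<le> 1" for i
  proof (cases "i \<le> p")
    case True
    then show ?thesis using s nd member_le_sum[of i "{..p}" "degen j x"] by auto
  qed (use z in auto)
  with nd z s show ?thesis by (simp add: standard_simplex_def)
qed

lemma degen_edge: "x \<in> standard_simplex 1 \<Longrightarrow> degen 0 x = origin"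
  using degen_in_standard_simplex[of x 0 0] by (simp add: standard_simplex_0_origin)

lemma face_origin: "simplical_face 1 origin = origin"
  by (auto simp: simplical_face_def origin_def fun_eq_iff)

lemma continuous_degen:
  assumes "j \<le> p"
  shows "continuous_map (subtopology (powertop_real UNIV) (standard_simplex (Suc p)))
     (subtopology (powertop_real UNIV) (standard_simplex p)) (degen j)"
proof -
  have "continuous_map (powertop_real UNIV) euclideanreal (\<lambda>x. degen j x i)" for i
    unfolding degen_def by (auto intro!: continuous_intros continuous_map_product_projection)
  then show ?thesis
    using degen_in_standard_simplex[OF _ assms]
    by (auto simp: continuous_map_in_subtopology continuous_map_componentwise_UNIV continuous_map_from_subtopology)
qed

lemma degen_faces:
  "degen 0 (simplical_face 0 x) = x" "degen 0 (simplical_face 1 x) = x"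
  "degen 0 (simplical_face 2 x) = simplical_face 1 (degen 0 x)"
  "degen 0 (simplical_face 3 x) = simplical_face 2 (degen 0 x)"
  "degen 1 (simplical_face 0 x) = simplical_face 0 (degen 0 x)" "degen 1 (simplical_face 1 x) = x"
  "degen 1 (simplical_face 2 x) = x" "degen 1 (simplical_face 3 x) = simplical_face 2 (degen 1 x)"
  "degen 2 (simplical_face 0 x) = simplical_face 0 (degen 1 x)" "degen 2 (simplical_face 1 x) = simplical_face 1 (degen 1 x)"
  "degen 2 (simplical_face 2 x) = x" "degen 2 (simplical_face 3 x) = x"
  using degen_face_same[of 0 x] degen_face_same[of 1 x] degen_face_same[of 2 x]
    degen_face_less[of 0 1 x] degen_face_less[of 0 2 x] degen_face_less[of 1 2 x]
    degen_face_greater[of 0 2 x] degen_face_greater[of 0 3 x] degen_face_greater[of 1 3 x]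
  by (simp_all add: numeral_2_eq_2 numeral_3_eq_3)

lemma singular_faces:
  "singular_face 1 k f = restrict (\<lambda>x. f (simplical_face k x)) (standard_simplex 0)"
  "singular_face 2 k f = restrict (\<lambda>x. f (simplical_face k x)) (standard_simplex 1)"
  "singular_face 3 k f = restrict (\<lambda>x. f (simplical_face k x)) (standard_simplex 2)"
  by (simp_all add: singular_face_def o_def numeral_2_eq_2 numeral_3_eq_3)

text \<open>
  The product of a 0-chain with a chain.
\<close>
definition slice_left :: "nat \<Rightarrow> 'b chain \<Rightarrow> 'c chain \<Rightarrow> ('b \<times> 'c) chain" where
  "slice_left p a c = frag_extend (\<lambda>\<rho>. chain_map p (\<lambda>y. (\<rho> origin, y)) c) a"

definition slice_right :: "nat \<Rightarrow> 'b chain \<Rightarrow> 'c chain \<Rightarrow> ('b \<times> 'c) chain" where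
  "slice_right p a c = frag_extend (\<lambda>\<rho>. chain_map p (\<lambda>x. (x, \<rho> origin)) a) c"

lemma slice_left_simps [simp]:
  "slice_left p 0 c = 0" "slice_left p a 0 = 0"
  "slice_left p (frag_of \<rho>) c = chain_map p (\<lambda>y. (\<rho> origin, y)) c"
  by (auto simp: slice_left_def intro: frag_extend_eq_0)

lemma slice_left_diff:
  "slice_left p (a - b) c = slice_left p a c - slice_left p b c"
  "slice_left p a (c - d) = slice_left p a c - slice_left p a d"
  by (simp_all add: slice_left_def frag_extend_diff chain_map_diff frag_extend_diff_fun)

lemma slice_right_simps [simp]:
  "slice_right p 0 c = 0" "slice_right p a 0 = 0"
  "slice_right p a (frag_of \<rho>) = chain_map p (\<lambda>x. (x, \<rho> origin)) a"
  by (auto simp: slice_right_def intro: frag_extend_eq_0)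

lemma slice_right_diff:
  "slice_right p (a - b) c = slice_right p a c - slice_right p b c"
  "slice_right p a (c - d) = slice_right p a c - slice_right p a d"
  by (simp_all add: slice_right_def frag_extend_diff chain_map_diff frag_extend_diff_fun)

lemma product_chain_simps [simp]:
  "product_chain 0 c = 0" "product_chain a 0 = 0"
  "product_chain (frag_of \<sigma>) (frag_of \<tau>) = product_simplex \<sigma> \<tau>"
  by (auto simp: product_chain_def intro: frag_extend_eq_0)

lemma product_chain_diff:
  "product_chain (a - b) c = product_chain a c - product_chain b c"
  "product_chain a (c - d) = product_chain a c - product_chain a d"
  by (simp_all add: product_chain_def frag_extend_diff frag_extend_diff_fun)

lemma product_chain_minus:
  "product_chain (- b) c = - product_chain b c" "product_chain a (- d) = - product_chain a d"
  using product_chain_diff(1)[of 0 b c] product_chain_diff(2)[of a 0 d] by simp_all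

lemma product_chain_add:
  "product_chain (a + b) c = product_chain a c + product_chain b c"
  "product_chain a (c + d) = product_chain a c + product_chain a d"
  using product_chain_diff(1)[of a "- b" c] product_chain_diff(2)[of a c "- d"]
  by (simp_all add: product_chain_minus)

text \<open>
  Bilinear identities need to be checked on pairs of simplices only.
\<close>
lemma bilinear_induct:
  assumes "\<And>c. P 0 c" "\<And>a. P a 0" "\<And>\<sigma> \<tau>. P (frag_of \<sigma>) (frag_of \<tau>)"
    "\<And>a b c. \<lbrakk>P a c; P b c\<rbrakk> \<Longrightarrow> P (a - b) c" "\<And>a c d. \<lbrakk>P a c; P a d\<rbrakk> \<Longrightarrow> P a (c - d)"
  shows "P a c"
proof -
  have "P (frag_of \<sigma>) c" for \<sigma>
    using subset_UNIV by (induction c rule: frag_induction) (auto intro: assms)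
  note of = this
  show ?thesis
    using subset_UNIV by (induction a rule: frag_induction) (auto intro: assms of)
qed

lemma chain_boundary_1_of:
  "chain_boundary 1 (frag_of \<sigma>) = frag_of (singular_face 1 0 \<sigma>) - frag_of (singular_face 1 1 \<sigma>)"
  by (simp add: chain_boundary_of)

lemma chain_boundary_2_of:
  "chain_boundary 2 (frag_of \<sigma>) = frag_of (singular_face 2 0 \<sigma>) - frag_of (singular_face 2 1 \<sigma>) + frag_of (singular_face 2 2 \<sigma>)"
  by (simp add: chain_boundary_of numeral_2_eq_2)

lemma chain_boundary_3_of:
  "chain_boundary 3 (frag_of \<sigma>) = frag_of (singular_face 3 0 \<sigma>) - frag_of (singular_face 3 1 \<sigma>)
     + frag_of (singular_face 3 2 \<sigma>) - frag_of (singular_face 3 3 \<sigma>)"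
  by (simp add: chain_boundary_of numeral_3_eq_3 numeral_2_eq_2)

lemma singular_face_vertex: "singular_face 1 k \<sigma> origin = \<sigma> (simplical_face k origin)"
  by (simp add: singular_face_def standard_simplex_0_origin)

text \<open>
  The two triangles share the diagonal of the square, which cancels; the other four edges remain.
\<close>
theorem chain_boundary_product_chain:
  "chain_boundary 2 (product_chain a c) = slice_left 1 (chain_boundary 1 a) c - slice_right 1 a (chain_boundary 1 c)"
proof (induction a c rule: bilinear_induct)
  case (3 \<sigma> \<tau>)
  have f0: "singular_face 2 0 (\<lambda>x. (\<sigma> (degen 1 x), \<tau> (degen 0 x))) = restrict (\<lambda>x. (\<sigma> (simplical_face 0 origin), \<tau> x)) (standard_simplex 1)"
    "singular_face 2 1 (\<lambda>x. (\<sigma> (degen 1 x), \<tau> (degen 0 x))) = restrict (\<lambda>x. (\<sigma> x, \<tau> x)) (standard_simplex 1)"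
    "singular_face 2 2 (\<lambda>x. (\<sigma> (degen 1 x), \<tau> (degen 0 x))) = restrict (\<lambda>x. (\<sigma> x, \<tau> origin)) (standard_simplex 1)"
    "singular_face 2 0 (\<lambda>x. (\<sigma> (degen 0 x), \<tau> (degen 1 x))) = restrict (\<lambda>x. (\<sigma> x, \<tau> (simplical_face 0 origin))) (standard_simplex 1)"
    "singular_face 2 1 (\<lambda>x. (\<sigma> (degen 0 x), \<tau> (degen 1 x))) = restrict (\<lambda>x. (\<sigma> x, \<tau> x)) (standard_simplex 1)"
    "singular_face 2 2 (\<lambda>x. (\<sigma> (degen 0 x), \<tau> (degen 1 x))) = restrict (\<lambda>x. (\<sigma> origin, \<tau> x)) (standard_simplex 1)"
    by (simp_all only: singular_faces degen_faces) (rule restrict_ext, simp only: degen_edge face_origin)+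
  show ?case
    by (simp add: product_simplex_def chain_boundary_diff chain_boundary_2_of f0 chain_boundary_1_of
        slice_left_diff slice_right_diff simplex_map_def o_def singular_face_vertex face_origin del: One_nat_def)
qed (simp_all add: chain_boundary_diff product_chain_diff slice_left_diff slice_right_diff)

text \<open>
  The Eilenberg--Zilber decomposition of the prism over a triangle into three tetrahedra. It
  supplies the chain that bounds the product of a cycle with a boundary.
\<close>
definition product_simplex_12 :: "((nat \<Rightarrow> real) \<Rightarrow> 'b) \<Rightarrow> ((nat \<Rightarrow> real) \<Rightarrow> 'c) \<Rightarrow> ('b \<times> 'c) chain" where
  "product_simplex_12 \<sigma> \<beta> =
     frag_of (restrict (\<lambda>x. (\<sigma> (degen 1 (degen 1 x)), \<beta> (degen 0 x))) (standard_simplex 3)) -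
     frag_of (restrict (\<lambda>x. (\<sigma> (degen 0 (degen 2 x)), \<beta> (degen 1 x))) (standard_simplex 3)) +
     frag_of (restrict (\<lambda>x. (\<sigma> (degen 0 (degen 0 x)), \<beta> (degen 2 x))) (standard_simplex 3))"

definition product_chain_12 :: "'b chain \<Rightarrow> 'c chain \<Rightarrow> ('b \<times> 'c) chain" where
  "product_chain_12 a b = frag_extend (\<lambda>\<sigma>. frag_extend (\<lambda>\<beta>. product_simplex_12 \<sigma> \<beta>) b) a"

lemma product_chain_12_simps [simp]:
  "product_chain_12 0 c = 0" "product_chain_12 a 0 = 0"
  "product_chain_12 (frag_of \<sigma>) (frag_of \<tau>) = product_simplex_12 \<sigma> \<tau>"
  by (auto simp: product_chain_12_def intro: frag_extend_eq_0)

lemma product_chain_12_diff: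
  "product_chain_12 (a - b) c = product_chain_12 a c - product_chain_12 b c"
  "product_chain_12 a (c - d) = product_chain_12 a c - product_chain_12 a d"
  by (simp_all add: product_chain_12_def frag_extend_diff frag_extend_diff_fun)

text \<open>
  Of the twelve faces of the tetrahedra, two pairs cancel; two are the ends of the prism, and the
  other six make up its three walls.
\<close>
theorem chain_boundary_product_chain_12:
  "chain_boundary 3 (product_chain_12 a b) = slice_left 2 (chain_boundary 1 a) b - product_chain a (chain_boundary 2 b)"
proof (induction a b rule: bilinear_induct)
  case (3 \<sigma> \<beta>)
  have dg: "degen j x \<in> standard_simplex 1" "degen 0 (degen 0 x) = origin" if "x \<in> standard_simplex 2" "j \<le> 1" for x j
    using that degen_in_standard_simplex[of x 1 j] degen_in_standard_simplex[of x 1 0] degen_edge[of "degen 0 x"]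
    by (auto simp: numeral_2_eq_2)
  have dg': "degen 0 x \<in> standard_simplex 1" "degen 1 x \<in> standard_simplex 1"
    "degen 0 (degen 0 x) = origin" "degen 0 (degen 1 x) = origin" if "x \<in> standard_simplex 2" for x
    using that dg(1)[of x 0] dg(1)[of x 1] degen_edge by auto
  note simps = dg' face_origin restrict_apply'
  let ?A = "\<lambda>x. (\<sigma> (degen 1 (degen 1 x)), \<beta> (degen 0 x))"
  let ?B = "\<lambda>x. (\<sigma> (degen 0 (degen 2 x)), \<beta> (degen 1 x))"
  let ?C = "\<lambda>x. (\<sigma> (degen 0 (degen 0 x)), \<beta> (degen 2 x))"
  let ?P = "\<lambda>i j k. restrict (\<lambda>x. (\<sigma> (degen i x), singular_face 2 k \<beta> (degen j x))) (standard_simplex 2)"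
  have A: "singular_face 3 0 ?A = restrict (\<lambda>x. (\<sigma> (simplical_face 0 origin), \<beta> x)) (standard_simplex 2)"
    "singular_face 3 1 ?A = restrict (\<lambda>x. (\<sigma> (degen 1 x), \<beta> x)) (standard_simplex 2)"
    "singular_face 3 2 ?A = ?P 1 0 1" "singular_face 3 3 ?A = ?P 1 0 2"
    by (simp_all only: singular_faces degen_faces) (rule restrict_ext, simp only: simps)+
  have B: "singular_face 3 0 ?B = ?P 1 0 0"
    "singular_face 3 1 ?B = restrict (\<lambda>x. (\<sigma> (degen 1 x), \<beta> x)) (standard_simplex 2)"
    "singular_face 3 2 ?B = restrict (\<lambda>x. (\<sigma> (degen 0 x), \<beta> x)) (standard_simplex 2)"
    "singular_face 3 3 ?B = ?P 0 1 2"
    by (simp_all only: singular_faces degen_faces) (rule restrict_ext, simp only: simps)+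
  have C: "singular_face 3 0 ?C = ?P 0 1 0" "singular_face 3 1 ?C = ?P 0 1 1"
    "singular_face 3 2 ?C = restrict (\<lambda>x. (\<sigma> (degen 0 x), \<beta> x)) (standard_simplex 2)"
    "singular_face 3 3 ?C = restrict (\<lambda>x. (\<sigma> origin, \<beta> x)) (standard_simplex 2)"
    by (simp_all only: singular_faces degen_faces) (rule restrict_ext, simp only: simps)+
  show ?case
    by (simp add: product_simplex_12_def product_simplex_def chain_boundary_diff chain_boundary_add chain_boundary_3_of A B C
        chain_boundary_1_of chain_boundary_2_of product_chain_diff product_chain_add
        slice_left_diff simplex_map_def o_def singular_face_vertex face_origin del: One_nat_def)
qed (simp_all add: chain_boundary_diff product_chain_12_diff product_chain_diff slice_left_diff)


lemma point_chain_slices [simp]: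
  "slice_left p (point_chain x) c = chain_map p (\<lambda>y. (x, y)) c"
  "slice_right p a (point_chain y) = chain_map p (\<lambda>x. (x, y)) a"
  by (simp_all add: point_chain_def standard_simplex_0_origin)

lemma singular_simplex_pair:
  assumes "continuous_map (subtopology (powertop_real UNIV) (standard_simplex p)) X f"
    and "continuous_map (subtopology (powertop_real UNIV) (standard_simplex p)) Y g"
  shows "singular_simplex p (prod_topology X Y) (restrict (\<lambda>x. (f x, g x)) (standard_simplex p))"
  unfolding singular_simplex_def
  by (auto intro: continuous_map_eq[OF continuous_map_pairedI[OF assms]])

lemma continuous_map_simplex_degen:
  assumes "singular_simplex p X \<sigma>" "j \<le> p"
  shows "continuous_map (subtopology (powertop_real UNIV) (standard_simplex (Suc p))) X (\<lambda>x. \<sigma> (degen j x))"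
  using continuous_map_compose[OF continuous_degen[OF assms(2)], of X \<sigma>] assms(1)
  by (simp add: singular_simplex_def o_def)

lemma singular_chain_product_chain:
  assumes a: "singular_chain 1 X a" and c: "singular_chain 1 Y c"
  shows "singular_chain 2 (prod_topology X Y) (product_chain a c)"
  unfolding product_chain_def
proof (intro singular_chain_extend)
  fix \<sigma> \<tau> assume "\<sigma> \<in> Poly_Mapping.keys a" "\<tau> \<in> Poly_Mapping.keys c"
  then have st: "singular_simplex 1 X \<sigma>" "singular_simplex 1 Y \<tau>" using a c by (auto simp: singular_chain_def)
  have "continuous_map (subtopology (powertop_real UNIV) (standard_simplex 2)) X (\<lambda>x. \<sigma> (degen j x))"
    "continuous_map (subtopology (powertop_real UNIV) (standard_simplex 2)) Y (\<lambda>x. \<tau> (degen j x))" if "j \<le> 1" for j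
    using continuous_map_simplex_degen[OF st(1) that] continuous_map_simplex_degen[OF st(2) that]
    by (simp_all add: numeral_2_eq_2)
  then show "singular_chain 2 (prod_topology X Y) (product_simplex \<sigma> \<tau>)"
    unfolding product_simplex_def
    by (intro singular_chain_diff) (simp_all add: singular_chain_of singular_simplex_pair)
qed

lemma singular_chain_product_chain_12:
  assumes a: "singular_chain 1 X a" and c: "singular_chain 2 Y c"
  shows "singular_chain 3 (prod_topology X Y) (product_chain_12 a c)"
  unfolding product_chain_12_def
proof (intro singular_chain_extend)
  fix \<sigma> \<beta> assume "\<sigma> \<in> Poly_Mapping.keys a" "\<beta> \<in> Poly_Mapping.keys c"
  then have st: "singular_simplex 1 X \<sigma>" "singular_simplex 2 Y \<beta>" using a c by (auto simp: singular_chain_def)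
  have "continuous_map (subtopology (powertop_real UNIV) (standard_simplex 3)) X (\<lambda>x. \<sigma> (degen i (degen j x)))"
    if "i \<le> 1" "j \<le> 2" for i j
  proof -
    have "continuous_map (subtopology (powertop_real UNIV) (standard_simplex 2)) X (\<lambda>x. \<sigma> (degen i x))"
      using continuous_map_simplex_degen[OF st(1) that(1)] by (simp add: numeral_2_eq_2)
    from continuous_map_compose[OF continuous_degen[OF that(2)] this] show ?thesis
      by (simp add: numeral_2_eq_2 numeral_3_eq_3 o_def)
  qed
  moreover have "continuous_map (subtopology (powertop_real UNIV) (standard_simplex 3)) Y (\<lambda>x. \<beta> (degen j x))"
    if "j \<le> 2" for j
    using continuous_map_simplex_degen[OF st(2) that] by (simp_all add: numeral_2_eq_2 numeral_3_eq_3)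
  ultimately show "singular_chain 3 (prod_topology X Y) (product_simplex_12 \<sigma> \<beta>)"
    unfolding product_simplex_12_def
    by (intro singular_chain_diff singular_chain_add) (simp_all add: singular_chain_of singular_simplex_pair)
qed

lemma continuous_map_prod_swap: "continuous_map (prod_topology X Y) (prod_topology Y X) prod.swap"
  by (simp add: continuous_map_pairwise o_def continuous_map_fst continuous_map_snd)

text \<open>
  Exchanging the factors exchanges the two triangles, which have opposite signs.
\<close>
lemma chain_map_swap_product_chain:
  "chain_map 2 prod.swap (product_chain a c) = - product_chain c a"
proof (induction a c rule: bilinear_induct)
  case (3 \<sigma> \<tau>)
  have "simplex_map 2 prod.swap (restrict (\<lambda>x. (f x, g x)) (standard_simplex 2)) = restrict (\<lambda>x. (g x, f x)) (standard_simplex 2)" for f g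
    by (simp add: simplex_map_def o_def cong: restrict_cong)
  from this[of "\<lambda>x. \<sigma> (degen 1 x)" "\<lambda>x. \<tau> (degen 0 x)"] this[of "\<lambda>x. \<sigma> (degen 0 x)" "\<lambda>x. \<tau> (degen 1 x)"]
  show ?case by (simp add: product_simplex_def chain_map_diff)
qed (simp_all add: chain_map_diff product_chain_diff)

lemma chain_map_prod_product_chain:
  "chain_map 2 (map_prod f g) (product_chain a c) = product_chain (chain_map 1 f a) (chain_map 1 g c)"
proof (induction a c rule: bilinear_induct)
  case (3 \<sigma> \<tau>)
  have "degen j x \<in> standard_simplex 1" if "x \<in> standard_simplex 2" "j \<le> 1" for j x
    using degen_in_standard_simplex[of x 1 j] that by (simp add: numeral_2_eq_2)
  then have "simplex_map 2 (map_prod f g) (restrict (\<lambda>x. (\<sigma> (degen i x), \<tau> (degen j x))) (standard_simplex 2))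
     = restrict (\<lambda>x. (simplex_map 1 f \<sigma> (degen i x), simplex_map 1 g \<tau> (degen j x))) (standard_simplex 2)"
     if "i \<le> 1" "j \<le> 1" for i j
    using that by (auto simp: simplex_map_def restrict_def fun_eq_iff simp del: One_nat_def)
  then show ?case by (simp add: product_simplex_def chain_map_diff del: One_nat_def)
qed (simp_all add: chain_map_diff product_chain_diff)

lemma relboundary_cycle_times_boundary:
  assumes a: "singular_relcycle 1 X {} a" and b: "singular_relboundary 1 Y {} b"
  shows "singular_relboundary 2 (prod_topology X Y) {} (product_chain a b)"
proof -
  obtain d where d: "singular_chain 2 Y d" "chain_boundary 2 d = b"
    using b by (auto simp: singular_boundary numeral_2_eq_2)
  have a': "singular_chain 1 X a" "chain_boundary 1 a = 0" using a by (auto simp: singular_cycle)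
  have "chain_boundary 3 (- product_chain_12 a d) = product_chain a b"
    by (simp add: chain_boundary_minus chain_boundary_product_chain_12 a'(2) d(2) del: One_nat_def)
  moreover have "singular_chain 3 (prod_topology X Y) (- product_chain_12 a d)"
    using singular_chain_product_chain_12[OF a'(1) d(1)] by (simp add: singular_chain_minus)
  ultimately show ?thesis
    by (auto simp: singular_boundary numeral_2_eq_2 numeral_3_eq_3)
qed

lemma relboundary_boundary_times_cycle:
  assumes a: "singular_relboundary 1 X {} a" and b: "singular_relcycle 1 Y {} b"
  shows "singular_relboundary 2 (prod_topology X Y) {} (product_chain a b)"
proof -
  have "singular_relboundary 2 (prod_topology X Y) {} (chain_map 2 prod.swap (product_chain b a))"
    by (rule singular_relboundary_chain_map[OF relboundary_cycle_times_boundary[OF b a]])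
       (auto simp: continuous_map_prod_swap)
  then show ?thesis
    using singular_relboundary_minus by (fastforce simp: chain_map_swap_product_chain)
qed

lemma homologous_rel_product_chain:
  assumes "singular_relcycle 1 X {} a" "singular_relcycle 1 Y {} c"
    and "homologous_rel 1 X {} a a'" "homologous_rel 1 Y {} c c'"
  shows "homologous_rel 2 (prod_topology X Y) {} (product_chain a c) (product_chain a' c')"
proof -
  have a': "singular_relcycle 1 X {} a'" using assms homologous_rel_singular_relcycle by blast
  have "product_chain a c - product_chain a' c' = product_chain (a - a') c + product_chain a' (c - c')"
    by (simp add: product_chain_diff)
  then show ?thesis
    using relboundary_boundary_times_cycle[OF _ assms(2), of X "a - a'"]
      relboundary_cycle_times_boundary[OF a', of Y "c - c'"] assms(3,4)
    by (simp add: homologous_rel_def singular_relboundary_add)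
qed

text \<open>
  Homologous factors give homologous products, so the definite description has a value.
\<close>
lemma homology_cross_eq:
  assumes "singular_relcycle 1 X {} a" "singular_relcycle 1 X {} c"
  shows "homology_cross X (homologous_rel_set 1 X {} a) (homologous_rel_set 1 X {} c) =
    homologous_rel_set 2 (square X) {} (product_chain a c)"
  unfolding homology_cross_def
proof (rule the_equality)
  show "\<exists>b\<in>homologous_rel_set 1 X {} a. \<exists>d\<in>homologous_rel_set 1 X {} c.
      homologous_rel_set 2 (square X) {} (product_chain a c) = homologous_rel_set 2 (square X) {} (product_chain b d)"
    by (intro bexI[of _ a] bexI[of _ c]) auto
next
  fix w assume "\<exists>b\<in>homologous_rel_set 1 X {} a. \<exists>d\<in>homologous_rel_set 1 X {} c.
      w = homologous_rel_set 2 (square X) {} (product_chain b d)"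
  then obtain b d where bd: "homologous_rel 1 X {} a b" "homologous_rel 1 X {} c d"
     "w = homologous_rel_set 2 (square X) {} (product_chain b d)" by auto
  then show "w = homologous_rel_set 2 (square X) {} (product_chain a c)"
    using homologous_rel_product_chain[OF assms bd(1,2)] homologous_rel_set_eq[of 2 "prod_topology X X" "{}"]
    by (simp only: square_def homologous_rel_sym)
qed

lemma singular_relcycle_product_chain:
  assumes "singular_relcycle 1 X {} a" "singular_relcycle 1 Y {} c"
  shows "singular_relcycle 2 (prod_topology X Y) {} (product_chain a c)"
  using assms singular_chain_product_chain[of X a Y c] chain_boundary_product_chain[of a c]
  by (auto simp: singular_cycle)

lemma group_hom_homology_class:
  "group_hom (relcycle_group p X S) (relative_homology_group (int p) X S) (homologous_rel_set p X S)"
proof -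
  have "homologous_rel_set p X S \<in> hom (relcycle_group p X S) (relative_homology_group (int p) X S)"
    using normal.r_coset_hom_Mod[OF normal_subgroup_singular_relboundary_relcycle[of p X S]]
    by (simp add: nontrivial_relative_homology_group right_coset_singular_relboundary)
  then show ?thesis by (simp add: group_hom_def group_hom_axioms_def)
qed

lemma homology_class_diff:
  assumes "singular_relcycle p X S a" "singular_relcycle p X S b"
  shows "homologous_rel_set p X S (a - b) =
    homologous_rel_set p X S a \<otimes>\<^bsub>relative_homology_group (int p) X S\<^esub>
      inv\<^bsub>relative_homology_group (int p) X S\<^esub> homologous_rel_set p X S b"
proof -
  interpret h: group_hom "relcycle_group p X S" "relative_homology_group (int p) X S" "homologous_rel_set p X S"
    by (rule group_hom_homology_class)
  have "inv\<^bsub>relcycle_group p X S\<^esub> b = - b"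
    by (rule h.G.inv_equality) (use assms in \<open>auto simp: singular_relcycle_minus\<close>)
  then show ?thesis using h.hom_mult[of a "- b"] h.hom_inv[of b] assms singular_relcycle_minus by fastforce
qed

lemma homology_class_in_carrier:
  "singular_relcycle p X S a \<Longrightarrow> homologous_rel_set p X S a \<in> carrier (relative_homology_group (int p) X S)"
  by (auto simp: carrier_relative_homology_group)

definition interval_chain :: "real chain" where
  "interval_chain = frag_of (restrict (\<lambda>x. x 1) (standard_simplex 1))"

lemma singular_chain_interval_chain: "singular_chain 1 (top_of_set {0..1}) interval_chain"
proof -
  have "continuous_map (subtopology (powertop_real UNIV) (standard_simplex 1)) euclideanreal (\<lambda>x. x 1)"
    by (intro continuous_map_from_subtopology continuous_map_product_projection) auto
  then have "continuous_map (subtopology (powertop_real UNIV) (standard_simplex 1)) (top_of_set {0..1}) (\<lambda>x. x 1)"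
    by (rule continuous_map_into_subtopology) (auto simp: standard_simplex_def)
  then show ?thesis
    by (auto simp: interval_chain_def singular_chain_of singular_simplex_def intro: continuous_map_eq)
qed

lemma chain_boundary_path:
  "chain_boundary 1 (frag_of (restrict \<sigma> (standard_simplex 1))) = point_chain (\<sigma> (simplical_face 0 origin)) - point_chain (\<sigma> origin)"
proof -
  have f: "simplical_face k origin \<in> standard_simplex 1" if "k \<le> 1" for k
    using simplical_face_in_standard_simplex[of 1 k origin] that by (simp add: standard_simplex_0_origin)
  have "restrict (\<lambda>x. restrict \<sigma> (standard_simplex 1) (simplical_face k x)) {origin} = restrict (\<lambda>_. \<sigma> (simplical_face k origin)) {origin}"
    if "k \<le> 1" for k
    by (rule restrict_ext) (use f[OF that] in simp)
  from this[of 0] this[of 1] show ?thesis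
    unfolding chain_boundary_1_of point_chain_def singular_faces standard_simplex_0_origin
    by (simp only: face_origin zero_le_one order_refl simp_thms)
qed

lemma chain_boundary_interval_chain: "chain_boundary 1 interval_chain = point_chain 1 - point_chain 0"
  unfolding interval_chain_def chain_boundary_path by (simp add: simplical_face_def origin_def)

text \<open>
  The product of a cycle with the interval has the boundary that characterizes the suspension.
\<close>
theorem cylinder_class_cycle:
  assumes c: "singular_relcycle 1 M {} c"
  shows "cylinder_class 2 M (homologous_rel_set 1 M {} c) =
     homologous_rel_set 2 (cylinder M) (cylinder_ends M) (product_chain c interval_chain)"
    and "singular_relcycle 2 (cylinder M) (cylinder_ends M) (product_chain c interval_chain)"
proof -
  let ?E = "subtopology (cylinder M) (cylinder_ends M)"
  let ?w = "product_chain c interval_chain"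
  let ?l = "\<lambda>t. chain_map 1 (\<lambda>m. (m, t)) c"
  have c': "singular_chain 1 M c" "chain_boundary 1 c = 0" using c by (auto simp: singular_cycle)
  have bd: "chain_boundary 2 ?w = ?l 0 - ?l 1"
    by (simp add: chain_boundary_product_chain c'(2) chain_boundary_interval_chain slice_right_diff del: One_nat_def)
  have cont: "continuous_map M ?E (\<lambda>m. (m, t))" if "t \<in> {0, 1}" for t
    using embedding_map_cylinder_end[OF that] embedding_map_in_subtopology
    by (metis embedding_map_def homeomorphic_imp_continuous_map continuous_map_in_subtopology)
  have l: "singular_relcycle 1 ?E {} (?l t)" if "t \<in> {0, 1}" for t
    by (rule singular_relcycle_chain_map[OF c cont[OF that]]) auto
  show rc: "singular_relcycle 2 (cylinder M) (cylinder_ends M) ?w"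
    unfolding singular_relcycle using singular_chain_product_chain[OF c'(1) singular_chain_interval_chain] 
      l[of 0] l[of 1] bd by (auto simp: cylinder_def singular_cycle singular_chain_diff)
  show "cylinder_class 2 M (homologous_rel_set 1 M {} c) = homologous_rel_set 2 (cylinder M) (cylinder_ends M) ?w"
  proof (rule cylinder_class_unique)
    show "homologous_rel_set 2 (cylinder M) (cylinder_ends M) ?w \<in> carrier (relative_homology_group 2 (cylinder M) (cylinder_ends M))"
      using rc carrier_relative_homology_group[of 2] by auto
    have e: "end_map 1 M t (homologous_rel_set 1 M {} c) = homologous_rel_set 1 ?E {} (?l t)" if "t \<in> {0, 1}" for t
      using hom_induced_chain_map[OF cont[OF that] _ c, of "{}"] by (simp add: end_map_def)
    have "homologous_rel_set 1 ?E {} (?l 0 - ?l 1) = ends_difference 1 M (homologous_rel_set 1 M {} c)"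
      using homology_class_diff[OF l[of 0] l[of 1]] by (simp add: ends_difference_def e del: One_nat_def)
    then show "hom_boundary 2 (cylinder M) (cylinder_ends M) (homologous_rel_set 2 (cylinder M) (cylinder_ends M) ?w)
      = ends_difference (2 - 1) M (homologous_rel_set 1 M {} c)"
      using hom_boundary_chain_boundary[OF rc] bd by simp
  qed
qed

section \<open>Realizations of graphs\<close>

definition points :: "'a set set \<Rightarrow> ('a \<Rightarrow> real) set" where
  "points K = {x. (\<forall>w. 0 \<le> x w) \<and> {w. x w \<noteq> 0} \<in> K \<and> (\<Sum>w | x w \<noteq> 0. x w) = 1}"

lemma realization_eq: "realization K = top_of_set (points K)"
  by (simp add: realization_def points_def)

lemma topspace_realization [simp]: "topspace (realization K) = points K"
  by (simp add: realization_eq)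

text \<open>
  The closed cell spanned by \<open>s\<close>. Unlike the sum over the support, the sum over the fixed set \<open>s\<close> is
  visibly continuous, which gives closedness.
\<close>
definition cell :: "'a set \<Rightarrow> ('a \<Rightarrow> real) set" where
  "cell s = {x. (\<forall>w. 0 \<le> x w) \<and> (\<forall>w. w \<notin> s \<longrightarrow> x w = 0) \<and> (\<Sum>w\<in>s. x w) = 1}"

lemma graph_finite: "graph K \<Longrightarrow> finite K" "graph K \<Longrightarrow> s \<in> K \<Longrightarrow> finite s" "graph K \<Longrightarrow> finite (\<Union>K)"
  by (auto simp: graph_def)

lemma graph_face: "\<lbrakk>graph K; s \<in> K; t \<subseteq> s; t \<noteq> {}\<rbrakk> \<Longrightarrow> t \<in> K"
  by (auto simp: graph_def)

lemma graph_nonempty: "graph K \<Longrightarrow> {} \<notin> K"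
  by (force simp: graph_def)

lemma graph_simplex_cases:
  assumes "graph K" "s \<in> K"
  obtains p where "s = {p}" | p q where "p \<noteq> q" "s = {p, q}" "{p} \<in> K" "{q} \<in> K"
proof -
  have c: "1 \<le> card s" "card s \<le> 2" "finite s" using assms by (auto simp: graph_def)
  then consider "card s = 1" | "card s = 2" by linarith
  then show thesis
  proof cases
    case 1 then show thesis using that(1) by (auto simp: card_1_singleton_iff)
  next
    case 2
    then obtain p q where "s = {p, q}" "p \<noteq> q" by (auto simp: card_2_iff)
    then show thesis using that(2) graph_face[OF assms] by blast
  qed
qed

lemma support_sum:
  assumes "finite s" "\<And>w. w \<notin> s \<Longrightarrow> x w = 0"
  shows "(\<Sum>w | x w \<noteq> 0. x w) = (\<Sum>w\<in>s. (x w :: real))"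
  by (rule sum.mono_neutral_left) (use assms in auto)

lemma points_eq_cells: "graph K \<Longrightarrow> points K = (\<Union>s\<in>K. cell s)"
proof (intro equalityI subsetI)
  fix x assume K: "graph K" and "x \<in> points K"
  then have "x \<in> cell {w. x w \<noteq> 0}" "{w. x w \<noteq> 0} \<in> K" by (auto simp: points_def cell_def)
  then show "x \<in> (\<Union>s\<in>K. cell s)" by blast
next
  fix x assume K: "graph K" and "x \<in> (\<Union>s\<in>K. cell s)"
  then obtain s where s: "s \<in> K" "x \<in> cell s" by blast
  have "{w. x w \<noteq> 0} \<subseteq> s" using s by (auto simp: cell_def)
  moreover have "{w. x w \<noteq> 0} \<noteq> {}"
  proof
    assume "{w. x w \<noteq> 0} = {}"
    then have "(\<Sum>w\<in>s. x w) = 0" by auto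
    then show False using s by (simp add: cell_def)
  qed
  ultimately have "{w. x w \<noteq> 0} \<in> K" using graph_face[OF K s(1)] by blast
  moreover have "(\<Sum>w | x w \<noteq> 0. x w) = 1"
    using support_sum[of s x] s graph_finite[OF K] by (auto simp: cell_def)
  ultimately show "x \<in> points K" using s by (auto simp: points_def cell_def)
qed

lemma points_iff_sum:
  assumes "graph K" "finite V" "\<Union>K \<subseteq> V"
  shows "x \<in> points K \<longleftrightarrow> (\<forall>w. 0 \<le> x w) \<and> {w. x w \<noteq> 0} \<in> K \<and> (\<Sum>w\<in>V. x w) = 1"
proof -
  have "(\<Sum>w | x w \<noteq> 0. x w) = (\<Sum>w\<in>V. x w)" if "{w. x w \<noteq> 0} \<in> K"
    by (rule support_sum) (use assms that in auto)
  then show ?thesis by (auto simp: points_def)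
qed

lemma points_mono: "K \<subseteq> L \<Longrightarrow> points K \<subseteq> points L"
  by (auto simp: points_def)

lemma continuous_coordinate: "continuous_on S (\<lambda>x. x w)" for S :: "('a \<Rightarrow> 'b::topological_space) set"
  by (rule continuous_on_subset[OF continuous_on_product_coordinates]) simp

lemma closed_cell: "closed (cell s)"
proof -
  have "cell s = (\<Inter>w. {x. 0 \<le> x w}) \<inter> (\<Inter>w\<in>-s. {x. x w = 0}) \<inter> {x. (\<Sum>w\<in>s. x w) = 1}"
    by (auto simp: cell_def)
  moreover have "closed {x :: 'a \<Rightarrow> real. 0 \<le> x w}" for w
    by (intro closed_Collect_le continuous_on_const continuous_coordinate)
  moreover have "closed {x :: 'a \<Rightarrow> real. x w = 0}" for w
    by (intro closed_Collect_eq continuous_on_const continuous_coordinate)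
  moreover have "closed {x. (\<Sum>w\<in>s. x w) = (1::real)}"
    by (intro closed_Collect_eq continuous_on_sum continuous_on_const continuous_coordinate)
  ultimately show ?thesis by (metis closed_Int closed_INT)
qed

lemma closed_points: "graph K \<Longrightarrow> closed (points K)"
  by (simp add: points_eq_cells closed_UN graph_finite closed_cell)

definition segment :: "'a \<Rightarrow> 'a \<Rightarrow> real \<Rightarrow> 'a \<Rightarrow> real" where
  "segment p q t = (\<lambda>w. (1 - t) * vertex_point p w + t * vertex_point q w)"

lemma segment_coords:
  "p \<noteq> q \<Longrightarrow> segment p q t p = 1 - t" "p \<noteq> q \<Longrightarrow> segment p q t q = t"
  "w \<noteq> p \<Longrightarrow> w \<noteq> q \<Longrightarrow> segment p q t w = 0"
  by (auto simp: segment_def vertex_point_def)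

lemma segment_ends [simp]: "segment p q 0 = vertex_point p" "segment p q 1 = vertex_point q"
  by (auto simp: segment_def)

lemma continuous_on_segment:
  assumes "continuous_on S f"
  shows "continuous_on S (\<lambda>z. segment p q (f z))"
  unfolding segment_def by (intro continuous_intros continuous_on_coordinatewise_then_product assms)

lemma cell_edge: "p \<noteq> q \<Longrightarrow> cell {p, q} = segment p q ` {0..1}"
proof (intro equalityI subsetI)
  fix x assume pq: "p \<noteq> q" and x: "x \<in> cell {p, q}"
  then have "x = segment p q (x q)"
    by (simp add: cell_def segment_def vertex_point_def fun_eq_iff eq_diff_eq)
  moreover have "0 \<le> x p" "x p + x q = 1" using x pq by (simp_all add: cell_def)
  then have "x q \<le> 1" by linarith
  ultimately show "x \<in> segment p q ` {0..1}" using x by (auto simp: cell_def)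
qed (auto simp: cell_def segment_coords, auto simp: segment_def vertex_point_def)

lemma cell_vertex: "cell {p} = {vertex_point p}"
  by (auto simp: cell_def vertex_point_def fun_eq_iff)

lemma vertex_point_in: "\<lbrakk>graph K; {p} \<in> K\<rbrakk> \<Longrightarrow> vertex_point p \<in> points K"
  using cell_vertex[of p] points_eq_cells[of K] by auto

lemma segment_in: "\<lbrakk>graph K; {p, q} \<in> K; p \<noteq> q; 0 \<le> t; t \<le> 1\<rbrakk> \<Longrightarrow> segment p q t \<in> points K"
  using cell_edge[of p q] points_eq_cells[of K] by auto

lemma support_segment: "\<lbrakk>p \<noteq> q; 0 < t; t < 1\<rbrakk> \<Longrightarrow> {w. segment p q t w \<noteq> 0} = {p, q}"
  by (auto simp: segment_def vertex_point_def split: if_splits)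

lemma support_vertex_point: "{w. vertex_point p w \<noteq> 0} = {p}"
  by (auto simp: vertex_point_def)

lemma graph_insert_vertex: "graph G \<Longrightarrow> graph (insert {w} G)"
  by (auto simp: graph_def)

lemma graph_insert_edge: 
  assumes "graph G" "{p} \<in> G" "{q} \<in> G"
  shows "graph (insert {p, q} G)"
proof -
  have "t \<in> insert {p, q} G" if "t \<subseteq> {p, q}" "t \<noteq> {}" for t
  proof -
    have "t = {p} \<or> t = {q} \<or> t = {p, q}" using that by (cases "p \<in> t"; cases "q \<in> t") auto
    then show ?thesis using assms by auto
  qed
  then show ?thesis using assms by (auto simp: graph_def card_insert_if)
qed

text \<open>
  Edges can be removed from a graph one by one, and once none is left, so can vertices.
\<close>
lemma graph_induct [consumes 1, case_names empty vertex edge]: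
  assumes "graph K" and "P {}"
    and "\<And>G w. \<lbrakk>graph G; {w} \<notin> G; P G\<rbrakk> \<Longrightarrow> P (insert {w} G)"
    and "\<And>G p q. \<lbrakk>graph G; {p} \<in> G; {q} \<in> G; p \<noteq> q; {p, q} \<notin> G; P G\<rbrakk> \<Longrightarrow> P (insert {p, q} G)"
  shows "P K"
  using assms(1)
proof (induction "card K" arbitrary: K rule: less_induct)
  case less
  have fin: "finite K" using less.prems graph_finite by blast
  show ?case
  proof (cases "\<exists>p q. p \<noteq> q \<and> {p, q} \<in> K")
    case True
    then obtain p q where pq: "p \<noteq> q" "{p, q} \<in> K" by blast
    let ?G = "K - {{p, q}}"
    have G: "graph ?G"
    proof -
      have "t \<noteq> {p, q}" if "s \<in> K" "s \<noteq> {p, q}" "t \<subseteq> s" for s t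
      proof
        assume "t = {p, q}"
        have "finite s" "card s \<le> 2" using less.prems that(1) unfolding graph_def by blast+
        then have "t = s" using that(3) \<open>t = {p, q}\<close> pq(1) by (intro card_seteq) auto
        then show False using that \<open>t = {p, q}\<close> by simp
      qed
      with less.prems show ?thesis by (simp add: graph_def) blast
    qed
    have "{p} \<in> ?G" "{q} \<in> ?G" using pq graph_face[OF less.prems pq(2)] by (auto simp: doubleton_eq_iff)
    moreover have "card ?G < card K" using fin pq by (meson card_Diff1_less)
    ultimately have "P (insert {p, q} ?G)" using assms(4) less.hyps G pq by blast
    then show ?thesis using pq by (simp add: insert_absorb)
  next
    case False
    show ?thesis
    proof (cases "K = {}")
      case False
      then obtain s where s: "s \<in> K" by blast
      then obtain w where w: "s = {w}" using \<open>\<not> (\<exists>p q. p \<noteq> q \<and> {p, q} \<in> K)\<close> graph_simplex_cases[OF less.prems s] by metis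
      let ?G = "K - {{w}}"
      have "graph ?G"
      proof -
        have "t \<noteq> {w}" if "s' \<in> K" "s' \<noteq> {w}" "t \<subseteq> s'" for s' t
          using that \<open>\<not> (\<exists>p q. p \<noteq> q \<and> {p, q} \<in> K)\<close> graph_simplex_cases[OF less.prems that(1)]
          by (metis singleton_insert_inj_eq')
        with less.prems show ?thesis by (simp add: graph_def) blast
      qed
      moreover have "card ?G < card K" using fin s w by (meson card_Diff1_less)
      ultimately have "P (insert {w} ?G)" using assms(3) less.hyps by blast
      then show ?thesis using s w by (simp add: insert_absorb)
    qed (use assms(2) in simp)
  qed
qed

lemma points_insert_edge:
  assumes "graph G" "{p} \<in> G" "{q} \<in> G"
  shows "points (insert {p, q} G) = points G \<union> cell {p, q}"
  using points_eq_cells[OF graph_insert_edge[OF assms]] points_eq_cells[OF assms(1)] by auto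

lemma segment_in_subgraph:
  assumes "graph G" "{p} \<in> G" "{q} \<in> G" "p \<noteq> q" "{p, q} \<notin> G" "0 \<le> t" "t \<le> 1"
  shows "segment p q t \<in> points G \<longleftrightarrow> t = 0 \<or> t = 1"
proof
  assume "segment p q t \<in> points G"
  then have "{w. segment p q t w \<noteq> 0} \<in> G" by (simp add: points_def)
  then show "t = 0 \<or> t = 1" using assms support_segment[of p q t] by fastforce
qed (use assms vertex_point_in in auto)

lemma prod_top_of_set_closedin:
  "closed S \<Longrightarrow> S \<subseteq> T \<Longrightarrow> closedin (prod_topology Y (top_of_set T)) (topspace Y \<times> S)"
  by (simp add: closedin_prod_Times_iff closed_subset)

text \<open>
  Adding an edge to the second factor attaches a tube over the first one.
\<close>
lemma edge_tube:
  assumes G: "graph G" "{p} \<in> G" "{q} \<in> G" "p \<noteq> q" "{p, q} \<notin> G"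
  shows "tube Y (prod_topology Y (realization (insert {p, q} G))) (topspace Y \<times> points G)
     (topspace Y \<times> cell {p, q}) (\<lambda>(y, t). (y, segment p q t)) (\<lambda>(y, x). (y, x q))"
proof
  have sub: "cell {p, q} \<subseteq> points (insert {p, q} G)" "points G \<subseteq> points (insert {p, q} G)"
    using points_insert_edge[OF G(1-3)] by auto
  show "closedin (prod_topology Y (realization (insert {p, q} G))) (topspace Y \<times> points G)"
    "closedin (prod_topology Y (realization (insert {p, q} G))) (topspace Y \<times> cell {p, q})"
    using sub G closed_points closed_cell by (auto simp: realization_eq intro!: prod_top_of_set_closedin)
  show "topspace (prod_topology Y (realization (insert {p, q} G))) \<subseteq> topspace Y \<times> points G \<union> topspace Y \<times> cell {p, q}"
    using points_insert_edge[OF G(1-3)] by auto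
  have eq: "subtopology (prod_topology Y (realization (insert {p, q} G))) (topspace Y \<times> cell {p, q})
      = prod_topology Y (top_of_set (cell {p, q}))"
    using sub(1) by (simp add: realization_eq prod_topology_subtopology subtopology_subtopology Times_Int_Times Int_absorb1)
  show "homeomorphic_maps (cylinder Y) (subtopology (prod_topology Y (realization (insert {p, q} G))) (topspace Y \<times> cell {p, q}))
     (\<lambda>(y, t). (y, segment p q t)) (\<lambda>(y, x). (y, x q))"
    unfolding eq cylinder_def
  proof (subst homeomorphic_maps_prod)
    have "homeomorphic_maps (top_of_set {0..1}) (top_of_set (cell {p, q})) (segment p q) (\<lambda>x. x q)"
      using G(4) cell_edge[OF G(4)]
      by (auto simp: homeomorphic_maps_def segment_coords continuous_coordinate 
         intro!: continuous_on_segment[OF continuous_on_id, simplified])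
    then show "prod_topology Y (top_of_set {0..1}) = trivial_topology \<and> prod_topology Y (top_of_set (cell {p, q})) = trivial_topology \<or>
        homeomorphic_maps Y Y (\<lambda>y. y) (\<lambda>y. y) \<and> homeomorphic_maps (top_of_set {0..1}) (top_of_set (cell {p, q})) (segment p q) (\<lambda>x. x q)"
      by (simp add: homeomorphic_maps_def)
  qed
  show "\<And>m t. \<lbrakk>m \<in> topspace Y; 0 \<le> t; t \<le> 1\<rbrakk> \<Longrightarrow> (case (m, t) of (y, t) \<Rightarrow> (y, segment p q t)) \<in> topspace Y \<times> points G \<longleftrightarrow> t = 0 \<or> t = 1"
    using segment_in_subgraph[OF G] by simp
qed

section \<open>The homology of a product with a graph\<close>

lemma trivial_group_one: "\<lbrakk>trivial_group G; x \<in> carrier G\<rbrakk> \<Longrightarrow> x = \<one>\<^bsub>G\<^esub>"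
  by (auto simp: trivial_group_def)

lemma continuous_map_realization_mono:
  "G \<subseteq> K \<Longrightarrow> continuous_map (realization G) (realization K) id"
  using points_mono[of G K] by (auto simp: realization_eq)

lemma prod_realization_subtopology:
  assumes "G \<subseteq> K"
  shows "subtopology (prod_topology Y (realization K)) (topspace Y \<times> points G) = prod_topology Y (realization G)"
  using points_mono[OF assms]
  by (simp add: realization_eq prod_topology_subtopology subtopology_subtopology Times_Int_Times Int_absorb1)

lemma points_insert_vertex: "graph G \<Longrightarrow> points (insert {w} G) = insert (vertex_point w) (points G)"
  using points_eq_cells[of G] points_eq_cells[OF graph_insert_vertex[of G w]] cell_vertex[of w] by simp

lemma vertex_point_notin: "{w} \<notin> G \<Longrightarrow> vertex_point w \<notin> points G"
  by (auto simp: points_def support_vertex_point)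

text \<open>
  An isolated vertex of the second factor contributes one more copy of \<open>Y\<close>.
\<close>
lemma homology_prod_insert_vertex:
  assumes G: "graph G" "{w} \<notin> G" and x: "x \<in> carrier (homology_group p (prod_topology Y (realization (insert {w} G))))"
  obtains a b where "a \<in> carrier (homology_group p (prod_topology Y (realization G)))" "b \<in> carrier (homology_group p Y)"
    "x = hom_induced p (prod_topology Y (realization G)) {} (prod_topology Y (realization (insert {w} G))) {} id a
       \<otimes>\<^bsub>homology_group p (prod_topology Y (realization (insert {w} G)))\<^esub>
       hom_induced p Y {} (prod_topology Y (realization (insert {w} G))) {} (\<lambda>y. (y, vertex_point w)) b"
proof -
  let ?Z = "prod_topology Y (realization (insert {w} G))"
  let ?A = "prod_topology Y (realization G)"
  have S: "?A = subtopology ?Z (topspace Y \<times> points G)"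
    by (rule prod_realization_subtopology[symmetric]) auto
  have notin: "vertex_point w \<notin> points G" by (rule vertex_point_notin[OF G(2)])
  have cl: "closedin ?Z (topspace Y \<times> points G)" "closedin ?Z (topspace Y \<times> {vertex_point w})"
    using points_insert_vertex[OF G(1)] closed_points[OF G(1)] closed_cell[of "{w}"]
    by (auto simp: cell_vertex realization_eq intro!: prod_top_of_set_closedin)
  have "topspace ?Z - topspace Y \<times> {vertex_point w} = topspace Y \<times> points G"
    "topspace ?Z - topspace Y \<times> points G = topspace Y \<times> {vertex_point w}"
    using notin by (auto simp: points_insert_vertex[OF G(1)])
  then have op: "openin ?Z (topspace Y \<times> points G)" "openin ?Z (topspace Y \<times> {vertex_point w})"
    using cl by (metis closedin_def)+
  have "embedding_map ?A ?Z id"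
    unfolding embedding_map_def using op(1) openin_subset[OF op(1)] by (simp add: S Int_absorb1)
  moreover have "embedding_map Y ?Z (\<lambda>y. (y, vertex_point w))"
    by (simp add: embedding_map_graph points_insert_vertex[OF G(1)])
  moreover have "id ` topspace ?A = topspace Y \<times> points G" "(\<lambda>y. (y, vertex_point w)) ` topspace Y = topspace Y \<times> {vertex_point w}"
    by auto
  ultimately have "(\<lambda>(a, b). hom_induced p ?A {} ?Z {} id a \<otimes>\<^bsub>homology_group p ?Z\<^esub> hom_induced p Y {} ?Z {} (\<lambda>y. (y, vertex_point w)) b)
    \<in> iso (homology_group p ?A \<times>\<times> homology_group p Y) (homology_group p ?Z)"
    using op notin points_insert_vertex[OF G(1)] by (intro iso_homology_two_pieces) auto
  then have "x \<in> (\<lambda>(a, b). hom_induced p ?A {} ?Z {} id a \<otimes>\<^bsub>homology_group p ?Z\<^esub> hom_induced p Y {} ?Z {} (\<lambda>y. (y, vertex_point w)) b)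
    ` (carrier (homology_group p ?A) \<times> carrier (homology_group p Y))"
    using x by (simp add: iso_def bij_betw_def)
  then show thesis using that by (elim imageE SigmaE) simp
qed

text \<open>
  A new vertex contributes a copy of the degree \<open>p\<close> homology of \<open>Y\<close>, and a new edge, through its
  tube, one of the degree \<open>p - 1\<close> homology.
\<close>
lemma trivial_homology_prod_graph:
  assumes "graph G" and p: "trivial_group (homology_group p Y)" and p1: "trivial_group (homology_group (p-1) Y)"
  shows "trivial_group (homology_group p (prod_topology Y (realization G)))"
  using assms(1)
proof (induction G rule: graph_induct)
  case empty
  have "topspace (prod_topology Y (realization {})) = {}" by (simp add: points_def)
  then show ?case by (rule trivial_homology_group_empty)
next
  case (vertex G w)
  let ?Z = "prod_topology Y (realization (insert {w} G))"
  interpret Z: group "homology_group p ?Z" by simp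
  have "x = \<one>\<^bsub>homology_group p ?Z\<^esub>" if x: "x \<in> carrier (homology_group p ?Z)" for x
    by (rule homology_prod_insert_vertex[OF vertex(1,2) x])
       (auto dest!: trivial_group_one[OF p] trivial_group_one[OF vertex(3)] simp: group_hom.hom_one[OF group_hom_hom_induced])
  then show ?case using Z.one_closed unfolding trivial_group_def by (auto simp del: Z.one_closed)
next
  case (edge G p' q)
  let ?X = "prod_topology Y (realization (insert {p', q} G))" and ?D = "topspace Y \<times> points G"
  interpret T: tube Y ?X ?D "topspace Y \<times> cell {p', q}" "\<lambda>(y, t). (y, segment p' q t)" "\<lambda>(y, x). (y, x q)"
    by (rule edge_tube) (use edge in auto)
  have S: "subtopology ?X ?D = prod_topology Y (realization G)"
    by (rule prod_realization_subtopology) auto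
  interpret X: group "homology_group p ?X" by simp
  have "x = \<one>\<^bsub>homology_group p ?X\<^esub>" if x: "x \<in> carrier (homology_group p ?X)" for x
  proof -
    let ?r = "hom_induced p ?X {} ?X ?D id"
    have "?r x \<in> carrier (relative_homology_group p ?X ?D)" by (rule hom_induced_carrier)
    then obtain z where "z \<in> carrier (homology_group (p-1) Y)" "?r x = T.tube_class p z"
      using T.iso_tube_class[of p] by (auto simp: iso_def bij_betw_def)
    then have "?r x = T.tube_class p \<one>\<^bsub>homology_group (p-1) Y\<^esub>"
      using trivial_group_one[OF p1] by auto
    also have "\<dots> = \<one>\<^bsub>relative_homology_group p ?X ?D\<^esub>"
      using T.iso_tube_class[of p] by (intro hom_one) (auto simp: iso_def)
    finally have "x \<in> kernel (homology_group p ?X) (relative_homology_group p ?X ?D) ?r"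
      using x by (simp add: kernel_def)
    then obtain a where "a \<in> carrier (homology_group p (subtopology ?X ?D))" "x = hom_induced p (subtopology ?X ?D) {} ?X {} id a"
      unfolding kernel_hom_induced_relativization by blast
    then show ?thesis
      using trivial_group_one[OF edge(6)] group_hom.hom_one[OF group_hom_hom_induced] unfolding S by metis
  qed
  then show ?case using X.one_closed unfolding trivial_group_def by (auto simp del: X.one_closed)
qed

text \<open>
  The case of a one-point factor \<open>Y\<close>.
\<close>
lemma trivial_homology_graph:
  assumes "graph G" "p \<ge> 2"
  shows "trivial_group (homology_group p (realization G))"
proof -
  let ?P = "subtopology (discrete_topology UNIV) {()}"
  have "trivial_group (homology_group p (prod_topology ?P (realization G)))"
    by (intro trivial_homology_prod_graph[OF assms(1)] homology_dimension_axiom) (use assms(2) in auto)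
  moreover have "prod_topology ?P (realization G) homeomorphic_space realization G"
    using homeomorphic_space_prod_topology_sing2[of "()" "discrete_topology UNIV" "realization G"]
      homeomorphic_space_prod_topology_swap homeomorphic_space_sym homeomorphic_space_trans by fastforce
  ultimately show ?thesis
    using homeomorphic_space_imp_isomorphic_homology_groups isomorphic_group_triviality
    by (metis group_relative_homology_group)
qed

definition adjacent :: "'a set set \<Rightarrow> 'a \<Rightarrow> 'a \<Rightarrow> bool" where
  "adjacent K p q \<longleftrightarrow> p \<noteq> q \<and> {p, q} \<in> K"

lemma adjacent_sym: "adjacent K p q \<Longrightarrow> adjacent K q p"
  by (auto simp: adjacent_def insert_commute)

definition edge_chain :: "'a \<Rightarrow> 'a \<Rightarrow> ('a \<Rightarrow> real) chain" where
  "edge_chain p q = chain_map 1 (segment p q) interval_chain"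

lemma singular_chain_edge_chain:
  assumes "graph K" "adjacent K p q"
  shows "singular_chain 1 (realization K) (edge_chain p q)"
  unfolding edge_chain_def
proof (rule singular_chain_chain_map[OF singular_chain_interval_chain])
  show "continuous_map (top_of_set {0..1}) (realization K) (segment p q)"
    using continuous_on_segment[OF continuous_on_id] segment_in[OF assms(1)] assms(2)
    by (auto simp: realization_eq adjacent_def id_def)
qed

lemma chain_map_point_chain: "chain_map 0 f (point_chain x) = point_chain (f x)"
  by (simp add: point_chain_def simplex_map_def o_def cong: restrict_cong)

lemma chain_boundary_edge_chain: "chain_boundary 1 (edge_chain p q) = point_chain (vertex_point q) - point_chain (vertex_point p)"
  using chain_boundary_chain_map[OF singular_chain_interval_chain, of "segment p q"]
  by (simp add: edge_chain_def chain_boundary_interval_chain chain_map_diff chain_map_point_chain flip: One_nat_def)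

lemma reachable_chain:
  assumes "graph K" "(adjacent K)\<^sup>*\<^sup>* p q"
  obtains b where "singular_chain 1 (realization K) b"
    "chain_boundary 1 b = point_chain (vertex_point q) - point_chain (vertex_point p)"
  using assms(2)
proof (induction arbitrary: thesis rule: rtranclp_induct)
  case base
  show ?case by (rule base[of 0]) auto
next
  case (step r q)
  obtain b where b: "singular_chain 1 (realization K) b"
    "chain_boundary 1 b = point_chain (vertex_point r) - point_chain (vertex_point p)" using step.IH by blast
  show ?case
    by (rule step.prems[of "b + edge_chain r q"])
       (use b singular_chain_edge_chain[OF assms(1) step.hyps(2)] chain_boundary_edge_chain[of r q] in \<open>simp_all add: singular_chain_add chain_boundary_add del: One_nat_def\<close>)
qed

text \<open>
  The total weight that a point gives to a union of components is locally constant; this turns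
  combinatorial components into continuous functions.
\<close>
lemma component_weight:
  assumes K: "graph K" and W: "\<And>p q. \<lbrakk>adjacent K p q; p \<in> W\<rbrakk> \<Longrightarrow> q \<in> W" and x: "x \<in> points K"
  shows "(\<Sum>w\<in>W \<inter> \<Union>K. x w) = 0 \<or> (\<Sum>w\<in>W \<inter> \<Union>K. x w) = 1"
proof -
  let ?s = "{w. x w \<noteq> 0}"
  have s: "?s \<in> K" "(\<Sum>w\<in>?s. x w) = 1" using x by (auto simp: points_def)
  have "?s \<subseteq> W \<or> ?s \<inter> W = {}"
    using graph_simplex_cases[OF K s(1)]
  proof cases
    case (2 p q)
    then have "adjacent K p q" using s(1) by (simp add: adjacent_def)
    then have "p \<in> W \<longleftrightarrow> q \<in> W" using W[of p q] W[of q p] adjacent_sym[of K p q] by blast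
    then show ?thesis using 2(2) by auto
  qed auto
  then show ?thesis
  proof
    assume "?s \<subseteq> W"
    then have "(\<Sum>w\<in>?s. x w) = (\<Sum>w\<in>W \<inter> \<Union>K. x w)"
      by (intro sum.mono_neutral_left) (use s graph_finite[OF K] in auto)
    with s show ?thesis by simp
  next
    assume "?s \<inter> W = {}"
    then have "(\<Sum>w\<in>W \<inter> \<Union>K. x w) = 0" by (intro sum.neutral) auto
    then show ?thesis by simp
  qed
qed

lemma continuous_weight: "continuous_on S (\<lambda>x. \<Sum>w\<in>W. x w)" for S :: "('a \<Rightarrow> real) set"
  by (intro continuous_on_sum continuous_coordinate)

definition cross_classes :: "'b topology \<Rightarrow> 'c topology \<Rightarrow> ('b \<times> 'c) chain set set" where
  "cross_classes Y Z = {homologous_rel_set 2 (prod_topology Y Z) {} (product_chain c d) | c d.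
     singular_relcycle 1 Y {} c \<and> singular_relcycle 1 Z {} d}"

lemma cross_classes_carrier: "cross_classes Y Z \<subseteq> carrier (homology_group 2 (prod_topology Y Z))"
  using singular_relcycle_product_chain homology_class_in_carrier[of 2] by (fastforce simp: cross_classes_def)

lemma hom_induced_cross_classes:
  assumes "continuous_map Z Z' id"
  shows "hom_induced 2 (prod_topology Y Z) {} (prod_topology Y Z') {} id ` cross_classes Y Z \<subseteq> cross_classes Y Z'"
proof clarify
  fix w assume "w \<in> cross_classes Y Z"
  then obtain c d where cd: "w = homologous_rel_set 2 (prod_topology Y Z) {} (product_chain c d)"
     "singular_relcycle 1 Y {} c" "singular_relcycle 1 Z {} d" by (auto simp: cross_classes_def)
  have rc: "singular_relcycle 2 (prod_topology Y Z) {} (product_chain c d)"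
    using singular_relcycle_product_chain cd by blast
  have "continuous_map (prod_topology Y Z) (prod_topology Y Z') id"
    using assms by (auto simp: continuous_map_pairwise o_def continuous_map_fst id_def
       intro: continuous_map_compose[OF continuous_map_snd, unfolded o_def])
  then have "hom_induced 2 (prod_topology Y Z) {} (prod_topology Y Z') {} id w
     = homologous_rel_set 2 (prod_topology Y Z') {} (chain_map 2 id (product_chain c d))"
    using hom_induced_chain_map[OF _ _ rc, of "prod_topology Y Z'" id "{}"] cd(1) by simp
  moreover have "chain_map 2 id (product_chain c d) = product_chain c d"
    using rc chain_map_ident[of 2 "prod_topology Y Z"] by (auto simp: singular_cycle)
  moreover have "singular_relcycle 1 Z' {} d"
    using singular_relcycle_chain_map[OF cd(3) assms, of "{}"] cd(3) chain_map_ident by (fastforce simp: singular_cycle)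
  ultimately show "hom_induced 2 (prod_topology Y Z) {} (prod_topology Y Z') {} id w \<in> cross_classes Y Z'"
    using cd(2) by (auto simp: cross_classes_def)
qed

lemma group_hom_generate_subset:
  assumes "group_hom G H h" "A \<subseteq> carrier G" "h ` A \<subseteq> B" "B \<subseteq> carrier H" "x \<in> generate G A"
  shows "h x \<in> generate H B"
  using group_hom.generate_img[OF assms(1,2)] assms group.mono_generate[of H "h ` A" B]
  by (auto simp: group_hom_def)

lemma hom_induced_const:
  assumes "y \<in> topspace Y" "p \<noteq> 0" "z \<in> carrier (homology_group p X)"
  shows "hom_induced p X {} Y {} (\<lambda>_. y) z = \<one>\<^bsub>homology_group p Y\<^esub>"
proof -
  let ?S = "subtopology Y {y}"
  have "hom_induced p X {} Y {} (id \<circ> (\<lambda>_. y)) z = hom_induced p ?S {} Y {} id (hom_induced p X {} ?S {} (\<lambda>_. y) z)"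
    by (rule hom_induced_compose'[symmetric]) (use assms in \<open>auto simp: continuous_map_in_subtopology\<close>)
  moreover have "trivial_group (homology_group p ?S)"
    by (rule homology_dimension_axiom[of _ y]) (use assms in auto)
  then have "hom_induced p X {} ?S {} (\<lambda>_. y) z = \<one>\<^bsub>homology_group p ?S\<^esub>"
    using trivial_group_one hom_induced_carrier by metis
  ultimately show ?thesis
    using group_hom.hom_one[OF group_hom_hom_induced] by (simp add: o_def)
qed


text \<open>
  Fold \<open>Y \<times> G\<close> to \<open>Y\<close> by projecting over the component of \<open>p\<close> and mapping everything else to one
  point. The first copy of \<open>z\<close> goes to \<open>z\<close>, the second one to zero.
\<close>
lemma separated_levels_trivial:
  assumes G: "graph G" "{p} \<in> G" "{q} \<in> G" and sep: "\<not> (adjacent G)\<^sup>*\<^sup>* p q"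
    and z: "z \<in> carrier (homology_group 1 Y)"
    and eq: "hom_induced 1 Y {} (prod_topology Y (realization G)) {} (\<lambda>y. (y, vertex_point p)) z =
      hom_induced 1 Y {} (prod_topology Y (realization G)) {} (\<lambda>y. (y, vertex_point q)) z"
  shows "z = \<one>\<^bsub>homology_group 1 Y\<^esub>"
proof (cases "topspace Y = {}")
  case True
  show ?thesis by (rule trivial_group_one[OF trivial_homology_group_empty[OF True] z])
next
  case False
  then obtain y0 where y0: "y0 \<in> topspace Y" by (meson ex_in_conv)
  let ?Z = "prod_topology Y (realization G)"
  define W where "W = {w. (adjacent G)\<^sup>*\<^sup>* p w}"
  define g where "g = (\<lambda>x :: 'a \<Rightarrow> real. \<Sum>w\<in>W \<inter> \<Union>G. x w)"
  have "r \<in> W" if "adjacent G s r" "s \<in> W" for s r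
    using that unfolding W_def by (simp add: rtranclp.rtrancl_into_rtrancl)
  then have g01: "g x = 0 \<or> g x = 1" if "x \<in> points G" for x
    using component_weight[OF G(1) _ that, of W] unfolding g_def by blast
  have fin: "finite (W \<inter> \<Union>G)" using graph_finite(3)[OF G(1)] by blast
  have gp: "g (vertex_point p) = 1"
    using G(2) fin by (simp add: g_def vertex_point_def sum.delta W_def) (metis UnionI insertI1)
  have gq: "g (vertex_point q) = 0"
    using sep by (simp add: g_def vertex_point_def W_def) (auto intro: sum.neutral)
  let ?\<phi> = "\<lambda>z. if g (snd z) \<le> 1/2 then y0 else fst z"
  have "continuous_map ?Z euclideanreal (g \<circ> snd)"
    by (rule continuous_map_compose[OF continuous_map_snd]) (simp add: g_def[abs_def] realization_eq continuous_weight)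
  then have "continuous_map ?Z Y ?\<phi>"
  proof (intro continuous_map_cases_le)
    show "y0 = fst x" if "x \<in> topspace ?Z" "g (snd x) = 1/2" for x
      using that g01[of "snd x"] by auto
  qed (use y0 in \<open>auto simp: o_def continuous_map_from_subtopology continuous_map_fst\<close>)
  then have "hom_induced 1 Y {} Y {} (?\<phi> \<circ> (\<lambda>y. (y, vertex_point r))) z =
      hom_induced 1 ?Z {} Y {} ?\<phi> (hom_induced 1 Y {} ?Z {} (\<lambda>y. (y, vertex_point r)) z)" if "{r} \<in> G" for r
    using vertex_point_in[OF G(1) that] by (intro hom_induced_compose'[symmetric]) (auto simp: continuous_map_pairwise o_def)
  from this[OF G(2)] this[OF G(3)] eq
  have "hom_induced 1 Y {} Y {} id z = hom_induced 1 Y {} Y {} (\<lambda>_. y0) z"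
    by (simp add: o_def gp gq id_def)
  then show ?thesis using hom_induced_const[OF y0 _ z] hom_induced_id[OF z] by simp
qed

text \<open>
  Suppose that a class \<open>x\<close> crosses the tube of a new edge in \<open>z \<times> e\<close>. If the ends of the edge are
  connected in the old graph by a chain \<open>b\<close>, then \<open>e + b\<close> is a cycle, and \<open>x\<close> minus the cross product
  of \<open>z\<close> with it misses the tube. Otherwise the boundary of \<open>z \<times> e\<close> has its two parts in different
  components, and can only vanish if \<open>z\<close> does.
\<close>
theorem kuenneth_surjective:
  assumes "graph G" and H2: "trivial_group (homology_group 2 Y)"
  shows "carrier (homology_group 2 (prod_topology Y (realization G)))
    \<subseteq> generate (homology_group 2 (prod_topology Y (realization G))) (cross_classes Y (realization G))"
  using assms(1)
proof (induction G rule: graph_induct)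
  case empty
  have "topspace (prod_topology Y (realization {})) = {}" by (simp add: points_def)
  from trivial_homology_group_empty[OF this, of 2] show ?case
    unfolding trivial_group_def by (metis (no_types, lifting) empty_subsetI generate.one insert_subset)
next
  case (vertex G w)
  let ?A = "prod_topology Y (realization G)" and ?Z = "prod_topology Y (realization (insert {w} G))"
  have id: "continuous_map (realization G) (realization (insert {w} G)) id"
    by (rule continuous_map_realization_mono) auto
  show ?case
  proof
    fix x assume "x \<in> carrier (homology_group 2 ?Z)"
    then obtain a b where ab: "a \<in> carrier (homology_group 2 ?A)" "b \<in> carrier (homology_group 2 Y)"
      "x = hom_induced 2 ?A {} ?Z {} id a \<otimes>\<^bsub>homology_group 2 ?Z\<^esub> hom_induced 2 Y {} ?Z {} (\<lambda>y. (y, vertex_point w)) b"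
      using homology_prod_insert_vertex[OF vertex(1,2)] by metis
    interpret Z: group "homology_group 2 ?Z" by simp
    have "b = \<one>\<^bsub>homology_group 2 Y\<^esub>" using trivial_group_one[OF H2 ab(2)] .
    then have "x = hom_induced 2 ?A {} ?Z {} id a"
      using ab(3) by (simp add: group_hom.hom_one[OF group_hom_hom_induced] hom_induced_carrier)
    moreover have "a \<in> generate (homology_group 2 ?A) (cross_classes Y (realization G))" using vertex(3) ab(1) by blast
    ultimately show "x \<in> generate (homology_group 2 ?Z) (cross_classes Y (realization (insert {w} G)))"
      using group_hom_generate_subset[OF group_hom_hom_induced cross_classes_carrier hom_induced_cross_classes[OF id] cross_classes_carrier]
      by simp
  qed
next
  case (edge G p q)
  let ?K = "insert {p, q} G"
  let ?X = "prod_topology Y (realization ?K)" and ?D = "topspace Y \<times> points G"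
  let ?A = "prod_topology Y (realization G)"
  let ?R = "relative_homology_group 2 ?X ?D"
  let ?r = "hom_induced 2 ?X {} ?X ?D id"
  let ?\<kappa> = "\<lambda>(y, t). (y, segment p q t)"
  interpret T: tube Y ?X ?D "topspace Y \<times> cell {p, q}" ?\<kappa> "\<lambda>(y, x). (y, x q)"
    by (rule edge_tube) (use edge in auto)
  have S: "subtopology ?X ?D = ?A"
    by (rule prod_realization_subtopology) auto
  have K: "graph ?K" by (rule graph_insert_edge[OF edge(1-3)])
  have id: "continuous_map (realization G) (realization ?K) id"
    by (rule continuous_map_realization_mono) auto
  interpret X: comm_group "homology_group 2 ?X" by simp
  interpret R: comm_group ?R by simp
  interpret r: group_hom "homology_group 2 ?X" ?R ?r by simp
  let ?gen = "generate (homology_group 2 ?X) (cross_classes Y (realization ?K))"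
  have from_G: "x \<in> ?gen" if x: "x \<in> carrier (homology_group 2 ?X)" "?r x = \<one>\<^bsub>?R\<^esub>" for x
  proof -
    have "x \<in> kernel (homology_group 2 ?X) ?R ?r" using x by (simp add: kernel_def)
    then have "x \<in> hom_induced 2 ?A {} ?X {} id ` carrier (homology_group 2 ?A)"
      unfolding kernel_hom_induced_relativization S .
    then obtain a where a: "a \<in> carrier (homology_group 2 ?A)" "x = hom_induced 2 ?A {} ?X {} id a" ..
    then have "a \<in> generate (homology_group 2 ?A) (cross_classes Y (realization G))" using edge(6) by blast
    then show ?thesis
      using group_hom_generate_subset[OF group_hom_hom_induced cross_classes_carrier hom_induced_cross_classes[OF id] cross_classes_carrier] a(2)
      by simp
  qed
  show ?case
  proof
    fix x assume x: "x \<in> carrier (homology_group 2 ?X)"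
    obtain z where z: "z \<in> carrier (homology_group 1 Y)" "?r x = T.tube_class 2 z"
      using T.iso_tube_class[of 2] r.hom_closed[OF x] by (auto simp: iso_def bij_betw_def)
    obtain c where c: "singular_relcycle 1 Y {} c" "z = homologous_rel_set 1 Y {} c"
      using z(1) carrier_relative_homology_group[of 1 Y "{}"] by auto
    show "x \<in> ?gen"
    proof (cases "(adjacent G)\<^sup>*\<^sup>* q p")
      case True
      \<comment> \<open>close the new edge up to a cycle by a chain in \<open>G\<close>\<close>
      obtain b where b: "singular_chain 1 (realization G) b"
        "chain_boundary 1 b = point_chain (vertex_point p) - point_chain (vertex_point q)"
        using reachable_chain[OF edge(1) True] by blast
      let ?e = "edge_chain p q"
      have bK: "singular_chain 1 (realization ?K) b"
        using b(1) singular_chain_chain_map[OF b(1) id] chain_map_ident[OF b(1)] by simp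
      have e: "singular_chain 1 (realization ?K) ?e"
        using singular_chain_edge_chain[OF K] edge(4) by (simp add: adjacent_def)
      have d: "singular_relcycle 1 (realization ?K) {} (?e + b)"
        using bK e b(2) chain_boundary_edge_chain[of p q]
        by (simp add: singular_cycle singular_chain_add chain_boundary_add del: One_nat_def)
      let ?y = "homologous_rel_set 2 ?X {} (product_chain c (?e + b))"
      have y: "?y \<in> cross_classes Y (realization ?K)" using c(1) d by (auto simp: cross_classes_def)
      have c': "singular_chain 1 Y c" using c by (simp add: singular_cycle)
      have "?r ?y = T.tube_class 2 z"
      proof -
        have rcl: "singular_relcycle 2 ?X {} (product_chain c (?e + b))"
          using singular_relcycle_product_chain[OF c(1) d] .
        have "?r ?y = homologous_rel_set 2 ?X ?D (chain_map 2 id (product_chain c (?e + b)))"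
          using hom_induced_chain_map[OF _ _ rcl, of ?X id ?D] by simp
        also have "chain_map 2 id (product_chain c (?e + b)) = product_chain c (?e + b)"
          using rcl chain_map_ident[of 2 ?X] by (auto simp: singular_cycle)
        also have "homologous_rel_set 2 ?X ?D (product_chain c (?e + b)) = homologous_rel_set 2 ?X ?D (product_chain c ?e)"
        proof -
          have "singular_chain 2 (subtopology ?X ?D) (product_chain c b)"
            unfolding S by (rule singular_chain_product_chain[OF c' b(1)])
          then have "homologous_rel 2 ?X ?D (product_chain c (?e + b)) (product_chain c ?e)"
            by (simp add: homologous_rel_def product_chain_add singular_chain_imp_relboundary)
          then show ?thesis by (simp only: homologous_rel_set_eq)
        qed
        also have "product_chain c ?e = chain_map 2 ?\<kappa> (product_chain c interval_chain)"
          using chain_map_prod_product_chain[of id "segment p q" c interval_chain] chain_map_ident[OF c']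
          by (simp add: edge_chain_def map_prod_def id_def del: One_nat_def)
        also have "homologous_rel_set 2 ?X ?D \<dots> = hom_induced 2 (cylinder Y) (cylinder_ends Y) ?X ?D ?\<kappa>
            (homologous_rel_set 2 (cylinder Y) (cylinder_ends Y) (product_chain c interval_chain))"
          using hom_induced_chain_map[OF T.kappa_cont _ cylinder_class_cycle(2)[OF c(1)], of ?D] T.kappa_ends_image
          by (simp add: image_subset_iff_funcset[symmetric])
        also have "\<dots> = T.tube_class 2 z"
          using cylinder_class_cycle(1)[OF c(1)] c(2) by (simp add: T.tube_class_def)
        finally show ?thesis .
      qed
      then have rr: "?r x = ?r ?y" using z(2) by simp
      have yc: "?y \<in> carrier (homology_group 2 ?X)" using y cross_classes_carrier by blast
      have "x \<otimes>\<^bsub>homology_group 2 ?X\<^esub> inv\<^bsub>homology_group 2 ?X\<^esub> ?y \<in> ?gen"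
        by (rule from_G) (use x yc rr in auto)
      then have "x \<otimes>\<^bsub>homology_group 2 ?X\<^esub> inv\<^bsub>homology_group 2 ?X\<^esub> ?y \<otimes>\<^bsub>homology_group 2 ?X\<^esub> ?y \<in> ?gen"
        by (rule generate.eng[OF _ generate.incl[OF y]])
      then show ?thesis using x yc by (simp add: X.m_assoc)
    next
      case False
      have "(\<lambda>m. ?\<kappa> (m, 0)) = (\<lambda>y. (y, vertex_point p))" "(\<lambda>m. ?\<kappa> (m, 1)) = (\<lambda>y. (y, vertex_point q))" by auto
      moreover have "hom_boundary 2 ?X ?D (?r x) = \<one>\<^bsub>homology_group 1 ?A\<^esub>"
      proof -
        have "?r x \<in> kernel ?R (homology_group (2-1) (subtopology ?X ?D)) (hom_boundary 2 ?X ?D)"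
          unfolding kernel_hom_boundary using x by blast
        then show ?thesis unfolding S by (simp add: kernel_def)
      qed
      ultimately have e1: "hom_induced 1 Y {} ?A {} (\<lambda>y. (y, vertex_point p)) z \<otimes>\<^bsub>homology_group 1 ?A\<^esub>
         inv\<^bsub>homology_group 1 ?A\<^esub> hom_induced 1 Y {} ?A {} (\<lambda>y. (y, vertex_point q)) z = \<one>\<^bsub>homology_group 1 ?A\<^esub>"
        using T.hom_boundary_tube_class[of z 2] z unfolding S by simp
      interpret A: comm_group "homology_group 1 ?A" by simp
      have "hom_induced 1 Y {} ?A {} (\<lambda>y. (y, vertex_point p)) z = hom_induced 1 Y {} ?A {} (\<lambda>y. (y, vertex_point q)) z"
        using e1 A.inv_equality[of "hom_induced 1 Y {} ?A {} (\<lambda>y. (y, vertex_point p)) z" "inv\<^bsub>homology_group 1 ?A\<^esub> hom_induced 1 Y {} ?A {} (\<lambda>y. (y, vertex_point q)) z"]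
        by (simp add: hom_induced_carrier)
      moreover have "\<not> (adjacent G)\<^sup>*\<^sup>* p q"
        using False adjacent_sym[of G] by (metis sympD sympI symp_rtranclp)
      ultimately have "z = \<one>\<^bsub>homology_group 1 Y\<^esub>"
        using separated_levels_trivial[OF edge(1-3) _ z(1)] by blast
      then have "?r x = \<one>\<^bsub>?R\<^esub>"
        using z(2) T.iso_tube_class[of 2] hom_one[of "T.tube_class 2" "homology_group 1 Y" ?R] by (simp add: iso_def)
      then show ?thesis using from_G x by blast
    qed
  qed
qed

section \<open>Two tokens on a graph\<close>

inductive token_move :: "('a \<Rightarrow> 'a \<Rightarrow> bool) \<Rightarrow> 'a set \<Rightarrow> 'a \<times> 'a \<Rightarrow> 'a \<times> 'a \<Rightarrow> bool"
  for E :: "'a \<Rightarrow> 'a \<Rightarrow> bool" and W :: "'a set" where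
  move_fst: "\<lbrakk>E p p'; p \<in> W; p' \<in> W; q \<in> W; q \<noteq> p; q \<noteq> p'\<rbrakk> \<Longrightarrow> token_move E W (p, q) (p', q)"
| move_snd: "\<lbrakk>E p p'; p \<in> W; p' \<in> W; q \<in> W; q \<noteq> p; q \<noteq> p'\<rbrakk> \<Longrightarrow> token_move E W (q, p) (q, p')"

abbreviation token_path :: "('a \<Rightarrow> 'a \<Rightarrow> bool) \<Rightarrow> 'a set \<Rightarrow> 'a \<times> 'a \<Rightarrow> 'a \<times> 'a \<Rightarrow> bool" where
  "token_path E W \<equiv> (token_move E W)\<^sup>*\<^sup>*"

definition tokens_connected :: "('a \<Rightarrow> 'a \<Rightarrow> bool) \<Rightarrow> 'a set \<Rightarrow> bool" where
  "tokens_connected E W \<longleftrightarrow>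
     (\<forall>p\<in>W. \<forall>q\<in>W. \<forall>p'\<in>W. \<forall>q'\<in>W. p \<noteq> q \<longrightarrow> p' \<noteq> q' \<longrightarrow> token_path E W (p, q) (p', q'))"

definition path_order :: "('a \<Rightarrow> 'a \<Rightarrow> bool) \<Rightarrow> 'a set \<Rightarrow> (nat \<Rightarrow> 'a) \<Rightarrow> nat \<Rightarrow> bool" where
  "path_order E W f n \<longleftrightarrow> bij_betw f {..n} W \<and> (\<forall>i\<le>n. \<forall>j\<le>n. E (f i) (f j) \<longleftrightarrow> j = Suc i \<or> i = Suc j)"

lemma token_move_mono: "token_move E W x y \<Longrightarrow> W \<subseteq> W' \<Longrightarrow> token_move E W' x y"
  by (induction rule: token_move.induct) (auto intro: token_move.intros)

lemma token_path_mono: "token_path E W x y \<Longrightarrow> W \<subseteq> W' \<Longrightarrow> token_path E W' x y"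
  by (induction rule: rtranclp_induct) (auto intro: token_move_mono rtranclp.rtrancl_into_rtrancl)

lemma token_move_swap: "token_move E W x y \<Longrightarrow> token_move E W (prod.swap x) (prod.swap y)"
  by (induction rule: token_move.induct) (auto intro: token_move.intros)

lemma token_path_swap: "token_path E W x y \<Longrightarrow> token_path E W (prod.swap x) (prod.swap y)"
  by (induction rule: rtranclp_induct) (auto intro: token_move_swap rtranclp.rtrancl_into_rtrancl)

locale sym_relation =
  fixes E :: "'a \<Rightarrow> 'a \<Rightarrow> bool"
  assumes E_sym: "E p q \<Longrightarrow> E q p" and E_irrefl: "\<not> E p p"
begin

lemma token_move_sym: "token_move E W x y \<Longrightarrow> token_move E W y x"
  by (induction rule: token_move.induct) (auto intro: token_move.intros E_sym)

lemma token_path_sym: "token_path E W x y \<Longrightarrow> token_path E W y x"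
  by (induction rule: rtranclp_induct) (auto intro: token_move_sym converse_rtranclp_into_rtranclp)

lemma token_path_trans: "token_path E W x y \<Longrightarrow> token_path E W y z \<Longrightarrow> token_path E W x z"
  by (rule rtranclp_trans)

text \<open>Along a path the two tokens keep their order, and every ordered position is reachable.\<close>
lemma path_order_tokens:
  assumes f: "path_order E W f n" and ij: "i < j" "j \<le> n"
  shows "token_path E W (f i, f j) (f 0, f n)"
proof -
  have inW: "f k \<in> W" if "k \<le> n" for k using f that by (auto simp: path_order_def bij_betw_def)
  have ne: "f k \<noteq> f l" if "k \<le> n" "l \<le> n" "k \<noteq> l" for k l
    using f that by (auto simp: path_order_def bij_betw_def inj_on_def)
  have adj: "E (f k) (f (Suc k))" if "Suc k \<le> n" for k using f that by (auto simp: path_order_def)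
  have a: "token_path E W (f i, f j) (f i, f (j + d))" if "j + d \<le> n" for d
    using that
  proof (induction d)
    case (Suc d)
    then have "token_move E W (f i, f (j + d)) (f i, f (Suc (j + d)))"
      using ij by (intro move_snd inW ne adj) auto
    then show ?case using Suc by (auto intro: rtranclp.rtrancl_into_rtrancl)
  qed auto
  have b: "token_path E W (f i, f n) (f (i - d), f n)" for d
  proof (induction d)
    case (Suc d)
    show ?case
    proof (cases "i - d = 0")
      case False
      then obtain k where k: "i - d = Suc k" by (metis not0_implies_Suc)
      then have "token_move E W (f (i - d), f n) (f k, f n)"
        unfolding k using ij k by (intro move_fst inW ne adj[THEN E_sym]) auto
      moreover have "i - Suc d = k" using k by simp
      ultimately show ?thesis using Suc by (auto intro: rtranclp.rtrancl_into_rtrancl)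
    qed (use Suc in auto)
  qed auto
  show ?thesis using token_path_trans[of W "(f i, f j)" "(f i, f n)" "(f 0, f n)"] a[of "n - j"] b[of i] ij by simp
qed

lemma path_order_tokens2:
  assumes f: "path_order E W f n" and ij: "i < j" "j \<le> n" and kl: "k < l" "l \<le> n"
  shows "token_path E W (f i, f j) (f k, f l)" "token_path E W (f j, f i) (f l, f k)"
proof -
  show *: "token_path E W (f i, f j) (f k, f l)"
    using token_path_trans[OF path_order_tokens[OF f ij] token_path_sym[OF path_order_tokens[OF f kl]]] .
  show "token_path E W (f j, f i) (f l, f k)"
    using token_path_swap[OF *] by simp
qed

text \<open>
  The positions of two tokens on a path fall into two classes according to their order. A single
  passage from one class to the other connects everything.
\<close>
lemma path_order_switch:
  assumes f: "path_order E W f n" and "W \<subseteq> W'" and ij: "i < j" "j \<le> n" and kl: "k < l" "l \<le> n"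
    and sw: "token_path E W' (f i, f j) (f l, f k)"
    and p: "p \<in> W" "q \<in> W" "p \<noteq> q" and p': "p' \<in> W" "q' \<in> W" "p' \<noteq> q'"
  shows "token_path E W' (p, q) (p', q')"
proof -
  have *: "token_path E W' (p, q) (f i, f j)" if pq: "p \<in> W" "q \<in> W" "p \<noteq> q" for p q
  proof -
    have im: "W = f ` {..n}" using f by (auto simp: path_order_def bij_betw_def)
    obtain a where a: "a \<le> n" "p = f a" using pq im by auto
    obtain b where b: "b \<le> n" "q = f b" using pq im by auto
    consider "a < b" | "b < a" using pq a b by (metis linorder_neqE_nat)
    then show ?thesis
    proof cases
      case 1
      then show ?thesis
        using token_path_mono[OF path_order_tokens2(1)[OF f 1 b(1) ij] assms(2)] a b by simp
    next
      case 2
      have "token_path E W' (p, q) (f l, f k)"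
        using token_path_mono[OF path_order_tokens2(2)[OF f 2 a(1) kl] assms(2)] a b by simp
      then show ?thesis using token_path_trans token_path_sym[OF sw] by blast
    qed
  qed
  show ?thesis using token_path_trans[OF *[OF p] token_path_sym[OF *[OF p']]] .
qed

text \<open>
  A token on the new vertex can always step back into \<open>W\<close>: if the other token blocks the neighbour
  \<open>a\<close>, that token moves away first.
\<close>
lemma tokens_extend:
  assumes old: "\<And>p q p' q'. \<lbrakk>p \<in> W; q \<in> W; p \<noteq> q; p' \<in> W; q' \<in> W; p' \<noteq> q'\<rbrakk> \<Longrightarrow> token_path E (insert w W) (p, q) (p', q')"
    and nb: "\<And>p. p \<in> W \<Longrightarrow> \<exists>q\<in>W. E p q" and w: "w \<notin> W" "a \<in> W" "E w a"
  shows "tokens_connected E (insert w W)"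
proof -
  let ?W = "insert w W"
  obtain b where b: "b \<in> W" "E a b" using nb w by blast
  have ab: "a \<noteq> b" using b E_irrefl by auto
  have wq: "token_path E ?W (w, q) (a, b)" if q: "q \<in> W" for q
  proof (cases "q = a")
    case True
    have "token_move E ?W (w, a) (w, b)" by (rule move_snd) (use b w in auto)
    moreover have "token_move E ?W (w, b) (a, b)" by (rule move_fst) (use b w ab in auto)
    ultimately show ?thesis using True by (meson converse_rtranclp_into_rtranclp r_into_rtranclp)
  next
    case False
    have "token_move E ?W (w, q) (a, q)" by (rule move_fst) (use q w False in auto)
    moreover have "token_path E ?W (a, q) (a, b)" by (rule old) (use q w False b ab in auto)
    ultimately show ?thesis by (meson converse_rtranclp_into_rtranclp)
  qed
  have qw: "token_path E ?W (q, w) (a, b)" if q: "q \<in> W" for q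
    using token_path_swap[OF wq[OF q]] old[of b a a b] w b ab token_path_trans by fastforce
  have all: "token_path E ?W (p, q) (a, b)" if "p \<in> ?W" "q \<in> ?W" "p \<noteq> q" for p q
    using that wq qw old[of p q a b] w b ab by auto
  show ?thesis unfolding tokens_connected_def using token_path_trans[OF all token_path_sym[OF all]] by auto
qed

lemma path_order_extend:
  assumes f: "path_order E W f n" and w: "w \<notin> W" and nb: "\<And>q. q \<in> W \<Longrightarrow> E w q \<longleftrightarrow> q = f n"
  shows "path_order E (insert w W) (f(Suc n := w)) (Suc n)"
proof -
  have b: "bij_betw f {..n} W" using f by (simp add: path_order_def)
  have "bij_betw (f(Suc n := w)) {..Suc n} (insert w W)"
  proof -
    have "bij_betw (f(Suc n := w)) {..n} W" using b by (rule bij_betw_cong[THEN iffD1, rotated]) auto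
    then show ?thesis using w notIn_Un_bij_betw3[of "Suc n" "{..n}" "f(Suc n := w)" W] by (simp add: atMost_Suc)
  qed
  moreover have inW: "f k \<in> W" if "k \<le> n" for k using b that by (auto simp: bij_betw_def)
  have inj: "f k = f n \<longleftrightarrow> k = n" if "k \<le> n" for k using b that by (auto simp: bij_betw_def inj_on_def)
  have "E w (f k) \<longleftrightarrow> k = n" "E (f k) w \<longleftrightarrow> k = n" if "k \<le> n" for k
    using nb[OF inW[OF that]] inj[OF that] E_sym by auto
  then have "\<forall>i\<le>Suc n. \<forall>j\<le>Suc n. E ((f(Suc n := w)) i) ((f(Suc n := w)) j) \<longleftrightarrow> j = Suc i \<or> i = Suc j"
    using f E_irrefl by (auto simp: path_order_def le_Suc_eq)
  ultimately show ?thesis by (simp add: path_order_def)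
qed

lemma path_order_rev:
  assumes f: "path_order E W f n"
  shows "path_order E W (\<lambda>i. f (n - i)) n"
proof -
  have "bij_betw (\<lambda>i. n - i) {..n} {..n}"
    by (rule bij_betw_byWitness[of _ "\<lambda>i. n - i"]) auto
  then have "bij_betw (f \<circ> (\<lambda>i. n - i)) {..n} W"
    using f by (auto simp: path_order_def intro: bij_betw_trans)
  moreover have "n - j = Suc (n - i) \<or> n - i = Suc (n - j) \<longleftrightarrow> j = Suc i \<or> i = Suc j" if "i \<le> n" "j \<le> n" for i j
    using that by auto
  ultimately show ?thesis using f by (simp add: path_order_def o_def)
qed

text \<open>
  Adding a vertex to a path: either the path becomes longer, or the new vertex creates a place where
  the two tokens can pass each other.
\<close>
lemma path_or_tokens_connected_insert:
  assumes f: "path_order E W f n" and n: "1 \<le> n" and w: "w \<notin> W" "a \<in> W" "E w a"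
  shows "(\<exists>f' n'. 1 \<le> n' \<and> path_order E (insert w W) f' n') \<or> tokens_connected E (insert w W)"
proof -
  let ?W = "insert w W"
  have im: "W = f ` {..n}" using f by (auto simp: path_order_def bij_betw_def)
  have inW: "f k \<in> W" if "k \<le> n" for k using im that by auto
  have ne: "f k \<noteq> f l" if "k \<le> n" "l \<le> n" "k \<noteq> l" for k l
    using f that by (auto simp: path_order_def bij_betw_def inj_on_def)
  have adj: "E (f k) (f (Suc k))" if "Suc k \<le> n" for k using f that by (auto simp: path_order_def)
  have nw: "f k \<noteq> w" if "k \<le> n" for k using inW[OF that] w by auto
  have nb: "\<exists>q\<in>W. E p q" if p: "p \<in> W" for p
  proof -
    obtain k where k: "k \<le> n" "p = f k" using p im by auto
    show ?thesis
    proof (cases k)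
      case 0
      then show ?thesis using k adj[of 0] inW[of 1] n by auto
    next
      case (Suc m)
      then show ?thesis using k adj[of m, THEN E_sym] inW[of m] by auto
    qed
  qed
  have conn: "tokens_connected E ?W" if "i < j" "j \<le> n" "k < l" "l \<le> n" "token_path E ?W (f i, f j) (f l, f k)" for i j k l
    by (rule tokens_extend[OF path_order_switch[OF f _ that] nb w]) auto
  obtain i where i: "i \<le> n" "a = f i" using w im by auto
  show ?thesis
  proof (cases "\<exists>j\<le>n. j \<noteq> i \<and> E w (f j)")
    case True
    \<comment> \<open>two neighbours: \<open>w\<close> closes a cycle, on which the tokens rotate\<close>
    then obtain j where j: "j \<le> n" "j \<noteq> i" "E w (f j)" by blast
    have *: "tokens_connected E ?W" if kl: "k < l" "l \<le> n" "E w (f k)" "E w (f l)" for k l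
    proof -
      have "token_move E ?W (f k, f l) (w, f l)"
        by (rule move_fst) (use kl E_sym inW nw[of k] nw[of l] ne[of k l] in auto)
      moreover have "token_path E ?W (w, f l) (w, f (l - d))" for d
      proof (induction d)
        case (Suc d)
        show ?case
        proof (cases "l - d = 0")
          case False
          then obtain m where m: "l - d = Suc m" by (metis not0_implies_Suc)
          have "token_move E ?W (w, f (l - d)) (w, f m)"
            unfolding m using m kl by (intro move_snd adj[THEN E_sym] insertI2 inW insertI1 nw[symmetric]) auto
          moreover have "l - Suc d = m" using m by simp
          ultimately show ?thesis using Suc by (auto intro: rtranclp.rtrancl_into_rtrancl)
        qed (use Suc in auto)
      qed auto
      from this[of "l - k"] have "token_path E ?W (w, f l) (w, f k)" using kl by simp
      moreover have "token_move E ?W (w, f k) (f l, f k)"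
        by (rule move_fst) (use kl E_sym inW nw[of k] nw[of l] ne[of k l] in auto)
      ultimately have "token_path E ?W (f k, f l) (f l, f k)"
        by (meson converse_rtranclp_into_rtranclp rtranclp.rtrancl_into_rtrancl)
      then show ?thesis using conn kl by blast
    qed
    show ?thesis using *[of i j] *[of j i] i j w by (metis linorder_neqE_nat)
  next
    case False
    then have nbw: "E w q \<longleftrightarrow> q = f i" if "q \<in> W" for q using that im i w by auto
    consider "i = n" | "i = 0" | "0 < i" "i < n" using i by linarith
    then show ?thesis
    proof cases
      case 1
      then show ?thesis using path_order_extend[OF f w(1)] nbw by (metis le_SucI n)
    next
      case 2
      then show ?thesis using path_order_extend[OF path_order_rev[OF f] w(1)] nbw by (metis diff_self_eq_0 le_SucI n)
    next
      case 3
      \<comment> \<open>a star with three arms: one token waits in \<open>w\<close> while the other passes\<close>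
      then obtain m where m: "i = Suc m" by (cases i) auto
      have e: "E (f m) (f i)" "E (f i) (f (Suc i))" "E w (f i)" using adj[of m] adj[of i] 3 m i w by auto
      have d: "f m \<noteq> f i" "f m \<noteq> f (Suc i)" "f i \<noteq> f (Suc i)" "w \<noteq> f m" "w \<noteq> f i" "w \<noteq> f (Suc i)"
        using ne[of m i] ne[of m "Suc i"] ne[of i "Suc i"] nw[of m] nw[of i] nw[of "Suc i"] m 3 by auto
      have s: "f m \<in> ?W" "f i \<in> ?W" "f (Suc i) \<in> ?W" "w \<in> ?W" using inW m 3 by auto
      have "token_move E ?W (f m, f i) (f m, w)" "token_move E ?W (f m, w) (f i, w)"
        "token_move E ?W (f i, w) (f (Suc i), w)" "token_move E ?W (f (Suc i), w) (f (Suc i), f i)"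
        using e d s E_sym by (auto intro!: token_move.intros)
      then have "token_path E ?W (f m, f i) (f (Suc i), f i)"
        by (meson converse_rtranclp_into_rtranclp rtranclp.rtrancl_refl)
      then show ?thesis using conn[of m i i "Suc i"] 3 m by auto
    qed
  qed
qed

text \<open>
  The dichotomy is carried along while a set of vertices grows to \<open>V\<close>, one neighbour at a time. A
  largest set for which it holds must be everything.
\<close>
theorem path_or_tokens_connected:
  assumes fin: "finite V" and two: "u \<in> V" "v \<in> V" "E u v"
    and conn: "\<And>W. \<lbrakk>W \<subseteq> V; W \<noteq> {}; W \<noteq> V\<rbrakk> \<Longrightarrow> \<exists>a\<in>W. \<exists>w\<in>V - W. E w a"
  shows "(\<exists>f n. path_order E V f n) \<or> tokens_connected E V"
proof -
  define good where "good = (\<lambda>W. u \<in> W \<and> v \<in> W \<and> W \<subseteq> V \<and> (\<forall>p\<in>W. \<exists>q\<in>W. E p q) \<and>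
     ((\<exists>f n. 1 \<le> n \<and> path_order E W f n) \<or> tokens_connected E W))"
  have uv: "u \<noteq> v" using two E_irrefl by auto
  have "path_order E {u, v} (\<lambda>i. if i = 0 then u else v) 1"
    using two uv E_sym E_irrefl
    by (auto simp: path_order_def bij_betw_def inj_on_def le_Suc_eq atMost_Suc)
  then have "\<exists>f n. 1 \<le> n \<and> path_order E {u, v} f n" by blast
  then have "good {u, v}" using two E_sym by (auto simp: good_def)
  moreover have "\<And>W. good W \<Longrightarrow> card W \<le> card V" using fin by (auto simp: good_def card_mono)
  ultimately obtain W where W: "good W" "\<And>W'. good W' \<Longrightarrow> card W' \<le> card W"
    using ex_has_greatest_nat[of good "{u, v}" card "Suc (card V)"] by (metis le_imp_less_Suc)
  have "W = V"
  proof (rule ccontr)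
    assume "W \<noteq> V"
    then obtain a w where aw: "a \<in> W" "w \<in> V" "w \<notin> W" "E w a"
      using conn[of W] W(1) by (auto simp: good_def)
    have nb: "\<And>p. p \<in> W \<Longrightarrow> \<exists>q\<in>W. E p q" using W(1) by (auto simp: good_def)
    have "(\<exists>f n. 1 \<le> n \<and> path_order E (insert w W) f n) \<or> tokens_connected E (insert w W)"
    proof (cases "tokens_connected E W")
      case True
      have "token_path E (insert w W) (p, q) (p', q')"
        if "p \<in> W" "q \<in> W" "p \<noteq> q" "p' \<in> W" "q' \<in> W" "p' \<noteq> q'" for p q p' q'
        using True that unfolding tokens_connected_def by (meson token_path_mono subset_insertI)
      then show ?thesis using tokens_extend[OF _ nb aw(3,1,4)] by blast
    next
      case False
      then obtain f n where "1 \<le> n" "path_order E W f n" using W(1) by (auto simp: good_def)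
      then show ?thesis using path_or_tokens_connected_insert aw by metis
    qed
    then have "good (insert w W)"
      using W(1) aw nb E_sym unfolding good_def by (metis insert_iff insert_subset)
    moreover have "card (insert w W) = Suc (card W)"
      using W(1) aw fin by (auto simp: good_def intro: card_insert_disjoint finite_subset)
    ultimately show False using W(2) by fastforce
  qed
  then show ?thesis using W(1) by (auto simp: good_def)
qed

end

section \<open>From the configuration space to the discrete configuration space\<close>

lemma closure_of_path_end:
  assumes "continuous_map (top_of_set {0..1::real}) X g" "\<And>t. \<lbrakk>0 < t; t \<le> 1\<rbrakk> \<Longrightarrow> g t \<in> S"
  shows "g 0 \<in> X closure_of S"
proof -
  have "0 \<in> top_of_set {0..1::real} closure_of {0<..1}"
    by (simp add: closure_of_subtopology Int_absorb1 greaterThanAtMost_subseteq_atLeastAtMost_iff)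
  then have "g 0 \<in> X closure_of (g ` {0<..1})"
    using continuous_map_image_closure_subset[OF assms(1)] by blast
  moreover have "g ` {0<..1} \<subseteq> S" using assms(2) by auto
  ultimately show ?thesis using closure_of_mono by blast
qed

lemma points_support:
  "x \<in> points K \<Longrightarrow> {w. x w \<noteq> 0} \<in> K" "x \<in> points K \<Longrightarrow> 0 \<le> x w"
  by (auto simp: points_def)

lemma points_supportE:
  assumes "graph K" "x \<in> points K"
  obtains w where "x w \<noteq> 0"
  using points_support(1)[OF assms(2)] graph_nonempty[OF assms(1)] by (metis (mono_tags) Collect_empty_eq)

text \<open>
  Every point of a closed cell is the end of a straight path through the open cell.
\<close>
lemma supp_eq_cell:
  assumes K: "graph K" and x: "x \<in> points K"
  shows "supp K x = cell {w. x w \<noteq> 0}"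
proof -
  let ?s = "{w. x w \<noteq> 0}"
  have s: "?s \<in> K" "finite ?s" using points_support(1)[OF x] graph_finite[OF K] by auto
  have sub: "cell ?s \<subseteq> points K" using points_eq_cells[OF K] s by auto
  have oc: "open_cell K ?s \<subseteq> cell ?s"
    using support_sum[OF s(2)] by (fastforce simp: open_cell_def points_def cell_def)
  have "closedin (realization K) (cell ?s)"
    using closed_subset[OF sub closed_cell] by (simp add: realization_eq)
  then have "supp K x \<subseteq> cell ?s"
    unfolding supp_def using oc by (rule closure_of_minimal[rotated])
  moreover have "cell ?s \<subseteq> supp K x"
  proof
    fix y assume y: "y \<in> cell ?s"
    let ?g = "\<lambda>t w. (1 - t) * y w + t * x w"
    have xc: "x \<in> cell ?s" using x support_sum[OF s(2), of x] by (auto simp: points_def cell_def)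
    have g: "?g t \<in> cell ?s" if "0 \<le> t" "t \<le> 1" for t
      using that y xc by (auto simp: cell_def sum.distrib simp flip: sum_distrib_left)
    have "continuous_on {0..1} ?g"
      by (intro continuous_on_coordinatewise_then_product continuous_intros)
    then have c: "continuous_map (top_of_set {0..1}) (realization K) ?g"
      using g sub by (auto simp: realization_eq)
    have oc: "?g t \<in> open_cell K ?s" if "0 < t" "t \<le> 1" for t
    proof -
      have "?g t w \<noteq> 0 \<longleftrightarrow> x w \<noteq> 0" for w
      proof (cases "x w = 0")
        case True
        then show ?thesis using y by (auto simp: cell_def)
      next
        case False
        then have "0 < t * x w" "0 \<le> (1 - t) * y w" using that y xc by (auto simp: cell_def less_le)
        then show ?thesis using False by linarith
      qed
      then show ?thesis using g[of t] sub that by (auto simp: open_cell_def)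
    qed
    have "?g 0 \<in> realization K closure_of (open_cell K ?s)"
      by (rule closure_of_path_end[OF c oc])
    then show "y \<in> supp K x" by (simp add: supp_def)
  qed
  ultimately show ?thesis by blast
qed

lemma disc_conf2_iff:
  assumes K: "graph K"
  shows "z \<in> disc_conf2 K \<longleftrightarrow> fst z \<in> points K \<and> snd z \<in> points K \<and> (\<forall>w. fst z w = 0 \<or> snd z w = 0)"
proof -
  have "cell {w. x w \<noteq> 0} \<inter> cell {w. y w \<noteq> 0} = {} \<longleftrightarrow> (\<forall>w. x w = 0 \<or> y w = 0)"
    if xy: "x \<in> points K" "y \<in> points K" for x y :: "'a \<Rightarrow> real"
  proof
    assume *: "cell {w. x w \<noteq> 0} \<inter> cell {w. y w \<noteq> 0} = {}"
    show "\<forall>w. x w = 0 \<or> y w = 0"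
    proof (rule ccontr)
      assume "\<not> (\<forall>w. x w = 0 \<or> y w = 0)"
      then obtain w where w: "x w \<noteq> 0" "y w \<noteq> 0" by blast
      have v: "vertex_point w \<in> cell s" if "w \<in> s" "finite s" for s
        using that by (auto simp: cell_def vertex_point_def)
      have fin: "finite {w. x w \<noteq> 0}" "finite {w. y w \<noteq> 0}"
        using graph_finite(2)[OF K points_support(1)[OF xy(1)]] graph_finite(2)[OF K points_support(1)[OF xy(2)]] .
      have "vertex_point w \<in> cell {w. x w \<noteq> 0} \<inter> cell {w. y w \<noteq> 0}"
        using v[OF _ fin(1)] v[OF _ fin(2)] w by simp
      with * show False by simp
    qed
  next
    assume *: "\<forall>w. x w = 0 \<or> y w = 0"
    show "cell {w. x w \<noteq> 0} \<inter> cell {w. y w \<noteq> 0} = {}"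
    proof (rule ccontr)
      assume "\<not> ?thesis"
      then obtain z where z: "z \<in> cell {w. x w \<noteq> 0}" "z \<in> cell {w. y w \<noteq> 0}" by blast
      then have "z w = 0" for w using * by (auto simp: cell_def)
      then show False using z by (simp add: cell_def)
    qed
  qed
  then show ?thesis
    by (cases z) (simp add: disc_conf2_def square_def supp_eq_cell[OF K] cong: conj_cong)
qed

lemma square_realization: "square (realization K) = top_of_set (points K \<times> points K)"
  by (simp add: square_def realization_eq)

definition conf_points :: "'a set set \<Rightarrow> (('a \<Rightarrow> real) \<times> ('a \<Rightarrow> real)) set" where
  "conf_points K = {z \<in> points K \<times> points K. fst z \<noteq> snd z}"

lemma conf2_realization: "conf2 (realization K) = top_of_set (conf_points K)"
proof -
  have "points K \<times> points K \<inter> {(x, y). x \<noteq> y} = conf_points K" by (auto simp: conf_points_def)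
  then show ?thesis by (simp add: conf2_def square_realization subtopology_subtopology)
qed

text \<open>
  Measures how close two points are: it is 0 exactly on the discrete configuration space and 1
  exactly on the diagonal.
\<close>
definition overlap :: "'a set set \<Rightarrow> ('a \<Rightarrow> real) \<times> ('a \<Rightarrow> real) \<Rightarrow> real" where
  "overlap K z = (\<Sum>w\<in>\<Union>K. min (fst z w) (snd z w))"

text \<open>
  For \<open>s = 1\<close> at each vertex one of the two coordinates becomes 0. Dividing by the common factor
  \<open>1 - s * overlap\<close> restores the coordinate sums, so that one formula works on all pairs of cells.
\<close>
definition separate :: "'a set set \<Rightarrow> real \<Rightarrow> ('a \<Rightarrow> real) \<times> ('a \<Rightarrow> real) \<Rightarrow> ('a \<Rightarrow> real) \<times> ('a \<Rightarrow> real)" where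
  "separate K s z =
     (\<lambda>w. (fst z w - s * min (fst z w) (snd z w)) / (1 - s * overlap K z),
      \<lambda>w. (snd z w - s * min (fst z w) (snd z w)) / (1 - s * overlap K z))"

lemma separate_0 [simp]: "separate K 0 z = z"
  by (simp add: separate_def)

lemma points_outside: "x \<in> points K \<Longrightarrow> w \<notin> \<Union>K \<Longrightarrow> x w = 0"
  using points_support(1)[of x K] by blast

lemma points_sum: "graph K \<Longrightarrow> x \<in> points K \<Longrightarrow> (\<Sum>w\<in>\<Union>K. x w) = 1"
  using points_iff_sum[of K "\<Union>K" x] graph_finite by auto

lemma overlap_nonneg: "z \<in> points K \<times> points K \<Longrightarrow> 0 \<le> overlap K z"
  by (auto simp: overlap_def points_support intro!: sum_nonneg)

lemma overlap_eq_0_iff: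
  assumes K: "graph K" and z: "z \<in> points K \<times> points K"
  shows "overlap K z = 0 \<longleftrightarrow> z \<in> disc_conf2 K"
proof -
  have nn: "0 \<le> fst z w" "0 \<le> snd z w" for w using z points_support(2) by (auto simp: mem_Times_iff)
  have "overlap K z = 0 \<longleftrightarrow> (\<forall>w\<in>\<Union>K. min (fst z w) (snd z w) = 0)"
    unfolding overlap_def using graph_finite(3)[OF K] nn by (intro sum_nonneg_eq_0_iff) auto
  also have "\<dots> \<longleftrightarrow> (\<forall>w. fst z w = 0 \<or> snd z w = 0)"
  proof
    assume *: "\<forall>w\<in>\<Union>K. min (fst z w) (snd z w) = 0"
    show "\<forall>w. fst z w = 0 \<or> snd z w = 0"
    proof
      fix w show "fst z w = 0 \<or> snd z w = 0"
        using * points_outside[of "fst z" K w] z by (cases "w \<in> \<Union>K") (auto simp: mem_Times_iff min_def split: if_splits)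
    qed
  next
    assume *: "\<forall>w. fst z w = 0 \<or> snd z w = 0"
    then show "\<forall>w\<in>\<Union>K. min (fst z w) (snd z w) = 0" using nn by (metis min.absorb1 min.absorb2)
  qed
  finally show ?thesis using z by (simp add: disc_conf2_iff[OF K] mem_Times_iff)
qed

lemma overlap_less_1:
  assumes K: "graph K" and z: "z \<in> conf_points K"
  shows "overlap K z < 1"
proof -
  have zp: "fst z \<in> points K" "snd z \<in> points K" "fst z \<noteq> snd z" using z by (auto simp: conf_points_def)
  have fin: "finite (\<Union>K)" using graph_finite(3)[OF K] .
  have le: "overlap K z \<le> (\<Sum>w\<in>\<Union>K. fst z w)" "overlap K z \<le> (\<Sum>w\<in>\<Union>K. snd z w)"
    unfolding overlap_def by (intro sum_mono; simp)+
  have "overlap K z \<noteq> 1"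
  proof
    assume 1: "overlap K z = 1"
    have eq: "min (fst z w) (snd z w) = fst z w" "min (fst z w) (snd z w) = snd z w" if "w \<in> \<Union>K" for w
    proof -
      have "(\<Sum>w\<in>\<Union>K. fst z w - min (fst z w) (snd z w)) = 0" "(\<Sum>w\<in>\<Union>K. snd z w - min (fst z w) (snd z w)) = 0"
        using 1 points_sum[OF K] zp by (simp_all add: sum_subtractf overlap_def)
      then have "\<forall>w\<in>\<Union>K. fst z w - min (fst z w) (snd z w) = 0" "\<forall>w\<in>\<Union>K. snd z w - min (fst z w) (snd z w) = 0"
        using fin by (simp_all add: sum_nonneg_eq_0_iff)
      then show "min (fst z w) (snd z w) = fst z w" "min (fst z w) (snd z w) = snd z w" using that by auto
    qed
    have "fst z w = snd z w" for w
      using eq[of w] points_outside[OF zp(1), of w] points_outside[OF zp(2), of w] by (cases "w \<in> \<Union>K") auto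
    then show False using zp(3) by blast
  qed
  then show ?thesis using le points_sum[OF K zp(1)] by linarith
qed

lemma disc_conf2_subset:
  assumes "graph K"
  shows "disc_conf2 K \<subseteq> conf_points K"
proof
  fix z assume z: "z \<in> disc_conf2 K"
  then have p: "fst z \<in> points K" "snd z \<in> points K" "\<forall>w. fst z w = 0 \<or> snd z w = 0" by (auto simp: disc_conf2_iff[OF assms])
  obtain w where "fst z w \<noteq> 0" using points_supportE[OF assms p(1)] .
  then have "fst z w \<noteq> snd z w" using p(3) by metis
  then show "z \<in> conf_points K" using p by (auto simp: conf_points_def mem_Times_iff)
qed

lemma conf_points_subset: "conf_points K \<subseteq> points K \<times> points K"
  by (auto simp: conf_points_def)

lemma separate_denominator:
  assumes "graph K" "z \<in> conf_points K" "0 \<le> s" "s \<le> 1"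
  shows "0 < 1 - s * overlap K z"
proof -
  have "s * overlap K z \<le> overlap K z"
    using assms(3,4) overlap_nonneg[OF subsetD[OF conf_points_subset assms(2)]] by (intro mult_left_le_one_le)
  then show ?thesis using overlap_less_1[OF assms(1,2)] by linarith
qed

lemma separate_in:
  assumes K: "graph K" and z: "z \<in> conf_points K" and s: "0 \<le> s" "s \<le> 1"
  shows "separate K s z \<in> conf_points K"
proof -
  let ?m = "overlap K z" and ?d = "1 - s * overlap K z"
  have zp: "fst z \<in> points K" "snd z \<in> points K" "fst z \<noteq> snd z" using z by (auto simp: conf_points_def)
  have d: "0 < ?d" by (rule separate_denominator[OF K z s])
  have part: "(\<lambda>w. (x w - s * min (fst z w) (snd z w)) / ?d) \<in> points K"
    if x: "x \<in> points K" and le: "\<And>w. min (fst z w) (snd z w) \<le> x w" for x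
  proof -
    have mn: "0 \<le> min (fst z w) (snd z w)" for w using zp points_support(2) by auto
    have sm: "s * min (fst z w) (snd z w) \<le> x w" for w
      using mult_left_le_one_le[OF mn s] le order_trans by blast
    let ?y = "\<lambda>w. (x w - s * min (fst z w) (snd z w)) / ?d"
    have y0: "0 \<le> ?y w" for w using sm d by simp
    have "(\<Sum>w\<in>\<Union>K. ?y w) = ((\<Sum>w\<in>\<Union>K. x w) - s * ?m) / ?d"
      by (simp add: overlap_def sum_subtractf sum_distrib_left flip: sum_divide_distrib)
    then have y1: "(\<Sum>w\<in>\<Union>K. ?y w) = 1" using d points_sum[OF K x] by simp
    have "x w = 0 \<Longrightarrow> ?y w = 0" for w using le[of w] mn[of w] by simp
    then have "{w. ?y w \<noteq> 0} \<subseteq> {w. x w \<noteq> 0}" by blast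
    moreover have "{w. ?y w \<noteq> 0} \<noteq> {}"
    proof
      assume "{w. ?y w \<noteq> 0} = {}"
      then have "(\<Sum>w\<in>\<Union>K. ?y w) = 0" by (intro sum.neutral) blast
      then show False using y1 by simp
    qed
    ultimately have "{w. ?y w \<noteq> 0} \<in> K" using graph_face[OF K points_support(1)[OF x]] by simp
    with y0 y1 show ?thesis using points_iff_sum[OF K graph_finite(3)[OF K] order_refl] by blast
  qed
  have "fst (separate K s z) \<in> points K" "snd (separate K s z) \<in> points K"
    unfolding separate_def fst_conv snd_conv using part[OF zp(1)] part[OF zp(2)] by auto
  moreover have "fst (separate K s z) \<noteq> snd (separate K s z)"
  proof
    assume "fst (separate K s z) = snd (separate K s z)"
    then have "fst z w = snd z w" for w using d by (auto simp: separate_def fun_eq_iff)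
    then show False using zp(3) by blast
  qed
  ultimately show ?thesis by (simp add: conf_points_def mem_Times_iff)
qed

lemma separate_1_in:
  assumes K: "graph K" and z: "z \<in> conf_points K"
  shows "separate K 1 z \<in> disc_conf2 K"
proof -
  have "fst (separate K 1 z) w = 0 \<or> snd (separate K 1 z) w = 0" for w
    by (auto simp: separate_def min_def)
  then show ?thesis using separate_in[OF K z, of 1] by (simp add: disc_conf2_iff[OF K] conf_points_def mem_Times_iff)
qed

lemma separate_fix:
  assumes K: "graph K" and z: "z \<in> disc_conf2 K"
  shows "separate K s z = z"
proof -
  have p: "z \<in> points K \<times> points K" "\<forall>w. fst z w = 0 \<or> snd z w = 0"
    using z by (auto simp: disc_conf2_iff[OF K] mem_Times_iff)
  then have "min (fst z w) (snd z w) = 0" for w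
    using points_support(2) by (metis mem_Times_iff min.absorb1 min.absorb2)
  then show ?thesis
    using overlap_eq_0_iff[OF K p(1)] z by (simp add: separate_def)
qed

lemma separate_not_disc:
  assumes K: "graph K" and z: "z \<in> conf_points K" "z \<notin> disc_conf2 K" and s: "0 \<le> s" "s < 1"
  shows "separate K s z \<notin> disc_conf2 K"
proof -
  have p: "fst z \<in> points K" "snd z \<in> points K" using z by (auto simp: conf_points_def)
  then obtain w where w: "fst z w \<noteq> 0" "snd z w \<noteq> 0" using z(2) by (auto simp: disc_conf2_iff[OF K])
  then have pos: "0 < fst z w" "0 < snd z w" using points_support(2) p by (metis less_le)+
  have "s * min (fst z w) (snd z w) < min (fst z w) (snd z w)" using pos s mult_strict_right_mono[of s 1 "min (fst z w) (snd z w)"] by simp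
  then have "fst z w - s * min (fst z w) (snd z w) \<noteq> 0" "snd z w - s * min (fst z w) (snd z w) \<noteq> 0" by linarith+
  then have "fst (separate K s z) w \<noteq> 0" "snd (separate K s z) w \<noteq> 0"
    using separate_denominator[OF K z(1), of s] s by (auto simp: separate_def)
  then show ?thesis by (auto simp: disc_conf2_iff[OF K])
qed

lemma continuous_pair_coords:
  "continuous_on S (\<lambda>p. fst (f p) w)" "continuous_on S (\<lambda>p. snd (f p) w)"
  if "continuous_on S f" for f :: "'b::topological_space \<Rightarrow> ('a \<Rightarrow> real) \<times> ('a \<Rightarrow> real)"
  using continuous_on_product_then_coordinatewise[OF continuous_on_fst[OF that]]
    continuous_on_product_then_coordinatewise[OF continuous_on_snd[OF that]] by blast+

lemma continuous_separate:
  assumes K: "graph K"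
  shows "continuous_on ({0..1} \<times> conf_points K) (\<lambda>(t, z). separate K (1 - t) z)"
proof -
  let ?S = "{0..1::real} \<times> conf_points K"
  have c: "continuous_on ?S (\<lambda>p. fst (snd p) w)" "continuous_on ?S (\<lambda>p. snd (snd p) w)" for w
    by (rule continuous_pair_coords[OF continuous_on_snd[OF continuous_on_id]])+
  have m: "continuous_on ?S (\<lambda>p. overlap K (snd p))"
    unfolding overlap_def by (intro continuous_intros c)
  have d: "1 - (1 - fst p) * overlap K (snd p) \<noteq> 0" if "p \<in> ?S" for p
    using separate_denominator[OF K, of "snd p" "1 - fst p"] that by auto
  show ?thesis
    unfolding separate_def case_prod_unfold
    by (intro continuous_on_Pair continuous_on_coordinatewise_then_product continuous_on_divide
        continuous_on_diff continuous_on_mult continuous_on_min c m continuous_on_const continuous_on_fst continuous_on_id)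
       (use d in auto)
qed

text \<open>
  For \<open>s < 1\<close> overlapping supports stay overlapping, so the homotopy preserves the complement of the
  discrete configuration space, and by continuity also every closed set containing it.
\<close>
lemma disc_conf2_deformation:
  assumes K: "graph K" and N: "points K \<times> points K - disc_conf2 K \<subseteq> N" "closedin (square (realization K)) N"
  shows "homotopic_with (\<lambda>k. k ` disc_conf2 K \<subseteq> disc_conf2 K \<and> k ` (N \<inter> conf_points K) \<subseteq> N \<inter> conf_points K)
     (top_of_set (conf_points K)) (top_of_set (conf_points K)) (separate K 1) id"
proof -
  let ?h = "\<lambda>(t, z). separate K (1 - t) z"
  have cont: "continuous_map (prod_topology (top_of_set {0..1}) (top_of_set (conf_points K))) (top_of_set (conf_points K)) ?h"
    using continuous_separate[OF K] separate_in[OF K] by auto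
  have N1: "separate K s z \<in> N" if z: "z \<in> N" "z \<in> conf_points K" and s: "0 \<le> s" "s \<le> 1" for z s
  proof (cases "z \<in> disc_conf2 K")
    case False
    have sN: "separate K r z \<in> points K \<times> points K - disc_conf2 K" if "0 \<le> r" "r < 1" for r
      using separate_not_disc[OF K z(2) False that] separate_in[OF K z(2)] conf_points_subset that by fastforce
    show ?thesis
    proof (cases "s = 1")
      case True
      have "continuous_on {0..1} (\<lambda>t. (\<lambda>(t, z). separate K (1 - t) z) (t, z))"
        by (rule continuous_on_compose2[OF continuous_separate[OF K]]) (use z in \<open>auto intro!: continuous_intros\<close>)
      then have "continuous_map (top_of_set {0..1}) (square (realization K)) (\<lambda>t. separate K (1 - t) z)"
        using separate_in[OF K z(2)] conf_points_subset by (fastforce simp: square_realization)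
      then have "separate K (1 - 0) z \<in> square (realization K) closure_of (points K \<times> points K - disc_conf2 K)"
        by (rule closure_of_path_end) (use sN in auto)
      then show ?thesis using True closure_of_minimal[OF N] by auto
    qed (use sN[of s] N s in auto)
  qed (use z separate_fix[OF K] in auto)
  show ?thesis
    unfolding homotopic_with_def
  proof (intro exI[of _ ?h] conjI ballI allI cont)
    fix t :: real assume t: "t \<in> {0..1}"
    show "(\<lambda>z. ?h (t, z)) ` disc_conf2 K \<subseteq> disc_conf2 K"
      using separate_fix[OF K] by auto
    show "(\<lambda>z. ?h (t, z)) ` (N \<inter> conf_points K) \<subseteq> N \<inter> conf_points K"
      using N1 separate_in[OF K] t by auto
  qed auto
qed

lemma closedin_disc_conf2:
  assumes K: "graph K"
  shows "closedin (square (realization K)) (disc_conf2 K)"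
proof -
  have "closed {z :: ('a \<Rightarrow> real) \<times> ('a \<Rightarrow> real). overlap K z = 0}"
    unfolding overlap_def
    by (intro closed_Collect_eq continuous_on_sum continuous_on_min continuous_on_const
        continuous_pair_coords[OF continuous_on_id])
  moreover have "disc_conf2 K = (points K \<times> points K) \<inter> {z. overlap K z = 0}"
    using overlap_eq_0_iff[OF K] by (auto simp: disc_conf2_iff[OF K] mem_Times_iff)
  ultimately show ?thesis by (auto simp: square_realization closedin_closed)
qed

lemma openin_conf_points: "openin (square (realization K)) (conf_points K)"
proof -
  have "closedin (square (realization K)) {z \<in> points K \<times> points K. fst z = snd z}"
  proof -
    have "{z \<in> points K \<times> points K. fst z = snd z} = (points K \<times> points K) \<inter> {z. fst z = snd z}" by auto
    moreover have "closed {z :: ('a \<Rightarrow> real) \<times> ('a \<Rightarrow> real). fst z = snd z}"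
    proof -
      have "closed {z :: ('a \<Rightarrow> real) \<times> ('a \<Rightarrow> real). fst z w = snd z w}" for w
        by (intro closed_Collect_eq continuous_pair_coords[OF continuous_on_id])
      moreover have "{z :: ('a \<Rightarrow> real) \<times> ('a \<Rightarrow> real). fst z = snd z} = (\<Inter>w. {z. fst z w = snd z w})"
        by (auto simp: fun_eq_iff)
      ultimately show ?thesis by (simp add: closed_INT)
    qed
    ultimately show ?thesis by (auto simp: square_realization closedin_closed)
  qed
  moreover have "conf_points K = topspace (square (realization K)) - {z \<in> points K \<times> points K. fst z = snd z}"
    by (auto simp: conf_points_def square_realization)
  ultimately show ?thesis by (simp only: openin_diff openin_topspace)
qed

text \<open>
  The open complement of the diagonal is the neighbourhood needed for excision.
\<close>
theorem iso_excise:
  assumes K: "graph K"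
  shows "excise K \<in> iso (H2_nbhd K) (H2_square_rel K)"
  unfolding excise_def H2_nbhd_def H2_square_rel_def diag_bdry_def
proof (rule iso_excision_deformation[OF closedin_disc_conf2[OF K] openin_conf_points disc_conf2_subset[OF K]])
  have sub: "points K \<times> points K - disc_conf2 K \<subseteq> diag_nbhd K"
    using closure_of_subset[of "points K \<times> points K - disc_conf2 K" "square (realization K)"]
    by (auto simp: diag_nbhd_def square_realization)
  then show "topspace (square (realization K)) - diag_nbhd K \<subseteq> disc_conf2 K"
    by (auto simp: square_realization)
  show "separate K 1 ` conf_points K \<subseteq> disc_conf2 K" using separate_1_in[OF K] by auto
  have "subtopology (square (realization K)) (conf_points K) = top_of_set (conf_points K)"
    using conf_points_subset[of K] by (simp add: square_realization subtopology_subtopology Int_absorb1)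
  then show "homotopic_with (\<lambda>k. k ` disc_conf2 K \<subseteq> disc_conf2 K \<and> k ` (diag_nbhd K \<inter> conf_points K) \<subseteq> diag_nbhd K \<inter> conf_points K)
     (subtopology (square (realization K)) (conf_points K)) (subtopology (square (realization K)) (conf_points K)) (separate K 1) id"
    using disc_conf2_deformation[OF K sub] by (simp add: diag_nbhd_def)
qed

definition disc_space :: "'a set set \<Rightarrow> (('a \<Rightarrow> real) \<times> ('a \<Rightarrow> real)) topology" where
  "disc_space K = subtopology (square (realization K)) (disc_conf2 K)"

lemma disc_space_eq: "graph K \<Longrightarrow> disc_space K = top_of_set (disc_conf2 K)"
  using disc_conf2_subset[of K] conf_points_subset[of K]
  by (simp add: disc_space_def square_realization subtopology_subtopology Int_absorb1)

lemma retraction_separate: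
  assumes K: "graph K"
  shows "retraction_maps (conf2 (realization K)) (disc_space K) (separate K 1) id"
proof -
  have "continuous_on (conf_points K) (\<lambda>z. (\<lambda>(t, z). separate K (1 - t) z) (0, z))"
    by (rule continuous_on_compose2[OF continuous_separate[OF K]]) (auto intro!: continuous_intros)
  then show ?thesis
    using separate_1_in[OF K] separate_fix[OF K] disc_conf2_subset[OF K]
    by (auto simp: retraction_maps_def conf2_realization disc_space_eq[OF K])
qed

theorem iso_disc_conf2:
  assumes K: "graph K"
  shows "hom_induced p (disc_space K) {} (conf2 (realization K)) {} id
    \<in> iso (homology_group p (disc_space K)) (homology_group p (conf2 (realization K)))"
proof (rule deformation_retract_relative_homology_group_isomorphism_id[OF retraction_separate[OF K]])
  show "homotopic_with (\<lambda>h. h ` {} \<subseteq> {}) (conf2 (realization K)) (conf2 (realization K)) (separate K 1) id"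
    unfolding conf2_realization
    by (rule homotopic_with_mono[OF disc_conf2_deformation[OF K, of "points K \<times> points K"]])
       (auto simp: square_realization)
qed auto

section \<open>Path connectedness of the configuration space\<close>

definition vertices :: "'a set set \<Rightarrow> 'a set" where "vertices K = {w. {w} \<in> K}"

lemma vertices_eq: "graph K \<Longrightarrow> vertices K = \<Union>K"
proof (intro equalityI subsetI)
  fix w assume K: "graph K" and "w \<in> \<Union>K"
  then obtain s where "s \<in> K" "w \<in> s" by blast
  then show "w \<in> vertices K" using graph_face[OF K, of s "{w}"] by (simp add: vertices_def)
qed (auto simp: vertices_def)

lemma finite_vertices: "graph K \<Longrightarrow> finite (vertices K)"
  using vertices_eq[of K] graph_finite(3)[of K] by simp

lemma sym_relation_adjacent: "sym_relation (adjacent K)"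
  by standard (auto simp: adjacent_def insert_commute)

text \<open>
  Otherwise the weight of \<open>W\<close> would be a continuous function onto \<open>{0, 1}\<close>.
\<close>
lemma connected_adjacent:
  assumes K: "graph K" and conn: "connected_space (realization K)"
    and W: "W \<subseteq> vertices K" "W \<noteq> {}" "W \<noteq> vertices K"
  shows "\<exists>a\<in>W. \<exists>w\<in>vertices K - W. adjacent K w a"
proof (rule ccontr)
  assume *: "\<not> ?thesis"
  have closed: "q \<in> W" if "adjacent K p q" "p \<in> W" for p q
  proof (rule ccontr)
    assume "q \<notin> W"
    moreover have "q \<in> vertices K" using that graph_face[OF K, of "{p, q}" "{q}"] by (auto simp: vertices_def adjacent_def)
    ultimately show False using * that adjacent_sym[of K p q] by blast
  qed
  let ?g = "\<lambda>x :: 'a \<Rightarrow> real. \<Sum>w\<in>W \<inter> \<Union>K. x w"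
  obtain a b where ab: "a \<in> W" "b \<in> vertices K" "b \<notin> W" using W by blast
  have "connected (points K)" using conn by (simp add: realization_eq connectedin_topspace[symmetric] connected_space_subtopology)
  then have c: "connected (?g ` points K)" by (intro connected_continuous_image continuous_weight)
  have fin: "finite (W \<inter> \<Union>K)" using graph_finite(3)[OF K] by blast
  have aK: "a \<in> vertices K" using ab W by blast
  have "?g (vertex_point a) = 1" using fin ab aK vertices_eq[OF K] by (simp add: vertex_point_def)
  moreover have "?g (vertex_point b) = 0" using ab by (auto simp: vertex_point_def intro: sum.neutral)
  moreover have v: "vertex_point a \<in> points K" "vertex_point b \<in> points K"
    using ab aK vertex_point_in[OF K] by (auto simp: vertices_def)
  ultimately have "0 \<in> ?g ` points K" "1 \<in> ?g ` points K"
    using imageI[OF v(1), of ?g] imageI[OF v(2), of ?g] by simp_all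
  then have "1/2 \<in> ?g ` points K" using connectedD_interval[OF c, of 0 1 "1/2"] by simp
  then obtain x where x: "x \<in> points K" "?g x = 1/2" by auto
  show False using component_weight[OF K closed x(1)] x(2) by auto
qed

lemma vertex_edge_cases:
  assumes K: "graph K" and x: "x \<in> points K"
  obtains p where "p \<in> vertices K" "x = vertex_point p"
  | p q where "adjacent K p q" "p \<in> vertices K" "q \<in> vertices K" "x \<in> cell {p, q}"
proof -
  have xc: "x \<in> cell {w. x w \<noteq> 0}" using x by (auto simp: points_def cell_def)
  show thesis
    using graph_simplex_cases[OF K points_support(1)[OF x]]
  proof cases
    case (1 p)
    then show thesis using xc that(1) points_support(1)[OF x] by (simp add: cell_vertex vertices_def)
  next
    case (2 p q)
    then show thesis using xc that(2)[of p q] points_support(1)[OF x] by (simp add: adjacent_def vertices_def)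
  qed
qed

text \<open>
  The homeomorphism is the mean index \<open>\<Sum> i x\<^sub>i / n\<close>; its inverse is given by hat functions. Both are
  evaluated on the segments between consecutive vertices, which cover the two spaces.
\<close>
lemma path_graph_homeomorphic_interval:
  assumes K: "graph K" and f: "path_order (adjacent K) (vertices K) f n" and n: "1 \<le> n"
  shows "realization K homeomorphic_space top_of_set {0..1::real}"
proof -
  have im: "vertices K = f ` {..n}" using f by (auto simp: path_order_def bij_betw_def)
  have inj: "f i = f j \<longleftrightarrow> i = j" if "i \<le> n" "j \<le> n" for i j
    using f that by (auto simp: path_order_def bij_betw_def inj_on_def)
  have adj: "adjacent K (f i) (f j) \<longleftrightarrow> j = Suc i \<or> i = Suc j" if "i \<le> n" "j \<le> n" for i j
    using f that by (auto simp: path_order_def)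
  define \<psi> where "\<psi> = (\<lambda>x :: 'a \<Rightarrow> real. (\<Sum>i\<le>n. real i * x (f i)) / real n)"
  define \<theta> where "\<theta> = (\<lambda>t w. \<Sum>i\<le>n. if w = f i then max 0 (1 - \<bar>real n * t - real i\<bar>) else 0)"
  define S where "S = (\<lambda>k. segment (f k) (f (Suc k)))"
  have S_coord: "S k r (f i) = (if i = k then 1 - r else if i = Suc k then r else 0)" if "k < n" "i \<le> n" for k r i
    using that inj[of i k] inj[of i "Suc k"] inj[of k "Suc k"] by (auto simp: S_def segment_def vertex_point_def)
  have S_out: "S k r w = 0" if "k < n" "w \<notin> f ` {..n}" for k r w
    using that by (auto simp: S_def segment_def vertex_point_def)
  have \<psi>S: "\<psi> (S k r) = (real k + r) / real n" if k: "k < n" for k r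
  proof -
    have "(\<Sum>i\<le>n. real i * S k r (f i)) = (\<Sum>i\<in>{k, Suc k}. real i * S k r (f i))"
      by (rule sum.mono_neutral_right) (use k in \<open>auto simp: S_coord\<close>)
    also have "\<dots> = real k + r" using k by (simp add: S_coord algebra_simps)
    finally show ?thesis by (simp add: \<psi>_def)
  qed
  have \<theta>S: "\<theta> ((real k + r) / real n) = S k r" if k: "k < n" and r: "0 \<le> r" "r \<le> 1" for k r
  proof
    fix w
    show "\<theta> ((real k + r) / real n) w = S k r w"
    proof (cases "w \<in> f ` {..n}")
      case True
      then obtain j where j: "j \<le> n" "w = f j" by auto
      have "\<theta> ((real k + r) / real n) w = (\<Sum>i\<le>n. if i = j then max 0 (1 - \<bar>real n * ((real k + r) / real n) - real i\<bar>) else 0)"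
        unfolding \<theta>_def j(2) by (rule sum.cong) (use j inj in auto)
      also have "\<dots> = max 0 (1 - \<bar>real k + r - real j\<bar>)" using j n by simp
      also have "\<dots> = S k r w"
      proof -
        consider "j < k" | "j = k" | "j = Suc k" | "Suc k < j" by linarith
        then show ?thesis
        proof cases
          case 1
          then have "real j + 1 \<le> real k" by simp
          then show ?thesis using j k r 1 by (auto simp: S_coord)
        next
          case 4
          then have "real k + 2 \<le> real j" by linarith
          then show ?thesis using j k r 4 by (auto simp: S_coord)
        qed (use j k r in \<open>auto simp: S_coord\<close>)
      qed
      finally show ?thesis .
    next
      case False
      then show ?thesis using S_out[OF k False] by (auto simp: \<theta>_def intro!: sum.neutral)
    qed
  qed
  have S_in: "S k r \<in> points K" if "k < n" "0 \<le> r" "r \<le> 1" for k r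
    unfolding S_def by (rule segment_in[OF K]) (use adj[of k "Suc k"] that in \<open>auto simp: adjacent_def\<close>)
  have pts: "\<exists>k r. k < n \<and> 0 \<le> r \<and> r \<le> 1 \<and> x = S k r" if x: "x \<in> points K" for x
    using vertex_edge_cases[OF K x]
  proof cases
    case (1 p)
    then obtain i where i: "i \<le> n" "p = f i" using im by auto
    show ?thesis
    proof (cases "i < n")
      case True
      then show ?thesis using i 1 by (intro exI[of _ i] exI[of _ 0]) (auto simp: S_def)
    next
      case False
      then show ?thesis using i 1 n by (intro exI[of _ "n - 1"] exI[of _ 1]) (auto simp: S_def)
    qed
  next
    case (2 p q)
    then obtain i j where ij: "i \<le> n" "j \<le> n" "p = f i" "q = f j" using im by auto
    have *: "\<exists>k r. k < n \<and> 0 \<le> r \<and> r \<le> 1 \<and> x = S k r" if k: "x \<in> cell {f k, f (Suc k)}" "Suc k \<le> n" for k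
    proof -
      have "f k \<noteq> f (Suc k)" using inj[of k "Suc k"] k(2) by auto
      then obtain r where "r \<in> {0..1}" "x = S k r" using k(1) cell_edge[of "f k" "f (Suc k)"] by (auto simp: S_def)
      then show ?thesis using k(2) by (intro exI[of _ k] exI[of _ r]) auto
    qed
    have "j = Suc i \<or> i = Suc j" using adj ij 2 by auto
    then show ?thesis using * ij 2(4) by (auto simp: insert_commute)
  qed
  have ts: "\<exists>k r. k < n \<and> 0 \<le> r \<and> r \<le> 1 \<and> t = (real k + r) / real n" if t: "0 \<le> t" "t \<le> 1" for t
  proof (cases "t = 1")
    case True
    then show ?thesis using n by (intro exI[of _ "n - 1"] exI[of _ 1]) (auto simp: of_nat_diff)
  next
    case False
    have nt: "0 \<le> real n * t" "real n * t < real n" using t False n by auto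
    obtain k where k: "real k \<le> real n * t" "real n * t < real k + 1"
      using nt(1) by (intro that[of "nat \<lfloor>real n * t\<rfloor>"]) linarith+
    then have "k < n" using nt(2) by linarith
    moreover have "t = (real k + (real n * t - real k)) / real n" using n by simp
    ultimately show ?thesis using k by (intro exI[of _ k] exI[of _ "real n * t - real k"]) auto
  qed
  have "homeomorphic_maps (realization K) (top_of_set {0..1}) \<psi> \<theta>"
    unfolding homeomorphic_maps_def
  proof (intro conjI ballI)
    have "\<psi> x \<in> {0..1}" if "x \<in> points K" for x
      using pts[OF that] \<psi>S n by (auto simp: divide_le_eq)
    moreover have "continuous_on (points K) \<psi>"
      unfolding \<psi>_def using n by (intro continuous_intros continuous_coordinate) auto
    ultimately show "continuous_map (realization K) (top_of_set {0..1}) \<psi>" by (auto simp: realization_eq)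
    have "\<theta> t \<in> points K" if "0 \<le> t" "t \<le> 1" for t
      using ts[OF that] \<theta>S S_in by auto
    moreover have "continuous_on {0..1} \<theta>"
    proof (rule continuous_on_coordinatewise_then_product)
      fix w
      have "continuous_on {0..1} (\<lambda>t. if w = f i then max 0 (1 - \<bar>real n * t - real i\<bar>) else 0)" for i
        by (cases "w = f i") (auto intro!: continuous_intros)
      then show "continuous_on {0..1} (\<lambda>t. \<theta> t w)" unfolding \<theta>_def by (intro continuous_on_sum)
    qed
    ultimately show "continuous_map (top_of_set {0..1}) (realization K) \<theta>" by (auto simp: realization_eq)
    show "\<theta> (\<psi> x) = x" if "x \<in> topspace (realization K)" for x
      using pts[of x] that \<psi>S \<theta>S by auto
    show "\<psi> (\<theta> t) = t" if "t \<in> topspace (top_of_set {0..1})" for t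
      using ts[of t] that \<psi>S \<theta>S by auto
  qed
  then show ?thesis unfolding homeomorphic_space_def by blast
qed

lemma path_component_ofI:
  assumes "continuous_map (top_of_set {0..1::real}) X g" "g 0 = x" "g 1 = y"
  shows "path_component_of X x y"
  using assms unfolding path_component_of_def pathin_def by blast

text \<open>
  After separation the two points can travel inside their disjoint closed cells to vertices.
\<close>
lemma conf_path_to_vertices:
  assumes K: "graph K" and z: "z \<in> conf_points K"
  obtains p q where "p \<in> vertices K" "q \<in> vertices K" "p \<noteq> q"
    "path_component_of (conf2 (realization K)) z (vertex_point p, vertex_point q)"
proof -
  let ?F = "conf2 (realization K)" and ?z = "separate K 1 z"
  have "continuous_on {0..1} (\<lambda>t. (\<lambda>(t, z). separate K (1 - t) z) (t, z))"
    by (rule continuous_on_compose2[OF continuous_separate[OF K]]) (use z in \<open>auto intro!: continuous_intros\<close>)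
  then have "path_component_of ?F ?z z"
    using separate_in[OF K z]
    by (intro path_component_ofI[where g = "\<lambda>t. separate K (1 - t) z"]) (auto simp: conf2_realization)
  moreover have D: "?z \<in> disc_conf2 K" using separate_1_in[OF K z] .
  obtain x y where xy: "?z = (x, y)" by fastforce
  have p: "x \<in> points K" "y \<in> points K" "\<And>w. x w = 0 \<or> y w = 0"
    using D xy by (auto simp: disc_conf2_iff[OF K])
  obtain a where a: "x a \<noteq> 0" using points_supportE[OF K p(1)] .
  obtain b where b: "y b \<noteq> 0" using points_supportE[OF K p(2)] .
  have ab: "a \<noteq> b" "a \<in> vertices K" "b \<in> vertices K"
    using p(3)[of a] a b points_outside[OF p(1), of a] points_outside[OF p(2), of b] vertices_eq[OF K] by auto
  let ?g = "\<lambda>t. (\<lambda>w. (1 - t) * x w + t * vertex_point a w, \<lambda>w. (1 - t) * y w + t * vertex_point b w)"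
  have inp: "(\<lambda>w. (1 - t) * x w + t * vertex_point a w) \<in> points K"
    if x: "x \<in> points K" "x a \<noteq> 0" and t: "0 \<le> t" "t \<le> 1" for x a t
  proof -
    let ?s = "{w. x w \<noteq> 0}"
    have "x \<in> cell ?s" using x by (auto simp: points_def cell_def)
    moreover have "vertex_point a \<in> cell ?s"
      using x(2) graph_finite(2)[OF K points_support(1)[OF x(1)]] by (auto simp: cell_def vertex_point_def)
    ultimately have "(\<lambda>w. (1 - t) * x w + t * vertex_point a w) \<in> cell ?s"
      using t by (auto simp: cell_def sum.distrib simp flip: sum_distrib_left)
    then show ?thesis using points_eq_cells[OF K] points_support(1)[OF x(1)] by blast
  qed
  have gD: "?g t \<in> disc_conf2 K" if t: "0 \<le> t" "t \<le> 1" for t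
  proof -
    have "(1 - t) * x w + t * vertex_point a w = 0 \<or> (1 - t) * y w + t * vertex_point b w = 0" for w
      using p(3)[of w] p(3)[of a] p(3)[of b] a b by (auto simp: vertex_point_def)
    then show ?thesis using inp[OF p(1) a t] inp[OF p(2) b t] by (simp add: disc_conf2_iff[OF K])
  qed
  have "continuous_on {0..1} ?g"
    by (intro continuous_on_Pair continuous_on_coordinatewise_then_product continuous_intros)
  then have "path_component_of ?F (x, y) (vertex_point a, vertex_point b)"
    using gD disc_conf2_subset[OF K]
    by (intro path_component_ofI[where g = ?g]) (auto simp: conf2_realization)
  ultimately show thesis
    using that[OF ab(2,3,1)] xy path_component_of_sym path_component_of_trans by metis
qed

lemma token_move_path:
  assumes K: "graph K" and m: "token_move (adjacent K) (vertices K) x y"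
  shows "path_component_of (conf2 (realization K)) (map_prod vertex_point vertex_point x) (map_prod vertex_point vertex_point y)"
  using m
proof cases
  case (move_fst p p' q)
  have s: "segment p p' t \<in> points K" "segment p p' t \<noteq> vertex_point q" if "0 \<le> t" "t \<le> 1" for t
  proof -
    show "segment p p' t \<in> points K" by (rule segment_in[OF K]) (use move_fst that in \<open>auto simp: adjacent_def\<close>)
    have "segment p p' t q = 0" "vertex_point q q = (1::real)" using move_fst by (auto simp: segment_def vertex_point_def)
    then show "segment p p' t \<noteq> vertex_point q" by auto
  qed
  have "continuous_on {0..1} (\<lambda>t. (segment p p' t, vertex_point q))"
    by (intro continuous_on_Pair continuous_on_segment continuous_on_id continuous_on_const)
  then show ?thesis
    using s move_fst vertex_point_in[OF K]
    by (intro path_component_ofI[where g = "\<lambda>t. (segment p p' t, vertex_point q)"])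
       (auto simp: conf2_realization conf_points_def vertices_def)
next
  case (move_snd p p' q)
  have s: "segment p p' t \<in> points K" "vertex_point q \<noteq> segment p p' t" if "0 \<le> t" "t \<le> 1" for t
  proof -
    show "segment p p' t \<in> points K" by (rule segment_in[OF K]) (use move_snd that in \<open>auto simp: adjacent_def\<close>)
    have "segment p p' t q = 0" "vertex_point q q = (1::real)" using move_snd by (auto simp: segment_def vertex_point_def)
    then show "vertex_point q \<noteq> segment p p' t" by auto
  qed
  have "continuous_on {0..1} (\<lambda>t. (vertex_point q, segment p p' t))"
    by (intro continuous_on_Pair continuous_on_segment continuous_on_id continuous_on_const)
  then show ?thesis
    using s move_snd vertex_point_in[OF K]
    by (intro path_component_ofI[where g = "\<lambda>t. (vertex_point q, segment p p' t)"])
       (auto simp: conf2_realization conf_points_def vertices_def)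
qed

theorem path_connected_conf2:
  assumes K: "graph K" and conn: "connected_space (realization K)"
    and interval: "\<not> realization K homeomorphic_space top_of_set {0..1::real}"
    and uv: "u \<in> vertices K" "v \<in> vertices K" "u \<noteq> v"
  shows "path_connected_space (conf2 (realization K))"
proof -
  let ?F = "conf2 (realization K)" and ?E = "adjacent K" and ?V = "vertices K"
  interpret sym_relation ?E by (rule sym_relation_adjacent)
  obtain w where w: "w \<in> ?V" "?E w u"
  proof -
    have "{u} \<noteq> ?V" using uv by (metis singletonD)
    then show thesis using that connected_adjacent[OF K conn, of "{u}"] uv(1) by blast
  qed
  have no_path: "\<not> path_order ?E ?V f n" for f n
  proof
    assume f: "path_order ?E ?V f n"
    then have "?V = f ` {..n}" by (auto simp: path_order_def bij_betw_def)
    then have "n \<noteq> 0" using uv by (cases n) auto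
    then show False using path_graph_homeomorphic_interval[OF K f] interval by simp
  qed
  have tc: "tokens_connected ?E ?V"
  proof -
    have "(\<exists>f n. path_order ?E ?V f n) \<or> tokens_connected ?E ?V"
      by (rule path_or_tokens_connected[OF finite_vertices[OF K] w(1) uv(1) w(2)]) (rule connected_adjacent[OF K conn])
    with no_path show ?thesis by simp
  qed
  have refl: "path_component_of ?F (vertex_point p, vertex_point q) (vertex_point p, vertex_point q)"
    if "p \<in> ?V" "q \<in> ?V" "p \<noteq> q" for p q
  proof -
    have "vertex_point p \<noteq> (vertex_point q :: _ \<Rightarrow> real)" using that(3) by (auto simp: vertex_point_def fun_eq_iff) 
    then show ?thesis using that vertex_point_in[OF K]
      by (auto simp: path_component_of_refl conf2_realization conf_points_def vertices_def)
  qed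
  have tp: "path_component_of ?F (map_prod vertex_point vertex_point x) (map_prod vertex_point vertex_point y)"
    if "token_path ?E ?V x y" "path_component_of ?F (map_prod vertex_point vertex_point x) (map_prod vertex_point vertex_point x)" for x y
    using that
  proof (induction rule: rtranclp_induct)
    case (step y z)
    show ?case
      by (rule path_component_of_trans[OF step.IH[OF step.prems] token_move_path[OF K step.hyps(2)]])
  qed auto
  have "path_component_of ?F z z'" if zz: "z \<in> conf_points K" "z' \<in> conf_points K" for z z'
  proof -
    obtain p q where pq: "p \<in> ?V" "q \<in> ?V" "p \<noteq> q" "path_component_of ?F z (vertex_point p, vertex_point q)"
      using conf_path_to_vertices[OF K zz(1)] .
    obtain p' q' where pq': "p' \<in> ?V" "q' \<in> ?V" "p' \<noteq> q'" "path_component_of ?F z' (vertex_point p', vertex_point q')"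
      using conf_path_to_vertices[OF K zz(2)] .
    have "token_path ?E ?V (p, q) (p', q')" using tc pq pq' by (auto simp: tokens_connected_def)
    then have "path_component_of ?F (vertex_point p, vertex_point q) (vertex_point p', vertex_point q')"
      using tp[of "(p, q)" "(p', q')"] refl[OF pq(1-3)] by simp
    from path_component_of_trans[OF path_component_of_trans[OF pq(4) this] path_component_of_sym[OF pq'(4)]]
    show ?thesis .
  qed
  then show ?thesis by (simp add: path_connected_space_iff_path_component conf2_realization)
qed

text \<open>
  Any two 0-simplices of the target are homologous.
\<close>
lemma hom_induced_0_path_connected:
  assumes Z: "path_connected_space Z" and fg: "continuous_map M Z f" "continuous_map M Z g"
    and z: "z \<in> carrier (homology_group 0 M)"
  shows "hom_induced 0 M {} Z {} f z = hom_induced 0 M {} Z {} g z"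
proof -
  obtain c where c: "singular_relcycle 0 M {} c" "z = homologous_rel_set 0 M {} c"
    using z by (auto simp: carrier_relative_homology_group_0)
  have "Poly_Mapping.keys c \<subseteq> singular_simplex_set 0 M" using c(1) by (simp add: singular_cycle singular_chain_def)
  then have "homologous_rel 0 Z {} (chain_map 0 f c) (chain_map 0 g c)"
  proof (induction c rule: frag_induction)
    case (one \<sigma>)
    then show ?case
      using fg by (auto intro!: iso_integer_zeroth_homology_group_aux[OF Z] singular_simplex_simplex_map)
  qed (auto simp: chain_map_diff homologous_rel_diff)
  then show ?thesis
    using hom_induced_chain_map[OF fg(1) _ c(1), of "{}"] hom_induced_chain_map[OF fg(2) _ c(1), of "{}"] c(2)
    by (simp add: homologous_rel_set_eq[symmetric])
qed

section \<open>Adding an edge\<close>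

locale added_edge =
  fixes K :: "'a set set" and u v :: 'a
  assumes K: "graph K" and uK: "{u} \<in> K" and vK: "{v} \<in> K" and uv: "u \<noteq> v" and nonadjacent: "{u, v} \<notin> K"
begin

abbreviation L where "L \<equiv> add_edge K u v"
abbreviation K0 where "K0 \<equiv> remove_vertices K u v"

lemma L: "graph L" by (simp add: add_edge_def graph_insert_edge[OF K uK vK])

lemma K0: "graph K0"
  using K by (auto simp: graph_def remove_vertices_def)

lemma points_K0: "x \<in> points K0 \<longleftrightarrow> x \<in> points K \<and> x u = 0 \<and> x v = 0"
  by (auto simp: points_def remove_vertices_def)

lemma points_L: "points L = points K \<union> cell {u, v}"
  by (simp add: add_edge_def points_insert_edge[OF K uK vK])

lemma vertex_points: "vertex_point u \<in> points K" "vertex_point v \<in> points K"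
  using vertex_point_in[OF K] uK vK by auto

lemma points_K0_K: "x \<in> points K0 \<Longrightarrow> x \<in> points K" by (simp add: points_K0)

text \<open>
  The common base of both tubes: the first or the second point sits at \<open>u\<close> and the other one is
  in \<open>\<Gamma>\<^sub>0\<close>. Treating the two tubes as one keeps the involution visible.
\<close>
definition ends_u :: "(('a \<Rightarrow> real) \<times> ('a \<Rightarrow> real)) set" where
  "ends_u = {vertex_point u} \<times> points K0 \<union> points K0 \<times> {vertex_point u}"

text \<open>
  Moves \<open>u\<close> along the new edge towards \<open>v\<close> and fixes \<open>\<Gamma>\<^sub>0\<close>, where the coordinate at \<open>u\<close> is 0. So the
  tube is parametrized by applying it to both points at once.
\<close>
definition slide :: "real \<Rightarrow> ('a \<Rightarrow> real) \<Rightarrow> 'a \<Rightarrow> real" where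
  "slide t x = (\<lambda>w. x w + t * x u * (vertex_point v w - vertex_point u w))"

definition unslide :: "('a \<Rightarrow> real) \<Rightarrow> 'a \<Rightarrow> real" where
  "unslide x = (\<lambda>w. x w + x v * (vertex_point u w - vertex_point v w))"

definition tube_map where "tube_map = (\<lambda>(z, t). (slide t (fst z), slide t (snd z)))"
definition tube_inv where "tube_inv = (\<lambda>z. ((unslide (fst z), unslide (snd z)), fst z v + snd z v))"
definition tube_set where "tube_set = cell {u, v} \<times> points K0 \<union> points K0 \<times> cell {u, v}"

lemma slide_simps:
  "slide t (vertex_point u) = segment u v t" "x \<in> points K0 \<Longrightarrow> slide t x = x"
  by (auto simp: slide_def segment_def vertex_point_def points_K0 fun_eq_iff)

lemma unslide_simps:
  "unslide (segment u v t) = vertex_point u" "x \<in> points K0 \<Longrightarrow> unslide x = x"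
  using uv by (auto simp: unslide_def segment_def vertex_point_def points_K0 fun_eq_iff algebra_simps)

lemma tube_map_simps:
  "y \<in> points K0 \<Longrightarrow> tube_map ((vertex_point u, y), t) = (segment u v t, y)"
  "y \<in> points K0 \<Longrightarrow> tube_map ((y, vertex_point u), t) = (y, segment u v t)"
  by (auto simp: tube_map_def slide_simps)

lemma cell_uv: "cell {u, v} = segment u v ` {0..1}"
  by (rule cell_edge[OF uv])

lemma tube_inv_simps:
  "y \<in> points K0 \<Longrightarrow> tube_inv (segment u v t, y) = ((vertex_point u, y), t)"
  "y \<in> points K0 \<Longrightarrow> tube_inv (y, segment u v t) = ((y, vertex_point u), t)"
  using uv by (auto simp: tube_inv_def unslide_simps segment_coords points_K0)

lemma tube_set_sub: "tube_set \<subseteq> disc_conf2 L"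
  using uv by (auto simp: tube_set_def disc_conf2_iff[OF L] points_L points_K0 cell_def) 

lemma disc_K_sub: "disc_conf2 K \<subseteq> disc_conf2 L"
  by (auto simp: disc_conf2_iff[OF L] disc_conf2_iff[OF K] points_L)

lemma segment_in_K: "\<lbrakk>0 \<le> t; t \<le> 1\<rbrakk> \<Longrightarrow> segment u v t \<in> points K \<longleftrightarrow> t = 0 \<or> t = 1"
  using segment_in_subgraph[OF K uK vK uv nonadjacent] .

text \<open>
  If one point is inside the new edge, the disjointness of supports keeps the other one off \<open>u\<close>
  and \<open>v\<close>.
\<close>
lemma disc_L_cover: "disc_conf2 L \<subseteq> disc_conf2 K \<union> tube_set"
proof
  fix z assume "z \<in> disc_conf2 L"
  then have z: "fst z \<in> points L" "snd z \<in> points L" "\<And>w. fst z w = 0 \<or> snd z w = 0" by (auto simp: disc_conf2_iff[OF L])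
  have end_or: "x \<in> points K \<or> (x u \<noteq> 0 \<and> x v \<noteq> 0)" if "x \<in> cell {u, v}" for x
  proof -
    obtain t where t: "0 \<le> t" "t \<le> 1" "x = segment u v t" using \<open>x \<in> cell {u, v}\<close> cell_uv by auto
    then show ?thesis using segment_in_K[OF t(1,2)] segment_coords(1,2)[OF uv, of t] by (cases "t = 0 \<or> t = 1") auto
  qed
  have other: "y \<in> points K0" if "y \<in> points L" "y u = 0" "y v = 0" for y
  proof -
    have "y \<notin> cell {u, v}" using that uv by (auto simp: cell_def)
    then show ?thesis using that points_L by (auto simp: points_K0)
  qed
  show "z \<in> disc_conf2 K \<union> tube_set"
  proof (cases "fst z \<in> points K \<and> snd z \<in> points K")
    case True
    then show ?thesis using z by (auto simp: disc_conf2_iff[OF K])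
  next
    case False
    then consider "fst z \<notin> points K" | "snd z \<notin> points K" by blast
    then show ?thesis
    proof cases
      case 1
      then have "fst z \<in> cell {u, v}" using z(1) points_L by auto
      moreover have "snd z \<in> points K0" using other[OF z(2)] end_or[OF calculation] 1 z(3)[of u] z(3)[of v] by auto
      ultimately show ?thesis by (auto simp: tube_set_def mem_Times_iff)
    next
      case 2
      then have "snd z \<in> cell {u, v}" using z(2) points_L by auto
      moreover have "fst z \<in> points K0" using other[OF z(1)] end_or[OF calculation] 2 z(3)[of u] z(3)[of v] by auto
      ultimately show ?thesis by (auto simp: tube_set_def mem_Times_iff)
    qed
  qed
qed

lemma cylinder_ends_u: "cylinder (top_of_set ends_u) = top_of_set (ends_u \<times> {0..1})"
  by (simp add: cylinder_def)

lemma continuous_slide: "continuous_on S (\<lambda>p. slide (g p) (f p))" if "continuous_on S f" "continuous_on S g"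
  for f :: "'b::topological_space \<Rightarrow> 'a \<Rightarrow> real"
  unfolding slide_def
  by (intro continuous_on_coordinatewise_then_product continuous_on_add continuous_on_mult
      continuous_on_const that continuous_on_product_then_coordinatewise[OF that(1)])

lemma continuous_unslide: "continuous_on S (\<lambda>p. unslide (f p))" if "continuous_on S f"
  for f :: "'b::topological_space \<Rightarrow> 'a \<Rightarrow> real"
  unfolding unslide_def
  by (intro continuous_on_coordinatewise_then_product continuous_on_add continuous_on_mult
      continuous_on_const that continuous_on_product_then_coordinatewise[OF that])

lemma tube_map_in: "\<lbrakk>z \<in> ends_u; 0 \<le> t; t \<le> 1\<rbrakk> \<Longrightarrow> tube_map (z, t) \<in> tube_set \<and> tube_inv (tube_map (z, t)) = (z, t)"
  by (auto simp: ends_u_def tube_set_def tube_map_simps tube_inv_simps cell_uv)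

lemma tube_inv_in: "z \<in> tube_set \<Longrightarrow> tube_inv z \<in> ends_u \<times> {0..1} \<and> tube_map (tube_inv z) = z"
  by (auto simp: ends_u_def tube_set_def tube_map_simps tube_inv_simps cell_uv)

lemma closed_prods: "closed tube_set" "closed (points K \<times> points K)"
  unfolding tube_set_def by (intro closed_Un closed_Times closed_points closed_cell K K0)+

sublocale T: tube "top_of_set ends_u" "disc_space L" "disc_conf2 K" tube_set tube_map tube_inv
proof
  have "disc_conf2 K = disc_conf2 L \<inter> (points K \<times> points K)"
    using disc_K_sub by (auto simp: disc_conf2_iff[OF L] disc_conf2_iff[OF K])
  then show "closedin (disc_space L) (disc_conf2 K)"
    using closed_prods(2) by (auto simp: disc_space_eq[OF L] closedin_closed)
  show "closedin (disc_space L) tube_set"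
    using closed_prods(1) tube_set_sub by (simp add: disc_space_eq[OF L] closed_subset)
  show "topspace (disc_space L) \<subseteq> disc_conf2 K \<union> tube_set"
    using disc_L_cover by (simp add: disc_space_eq[OF L])
  have st: "subtopology (disc_space L) tube_set = top_of_set tube_set"
    using tube_set_sub by (simp add: disc_space_eq[OF L] subtopology_subtopology Int_absorb1)
  have c1: "continuous_on (ends_u \<times> {0..1}) tube_map"
    unfolding tube_map_def case_prod_unfold
    by (intro continuous_on_Pair continuous_slide continuous_on_fst continuous_on_snd continuous_on_id)
  have coord: "continuous_on tube_set (\<lambda>z. fst z v)" "continuous_on tube_set (\<lambda>z. snd z v)"
    by (rule continuous_pair_coords[OF continuous_on_id])+
  have c2: "continuous_on tube_set tube_inv"
    unfolding tube_inv_def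
    by (intro continuous_on_Pair continuous_unslide continuous_on_fst continuous_on_snd continuous_on_id continuous_on_add coord)
  show "homeomorphic_maps (cylinder (top_of_set ends_u)) (subtopology (disc_space L) tube_set) tube_map tube_inv"
    unfolding st cylinder_ends_u homeomorphic_maps_def
    using c1 c2 tube_map_in tube_inv_in by (auto simp: image_subset_iff_funcset[symmetric] image_subset_iff)
  show "tube_map (m, t) \<in> disc_conf2 K \<longleftrightarrow> t = 0 \<or> t = 1" if "m \<in> topspace (top_of_set ends_u)" "0 \<le> t" "t \<le> 1" for m t
  proof -
    have zero: "segment u v t w = 0 \<or> y w = 0" if "y \<in> points K0" for y w
      using that uv by (auto simp: segment_def vertex_point_def points_K0)
    have "(segment u v t, y) \<in> disc_conf2 K \<longleftrightarrow> t = 0 \<or> t = 1" "(y, segment u v t) \<in> disc_conf2 K \<longleftrightarrow> t = 0 \<or> t = 1"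
      if "y \<in> points K0" for y
      unfolding disc_conf2_iff[OF K] fst_conv snd_conv segment_in_K[OF \<open>0 \<le> t\<close> \<open>t \<le> 1\<close>, symmetric]
      using zero[OF that] points_K0_K[OF that] by blast+
    then show ?thesis
      using that(1) by (auto simp: ends_u_def tube_map_simps)
  qed
qed

lemma subtopology_disc: "subtopology (disc_space L) (disc_conf2 K) = disc_space K"
  using disc_K_sub by (simp add: disc_space_eq[OF L] disc_space_eq[OF K] subtopology_subtopology Int_absorb1)

abbreviation H0 where "H0 p \<equiv> homology_group p (realization K0)"
abbreviation HD where "HD p \<equiv> homology_group p (disc_space K)"

definition left_map :: "int \<Rightarrow> 'a \<Rightarrow> ('a \<Rightarrow> real) chain set \<Rightarrow> (('a \<Rightarrow> real) \<times> ('a \<Rightarrow> real)) chain set" where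
  "left_map p w = hom_induced p (realization K0) {} (disc_space K) {} (\<lambda>y. (vertex_point w, y))"
definition right_map :: "int \<Rightarrow> 'a \<Rightarrow> ('a \<Rightarrow> real) chain set \<Rightarrow> (('a \<Rightarrow> real) \<times> ('a \<Rightarrow> real)) chain set" where
  "right_map p w = hom_induced p (realization K0) {} (disc_space K) {} (\<lambda>y. (y, vertex_point w))"

text \<open>
  \<open>z \<oplus> z'\<close> goes to \<open>(u \<times> z - v \<times> z) + (z' \<times> u - z' \<times> v)\<close>.
\<close>
definition link_map :: "int \<Rightarrow> ('a \<Rightarrow> real) chain set \<times> ('a \<Rightarrow> real) chain set \<Rightarrow> (('a \<Rightarrow> real) \<times> ('a \<Rightarrow> real)) chain set" where
  "link_map p = (\<lambda>(z, z').
     (left_map p u z \<otimes>\<^bsub>HD p\<^esub> inv\<^bsub>HD p\<^esub> left_map p v z) \<otimes>\<^bsub>HD p\<^esub>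
     (right_map p u z' \<otimes>\<^bsub>HD p\<^esub> inv\<^bsub>HD p\<^esub> right_map p v z'))"

lemma slices_continuous:
  assumes "w = u \<or> w = v"
  shows "continuous_map (realization K0) (disc_space K) (\<lambda>y. (vertex_point w, y))"
    "continuous_map (realization K0) (disc_space K) (\<lambda>y. (y, vertex_point w))"
proof -
  have "vertex_point w x = 0 \<or> y x = 0" "y x = 0 \<or> vertex_point w x = 0" if "y \<in> points K0" for x y
    using that assms by (auto simp: vertex_point_def points_K0)
  moreover have "vertex_point w \<in> points K" using assms vertex_points by auto
  ultimately show "continuous_map (realization K0) (disc_space K) (\<lambda>y. (vertex_point w, y))"
    "continuous_map (realization K0) (disc_space K) (\<lambda>y. (y, vertex_point w))"
    using points_K0_K
    by (auto simp: realization_eq disc_space_eq[OF K] disc_conf2_iff[OF K] intro!: continuous_intros)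
qed

definition core_map :: "int \<Rightarrow> ('a \<Rightarrow> real) chain set \<times> ('a \<Rightarrow> real) chain set \<Rightarrow> (('a \<Rightarrow> real) \<times> ('a \<Rightarrow> real)) chain set" where
  "core_map p = (\<lambda>(z, z'). hom_induced p (realization K0) {} (top_of_set ends_u) {} (\<lambda>y. (vertex_point u, y)) z
     \<otimes>\<^bsub>homology_group p (top_of_set ends_u)\<^esub>
     hom_induced p (realization K0) {} (top_of_set ends_u) {} (\<lambda>y. (y, vertex_point u)) z')"

lemma core_continuous:
  "continuous_map (realization K0) (top_of_set ends_u) (\<lambda>y. (vertex_point u, y))"
  "continuous_map (realization K0) (top_of_set ends_u) (\<lambda>y. (y, vertex_point u))"
  by (auto simp: realization_eq ends_u_def intro!: continuous_intros)

lemma iso_core_map: "core_map p \<in> iso (H0 p \<times>\<times> H0 p) (homology_group p (top_of_set ends_u))"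
  unfolding core_map_def
proof (rule iso_homology_two_pieces)
  let ?A = "{vertex_point u} \<times> points K0" and ?B = "points K0 \<times> {vertex_point u}"
  have im: "(\<lambda>y. (vertex_point u, y)) ` topspace (realization K0) = ?A" "(\<lambda>y. (y, vertex_point u)) ` topspace (realization K0) = ?B"
    by auto
  have sub: "subtopology (top_of_set ends_u) ?A = top_of_set ?A" "subtopology (top_of_set ends_u) ?B = top_of_set ?B"
    by (simp_all add: subtopology_subtopology ends_u_def Int_absorb1)
  have hm: "homeomorphic_maps (realization K0) (top_of_set ?A) (\<lambda>y. (vertex_point u, y)) snd"
    "homeomorphic_maps (realization K0) (top_of_set ?B) (\<lambda>y. (y, vertex_point u)) fst"
    by (auto simp: homeomorphic_maps_def realization_eq continuous_on_fst[OF continuous_on_id] continuous_on_snd[OF continuous_on_id]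
        intro!: continuous_on_Pair continuous_on_const continuous_on_id)
  show "embedding_map (realization K0) (top_of_set ends_u) (\<lambda>y. (vertex_point u, y))"
    "embedding_map (realization K0) (top_of_set ends_u) (\<lambda>y. (y, vertex_point u))"
    unfolding embedding_map_def im sub
    using homeomorphic_maps_imp_map[OF hm(1)] homeomorphic_maps_imp_map[OF hm(2)] .
  have op: "open {z :: ('a \<Rightarrow> real) \<times> ('a \<Rightarrow> real). 1/2 < fst z u}" "open {z :: ('a \<Rightarrow> real) \<times> ('a \<Rightarrow> real). 1/2 < snd z u}"
    by (intro open_Collect_less continuous_on_const continuous_pair_coords[OF continuous_on_id])+
  have "?A = ends_u \<inter> {z. 1/2 < fst z u}" "?B = ends_u \<inter> {z. 1/2 < snd z u}"
    by (auto simp: ends_u_def points_K0 vertex_point_def)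
  then show "openin (top_of_set ends_u) ((\<lambda>y. (vertex_point u, y)) ` topspace (realization K0))"
    "openin (top_of_set ends_u) ((\<lambda>y. (y, vertex_point u)) ` topspace (realization K0))"
    unfolding im using op by (metis openin_open)+
  show "(\<lambda>y. (vertex_point u, y)) ` topspace (realization K0) \<inter> (\<lambda>y. (y, vertex_point u)) ` topspace (realization K0) = {}"
    by (auto simp: points_K0 vertex_point_def fun_eq_iff)
  show "topspace (top_of_set ends_u) \<subseteq> (\<lambda>y. (vertex_point u, y)) ` topspace (realization K0) \<union> (\<lambda>y. (y, vertex_point u)) ` topspace (realization K0)"
    by (auto simp: ends_u_def)
qed

definition attach :: "int \<Rightarrow> ('a \<Rightarrow> real) chain set \<times> ('a \<Rightarrow> real) chain set \<Rightarrow> (('a \<Rightarrow> real) \<times> ('a \<Rightarrow> real)) chain set" where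
  "attach p = T.tube_class p \<circ> core_map (p - 1)"

lemma iso_attach: "attach p \<in> iso (H0 (p-1) \<times>\<times> H0 (p-1)) (relative_homology_group p (disc_space L) (disc_conf2 K))"
  unfolding attach_def by (rule iso_set_trans[OF iso_core_map T.iso_tube_class])

lemma hom_boundary_attach:
  assumes "x \<in> carrier (H0 (p-1) \<times>\<times> H0 (p-1))"
  shows "hom_boundary p (disc_space L) (disc_conf2 K) (attach p x) = link_map (p-1) x"
proof -
  obtain z z' where x: "x = (z, z')" "z \<in> carrier (H0 (p-1))" "z' \<in> carrier (H0 (p-1))" using assms by auto
  let ?M = "homology_group (p-1) (top_of_set ends_u)"
  let ?l = "hom_induced (p-1) (realization K0) {} (top_of_set ends_u) {} (\<lambda>y. (vertex_point u, y)) z"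
  let ?r = "hom_induced (p-1) (realization K0) {} (top_of_set ends_u) {} (\<lambda>y. (y, vertex_point u)) z'"
  let ?e = "\<lambda>t. hom_induced (p-1) (top_of_set ends_u) {} (disc_space K) {} (\<lambda>m. tube_map (m, t))"
  have c: "core_map (p-1) x \<in> carrier ?M" using iso_core_map[of "p-1"] assms by (auto simp: iso_def hom_def)
  interpret D: comm_group "HD (p-1)" by simp
  have e: "?e t (core_map (p-1) x) = left_map (p-1) w z \<otimes>\<^bsub>HD (p-1)\<^esub> right_map (p-1) w z'"
    if tw: "t = 0 \<and> w = u \<or> t = 1 \<and> w = v" for t w
  proof -
    have ct: "continuous_map (top_of_set ends_u) (disc_space K) (\<lambda>m. tube_map (m, t))"
      using T.end_cont[of t] tw subtopology_disc by auto
    have seg: "segment u v t = vertex_point w" using tw by auto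
    interpret e: group_hom ?M "HD (p-1)" "?e t" by simp
    have "?e t ?l = hom_induced (p-1) (realization K0) {} (disc_space K) {} ((\<lambda>m. tube_map (m, t)) \<circ> (\<lambda>y. (vertex_point u, y))) z"
      by (rule hom_induced_compose'[OF core_continuous(1) _ ct]) auto
    also have "\<dots> = left_map (p-1) w z"
      unfolding left_map_def by (subst hom_induced_eq[of _ _ "\<lambda>y. (vertex_point w, y)"]) (auto simp: tube_map_simps seg)
    finally have l: "?e t ?l = left_map (p-1) w z" .
    have "?e t ?r = hom_induced (p-1) (realization K0) {} (disc_space K) {} ((\<lambda>m. tube_map (m, t)) \<circ> (\<lambda>y. (y, vertex_point u))) z'"
      by (rule hom_induced_compose'[OF core_continuous(2) _ ct]) auto
    also have "\<dots> = right_map (p-1) w z'"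
      unfolding right_map_def by (subst hom_induced_eq[of _ _ "\<lambda>y. (y, vertex_point w)"]) (auto simp: tube_map_simps seg)
    finally have r: "?e t ?r = right_map (p-1) w z'" .
    show ?thesis using l r by (simp add: core_map_def x hom_induced_carrier)
  qed
  have "hom_boundary p (disc_space L) (disc_conf2 K) (attach p x)
     = (left_map (p-1) u z \<otimes>\<^bsub>HD (p-1)\<^esub> right_map (p-1) u z') \<otimes>\<^bsub>HD (p-1)\<^esub>
       inv\<^bsub>HD (p-1)\<^esub> (left_map (p-1) v z \<otimes>\<^bsub>HD (p-1)\<^esub> right_map (p-1) v z')"
    using T.hom_boundary_tube_class[OF c] e[of 0 u] e[of 1 v] by (simp add: attach_def subtopology_disc)
  also have "\<dots> = link_map (p-1) x"
  proof -
    have "left_map (p-1) w z \<in> carrier (HD (p-1))" "right_map (p-1) w z' \<in> carrier (HD (p-1))" for w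
      by (auto simp: left_map_def right_map_def hom_induced_carrier)
    then show ?thesis by (simp add: link_map_def x D.inv_mult D.m_ac)
  qed
  finally show ?thesis .
qed

text \<open>
  The involution preserves levels of the cylinder, hence commutes with the suspension because the
  latter is determined by its boundary.
\<close>
lemma swap_attach:
  assumes "x \<in> carrier (H0 (p-1) \<times>\<times> H0 (p-1))"
  shows "hom_induced p (disc_space L) (disc_conf2 K) (disc_space L) (disc_conf2 K) prod.swap (attach p x) = attach p (prod.swap x)"
proof -
  obtain z z' where x: "x = (z, z')" "z \<in> carrier (H0 (p-1))" "z' \<in> carrier (H0 (p-1))" using assms by auto
  let ?U = "top_of_set ends_u"
  let ?C = "cylinder ?U" and ?E = "cylinder_ends ?U"
  let ?M = "homology_group (p-1) ?U"
  let ?S = "hom_induced (p-1) ?U {} ?U {} prod.swap"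
  let ?s = "map_prod prod.swap id :: (('a \<Rightarrow> real) \<times> ('a \<Rightarrow> real)) \<times> real \<Rightarrow> _"
  have cs: "continuous_map ?U ?U prod.swap"
    by (auto simp: ends_u_def continuous_on_swap)
  have csC: "continuous_map ?C ?C ?s"
    unfolding cylinder_def map_prod_def by (subst continuous_map_prod_top) (use cs in auto)
  have sE: "?s \<in> ?E \<rightarrow> ?E" by (auto simp: cylinder_ends_def ends_u_def)
  have csL: "continuous_map (disc_space L) (disc_space L) prod.swap"
    by (auto simp: disc_space_eq[OF L] disc_conf2_iff[OF L] continuous_on_swap)
  have c: "core_map (p-1) x \<in> carrier ?M" using iso_core_map[of "p-1"] assms by (auto simp: iso_def hom_def)
  have core: "?S (core_map (p-1) x) = core_map (p-1) (prod.swap x)"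
  proof -
    interpret M: comm_group ?M by simp
    interpret S: group_hom ?M ?M ?S by simp
    have "?S (hom_induced (p-1) (realization K0) {} ?U {} (\<lambda>y. (vertex_point u, y)) a) = hom_induced (p-1) (realization K0) {} ?U {} (\<lambda>y. (y, vertex_point u)) a"
      "?S (hom_induced (p-1) (realization K0) {} ?U {} (\<lambda>y. (y, vertex_point u)) a) = hom_induced (p-1) (realization K0) {} ?U {} (\<lambda>y. (vertex_point u, y)) a" for a
      using hom_induced_compose'[OF core_continuous(1) _ cs, of "{}" "{}" "{}"] hom_induced_compose'[OF core_continuous(2) _ cs, of "{}" "{}" "{}"]
      by (simp_all add: o_def)
    then show ?thesis by (simp add: core_map_def x hom_induced_carrier M.m_comm)
  qed
  have cyl: "hom_induced p ?C ?E ?C ?E ?s (cylinder_class p ?U y) = cylinder_class p ?U (?S y)" if y: "y \<in> carrier ?M" for y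
  proof (rule cylinder_class_unique[symmetric])
    let ?SE = "hom_induced (p-1) (subtopology ?C ?E) {} (subtopology ?C ?E) {} ?s"
    interpret SE: group_hom "homology_group (p-1) (subtopology ?C ?E)" "homology_group (p-1) (subtopology ?C ?E)" ?SE by simp
    have nat: "hom_boundary p ?C ?E (hom_induced p ?C ?E ?C ?E ?s (cylinder_class p ?U y)) = ?SE (ends_difference (p-1) ?U y)"
      using naturality_hom_induced[OF csC sE, of p] cylinder_class(2)[OF y] by (simp add: fun_eq_iff)
    have "?SE (end_map (p-1) ?U t y) = end_map (p-1) ?U t (?S y)" if t: "t \<in> {0, 1}" for t
    proof -
      have ct: "continuous_map ?U (subtopology ?C ?E) (\<lambda>m. (m, t))"
        using continuous_map_cylinder_level[of t ?U] t by (auto simp: continuous_map_in_subtopology cylinder_ends_def)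
      have cE: "continuous_map (subtopology ?C ?E) (subtopology ?C ?E) ?s"
        using csC sE by (auto simp: continuous_map_in_subtopology continuous_map_from_subtopology)
      have "?SE (end_map (p-1) ?U t y) = hom_induced (p-1) ?U {} (subtopology ?C ?E) {} (?s \<circ> (\<lambda>m. (m, t))) y"
        unfolding end_map_def by (rule hom_induced_compose'[OF ct _ cE]) auto
      moreover have "end_map (p-1) ?U t (?S y) = hom_induced (p-1) ?U {} (subtopology ?C ?E) {} ((\<lambda>m. (m, t)) \<circ> prod.swap) y"
        unfolding end_map_def by (rule hom_induced_compose'[OF cs _ ct]) auto
      ultimately show ?thesis by (simp add: o_def)
    qed
    then show "hom_boundary p ?C ?E (hom_induced p ?C ?E ?C ?E ?s (cylinder_class p ?U y)) = ends_difference (p-1) ?U (?S y)"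
      unfolding nat by (simp add: ends_difference_def end_map_def hom_induced_carrier)
  qed (rule hom_induced_carrier)
  have kE: "tube_map \<in> ?E \<rightarrow> disc_conf2 K" using T.kappa_ends_image by blast
  have sD: "prod.swap \<in> disc_conf2 K \<rightarrow> disc_conf2 K" by (auto simp: disc_conf2_iff[OF K])
  have "hom_induced p (disc_space L) (disc_conf2 K) (disc_space L) (disc_conf2 K) prod.swap (attach p x)
    = hom_induced p ?C ?E (disc_space L) (disc_conf2 K) (prod.swap \<circ> tube_map) (cylinder_class p ?U (core_map (p-1) x))"
  proof -
    have "attach p x = hom_induced p ?C ?E (disc_space L) (disc_conf2 K) tube_map (cylinder_class p ?U (core_map (p-1) x))"
      by (simp add: attach_def T.tube_class_def)
    then show ?thesis by (simp only: hom_induced_compose'[OF T.kappa_cont kE csL sD])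
  qed
  also have "prod.swap \<circ> tube_map = tube_map \<circ> ?s"
    by (auto simp: tube_map_def fun_eq_iff)
  also have "hom_induced p ?C ?E (disc_space L) (disc_conf2 K) (tube_map \<circ> ?s) (cylinder_class p ?U (core_map (p-1) x))
    = hom_induced p ?C ?E (disc_space L) (disc_conf2 K) tube_map (hom_induced p ?C ?E ?C ?E ?s (cylinder_class p ?U (core_map (p-1) x)))"
    by (rule hom_induced_compose'[OF csC sE T.kappa_cont kE, symmetric])
  also have "\<dots> = attach p (prod.swap x)"
    using cyl[OF c] core by (simp add: attach_def T.tube_class_def)
  finally show ?thesis .
qed

end

section \<open>The boundary homomorphism on the cokernel of the intersection form\<close>

lemma (in group_hom) generate_into_kernel:
  assumes "S \<subseteq> kernel G H h"
  shows "generate G S \<subseteq> kernel G H h"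
  using assms subgroup_kernel G.generate_subgroup_incl by blast

lemma inv_into_iso: 
  assumes "f \<in> iso A B" "x \<in> carrier B"
  shows "inv_into (carrier A) f x \<in> carrier A" "f (inv_into (carrier A) f x) = x"
  using assms unfolding iso_def bij_betw_def by (auto simp: inv_into_into f_inv_into_f)

lemma continuous_map_square_swap: "continuous_map (square X) (square X) prod.swap"
  by (simp add: square_def continuous_map_prod_swap)

lemma disc_conf2_swap: "graph K \<Longrightarrow> prod.swap z \<in> disc_conf2 K \<longleftrightarrow> z \<in> disc_conf2 K"
  by (auto simp: disc_conf2_iff)

lemma diag_nbhd_swap:
  assumes K: "graph K" and z: "z \<in> diag_nbhd K"
  shows "prod.swap z \<in> diag_nbhd K"
proof -
  let ?S = "topspace (square (realization K)) - disc_conf2 K"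
  have "prod.swap ` ?S \<subseteq> ?S" using disc_conf2_swap[OF K] by (auto simp: square_def)
  moreover have "prod.swap ` (square (realization K) closure_of ?S) \<subseteq> square (realization K) closure_of (prod.swap ` ?S)"
    by (rule continuous_map_image_closure_subset[OF continuous_map_square_swap])
  ultimately show ?thesis
    using z closure_of_mono[of "prod.swap ` ?S" ?S "square (realization K)"] unfolding diag_nbhd_def by blast
qed

locale finite_graph =
  fixes K :: "'a set set"
  assumes K: "graph K"
begin

abbreviation "Sq \<equiv> square (realization K)"
abbreviation "Conf \<equiv> conf2 (realization K)"
abbreviation "H1C \<equiv> homology_group 1 Conf"
abbreviation "H1D \<equiv> homology_group 1 (disc_space K)"
abbreviation "N2 \<equiv> H2_nbhd K"
abbreviation "R2 \<equiv> H2_square_rel K"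

definition \<iota> :: "int \<Rightarrow> (('a \<Rightarrow> real) \<times> ('a \<Rightarrow> real)) chain set \<Rightarrow> (('a \<Rightarrow> real) \<times> ('a \<Rightarrow> real)) chain set" where
  "\<iota> p = hom_induced p (disc_space K) {} Conf {} id"

lemma iso_iota: "\<iota> p \<in> iso (homology_group p (disc_space K)) (homology_group p Conf)"
  unfolding \<iota>_def by (rule iso_disc_conf2[OF K])

definition bd :: "(('a \<Rightarrow> real) \<times> ('a \<Rightarrow> real)) chain set \<Rightarrow> (('a \<Rightarrow> real) \<times> ('a \<Rightarrow> real)) chain set" where
  "bd = hom_boundary 2 Sq (disc_conf2 K)"

lemma bd_hom: "group_hom R2 H1D bd"
  using group_hom_hom_boundary[of 2 Sq "disc_conf2 K"] by (simp add: bd_def H2_square_rel_def disc_space_def)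

definition \<beta> :: "(('a \<Rightarrow> real) \<times> ('a \<Rightarrow> real)) chain set \<Rightarrow> (('a \<Rightarrow> real) \<times> ('a \<Rightarrow> real)) chain set" where
  "\<beta> w = \<iota> 1 (bd (excise K w))"

lemma groups: "comm_group N2" "comm_group R2" "comm_group H1D" "comm_group H1C"
  by (auto simp: H2_nbhd_def H2_square_rel_def)

lemma beta_hom: "group_hom N2 H1C \<beta>"
proof -
  have "\<iota> 1 \<circ> (bd \<circ> excise K) \<in> hom N2 H1C"
    using iso_iota[of 1] iso_excise[OF K] bd_hom
    by (intro hom_compose[of _ _ H1D] hom_compose[of _ _ R2]) (auto simp: iso_def group_hom_def group_hom_axioms_def)
  then have "\<beta> \<in> hom N2 H1C" by (simp add: \<beta>_def[abs_def] o_def)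
  then show ?thesis using groups by (simp add: group_hom_def group_hom_axioms_def comm_group_def)
qed

lemma excise_inv:
  assumes "w \<in> carrier R2"
  shows "excise_inv K w \<in> carrier N2" "excise K (excise_inv K w) = w"
  using inv_into_iso[OF iso_excise[OF K] assms] by (simp_all add: excise_inv_def)

lemma iso_excise_inv: "excise_inv K \<in> iso R2 N2"
  unfolding excise_inv_def[abs_def] using group.iso_set_sym[OF _ iso_excise[OF K]] groups by (simp add: comm_group_def)

definition relativize :: "(('a \<Rightarrow> real) \<times> ('a \<Rightarrow> real)) chain set \<Rightarrow> (('a \<Rightarrow> real) \<times> ('a \<Rightarrow> real)) chain set" where
  "relativize = hom_induced 2 Sq {} Sq (disc_conf2 K) id"

lemma relativize_hom: "group_hom (homology_group 2 Sq) R2 relativize"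
  by (simp add: relativize_def H2_square_rel_def)

lemma kernel_bd: "kernel R2 H1D bd = relativize ` carrier (homology_group 2 Sq)"
  using kernel_hom_boundary[of 2 Sq "disc_conf2 K"]
  by (simp add: bd_def H2_square_rel_def disc_space_def relativize_def)

lemma cross_classes_eq:
  "cross_classes (realization K) (realization K) =
    {homology_cross (realization K) z z' | z z'.
        z \<in> carrier (homology_group 1 (realization K)) \<and> z' \<in> carrier (homology_group 1 (realization K))}"
proof -
  have c: "carrier (homology_group 1 (realization K)) = homologous_rel_set 1 (realization K) {} ` singular_relcycle_set 1 (realization K) {}"
    using carrier_relative_homology_group[of 1 "realization K" "{}"] by simp
  show ?thesis
  proof (intro equalityI subsetI)
    fix x assume "x \<in> cross_classes (realization K) (realization K)"
    then obtain a b where "singular_relcycle 1 (realization K) {} a" "singular_relcycle 1 (realization K) {} b"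
      "x = homologous_rel_set 2 (square (realization K)) {} (product_chain a b)"
      by (auto simp: cross_classes_def square_def)
    then show "x \<in> {homology_cross (realization K) z z' | z z'.
        z \<in> carrier (homology_group 1 (realization K)) \<and> z' \<in> carrier (homology_group 1 (realization K))}"
      using homology_cross_eq[of "realization K" a b] unfolding c by blast
  next
    fix x assume "x \<in> {homology_cross (realization K) z z' | z z'.
        z \<in> carrier (homology_group 1 (realization K)) \<and> z' \<in> carrier (homology_group 1 (realization K))}"
    then obtain a b where ab: "singular_relcycle 1 (realization K) {} a" "singular_relcycle 1 (realization K) {} b"
      "x = homology_cross (realization K) (homologous_rel_set 1 (realization K) {} a) (homologous_rel_set 1 (realization K) {} b)"
      unfolding c by blast
    then show "x \<in> cross_classes (realization K) (realization K)"
      unfolding ab(3) homology_cross_eq[OF ab(1,2)] by (auto simp: cross_classes_def square_def)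
  qed
qed

lemma intersection_image_eq:
  "intersection_image K = generate N2 ((excise_inv K \<circ> relativize) ` cross_classes (realization K) (realization K))"
proof -
  have "{intersection_form K z z' | z z'. z \<in> carrier (homology_group 1 (realization K)) \<and> z' \<in> carrier (homology_group 1 (realization K))}
     = (excise_inv K \<circ> relativize) ` cross_classes (realization K) (realization K)"
    unfolding cross_classes_eq intersection_form_def relativize_def by (auto simp: image_iff) 
  then show ?thesis by (simp add: intersection_image_def)
qed

lemma cross_classes_sub: "cross_classes (realization K) (realization K) \<subseteq> carrier (homology_group 2 Sq)"
  using cross_classes_carrier[of "realization K" "realization K"] by (simp add: square_def)

text \<open>
  A class with zero boundary comes from \<open>H\<^sub>2(\<Gamma> \<times> \<Gamma>)\<close> by exactness, hence from cross products by the
  Kuenneth theorem.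
\<close>
theorem kernel_beta: "kernel N2 H1C \<beta> = intersection_image K"
proof -
  interpret b: group_hom N2 H1C \<beta> by (rule beta_hom)
  interpret r: group_hom "homology_group 2 Sq" R2 relativize by (rule relativize_hom)
  interpret d: group_hom R2 H1D bd by (rule bd_hom)
  have ei: "group_hom R2 N2 (excise_inv K)"
    using iso_excise_inv groups by (simp add: group_hom_def group_hom_axioms_def iso_def comm_group_def)
  interpret ei: group_hom R2 N2 "excise_inv K" by (rule ei)
  interpret i: group_hom H1D H1C "\<iota> 1"
    using iso_iota[of 1] groups by (simp add: group_hom_def group_hom_axioms_def iso_def comm_group_def)
  let ?C = "cross_classes (realization K) (realization K)"
  have rb: "bd (relativize x) = \<one>\<^bsub>H1D\<^esub>" if "x \<in> carrier (homology_group 2 Sq)" for x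
    using kernel_bd that by (auto simp: kernel_def)
  show ?thesis
  proof
    have "(excise_inv K \<circ> relativize) ` ?C \<subseteq> kernel N2 H1C \<beta>"
    proof clarify
      fix x assume "x \<in> ?C"
      then have x: "x \<in> carrier (homology_group 2 Sq)" using cross_classes_sub by blast
      then show "(excise_inv K \<circ> relativize) x \<in> kernel N2 H1C \<beta>"
        using excise_inv[OF r.hom_closed[OF x]] rb[OF x] by (simp add: kernel_def \<beta>_def)
    qed
    then show "intersection_image K \<subseteq> kernel N2 H1C \<beta>"
      unfolding intersection_image_eq by (rule b.generate_into_kernel)
    show "kernel N2 H1C \<beta> \<subseteq> intersection_image K"
    proof
      fix w assume "w \<in> kernel N2 H1C \<beta>"
      then have w: "w \<in> carrier N2" "\<iota> 1 (bd (excise K w)) = \<one>\<^bsub>H1C\<^esub>" by (auto simp: kernel_def \<beta>_def)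
      have ew: "excise K w \<in> carrier R2" using iso_excise[OF K] w by (auto simp: iso_def hom_def)
      have "inj_on (\<iota> 1) (carrier H1D)" using iso_iota[of 1] by (simp add: iso_def bij_betw_def)
      then have "bd (excise K w) = \<one>\<^bsub>H1D\<^esub>"
        using w(2) d.hom_closed[OF ew] i.inj_on_one_iff by blast
      then have "excise K w \<in> relativize ` carrier (homology_group 2 Sq)"
        using ew kernel_bd by (auto simp: kernel_def)
      then obtain y where y: "y \<in> carrier (homology_group 2 Sq)" "excise K w = relativize y" by blast
      have "y \<in> generate (homology_group 2 Sq) ?C"
        using kuenneth_surjective[OF K trivial_homology_graph[OF K]] y(1) by (auto simp: square_def)
      moreover have "group_hom (homology_group 2 Sq) N2 (excise_inv K \<circ> relativize)"
        using hom_compose[OF r.homh ei.homh] groups by (simp add: group_hom_def group_hom_axioms_def comm_group_def)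
      ultimately have "(excise_inv K \<circ> relativize) y \<in> generate N2 ((excise_inv K \<circ> relativize) ` ?C)"
        using group_hom.generate_img[of "homology_group 2 Sq" N2 "excise_inv K \<circ> relativize" ?C] cross_classes_sub by blast
      moreover have "(excise_inv K \<circ> relativize) y = w"
        using y(2) w(1) iso_excise[OF K] by (simp add: excise_inv_def iso_def bij_betw_def inv_into_f_f flip: y(2))
      ultimately show "w \<in> intersection_image K" unfolding intersection_image_eq by simp
    qed
  qed
qed

lemma Q_group_eq: "Q_group K = N2 Mod kernel N2 H1C \<beta>"
  by (simp add: Q_group_def kernel_beta)

lemma Q_boundary_eq: "Q_boundary K = (\<lambda>q. the_elem (\<beta> ` q))"
  by (simp add: Q_boundary_def[abs_def] \<beta>_def[abs_def] \<iota>_def bd_def disc_space_def)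

lemma Q_boundary_coset:
  assumes w: "w \<in> carrier N2"
  shows "Q_boundary K (intersection_image K #>\<^bsub>N2\<^esub> w) = \<beta> w"
proof -
  interpret b: group_hom N2 H1C \<beta> by (rule beta_hom)
  have "\<beta> ` (kernel N2 H1C \<beta> #>\<^bsub>N2\<^esub> w) = {\<beta> w}"
  proof
    show "\<beta> ` (kernel N2 H1C \<beta> #>\<^bsub>N2\<^esub> w) \<subseteq> {\<beta> w}"
      using w by (auto simp: r_coset_def kernel_def)
    have "\<one>\<^bsub>N2\<^esub> \<otimes>\<^bsub>N2\<^esub> w \<in> kernel N2 H1C \<beta> #>\<^bsub>N2\<^esub> w"
      by (auto simp: r_coset_def kernel_def intro!: exI[of _ "\<one>\<^bsub>N2\<^esub>"])
    then have "w \<in> kernel N2 H1C \<beta> #>\<^bsub>N2\<^esub> w" using w by simp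
    then show "{\<beta> w} \<subseteq> \<beta> ` (kernel N2 H1C \<beta> #>\<^bsub>N2\<^esub> w)" by blast
  qed
  then show ?thesis by (simp add: Q_boundary_eq kernel_beta)
qed

lemma Q_boundary_hom: "group_hom (Q_group K) H1C (Q_boundary K)"
proof -
  interpret b: group_hom N2 H1C \<beta> by (rule beta_hom)
  have "Q_boundary K \<in> hom (Q_group K) H1C" unfolding Q_boundary_eq Q_group_eq by (rule b.FactGroup_hom)
  moreover have "group (Q_group K)" unfolding Q_group_eq by (rule normal.factorgroup_is_group[OF b.normal_kernel])
  ultimately show ?thesis by (simp add: group_hom_def group_hom_axioms_def)
qed

text \<open>
  By the identification of its kernel, \<open>\<beta>\<close> induces an injection on the quotient, and the induced map
  is \<open>Q_boundary\<close>.
\<close>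
theorem inj_on_Q_boundary: "inj_on (Q_boundary K) (carrier (Q_group K))"
proof -
  interpret b: group_hom N2 H1C \<beta> by (rule beta_hom)
  show ?thesis unfolding Q_boundary_eq Q_group_eq by (rule b.FactGroup_inj_on)
qed

lemma carrier_Q_group: "carrier (Q_group K) = (\<lambda>w. intersection_image K #>\<^bsub>N2\<^esub> w) ` carrier N2"
  by (simp add: Q_group_def carrier_FactGroup)

definition swap_N :: "(('a \<Rightarrow> real) \<times> ('a \<Rightarrow> real)) chain set \<Rightarrow> (('a \<Rightarrow> real) \<times> ('a \<Rightarrow> real)) chain set" where
  "swap_N = hom_induced 2 (subtopology Sq (diag_nbhd K)) (diag_bdry K) (subtopology Sq (diag_nbhd K)) (diag_bdry K) prod.swap"

lemma continuous_swap_subtopology: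
  assumes "\<And>z. z \<in> S \<Longrightarrow> prod.swap z \<in> S"
  shows "continuous_map (subtopology Sq S) (subtopology Sq S) prod.swap"
  using assms by (auto simp: continuous_map_in_subtopology intro: continuous_map_from_subtopology continuous_map_square_swap)

lemma swap_bdry: "prod.swap \<in> diag_bdry K \<rightarrow> diag_bdry K"
  using diag_nbhd_swap[OF K] disc_conf2_swap[OF K] by (auto simp: diag_bdry_def)

lemma swap_N_hom: "group_hom N2 N2 swap_N"
  by (simp add: swap_N_def H2_nbhd_def)

lemma swap_N_swap_N: "w \<in> carrier N2 \<Longrightarrow> swap_N (swap_N w) = w"
  unfolding swap_N_def H2_nbhd_def
  by (subst hom_induced_compose'[OF continuous_swap_subtopology swap_bdry continuous_swap_subtopology swap_bdry])
     (auto intro: diag_nbhd_swap[OF K] simp: hom_induced_id)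

lemma continuous_swap_Conf: "continuous_map Conf Conf prod.swap"
  unfolding conf2_def by (rule continuous_swap_subtopology) auto

lemma continuous_swap_disc: "continuous_map (disc_space K) (disc_space K) prod.swap"
  unfolding disc_space_def by (rule continuous_swap_subtopology) (simp add: disc_conf2_swap[OF K])

lemma continuous_incl: "continuous_map (disc_space K) Conf id"
  using disc_conf2_subset[OF K] by (auto simp: disc_space_eq[OF K] conf2_realization)

lemma iota_swap: "\<iota> p (hom_induced p (disc_space K) {} (disc_space K) {} prod.swap x) = tau p Conf (\<iota> p x)"
proof -
  have "\<iota> p (hom_induced p (disc_space K) {} (disc_space K) {} prod.swap x) = hom_induced p (disc_space K) {} Conf {} (id \<circ> prod.swap) x"
    unfolding \<iota>_def by (rule hom_induced_compose'[OF continuous_swap_disc _ continuous_incl]) auto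
  moreover have "tau p Conf (\<iota> p x) = hom_induced p (disc_space K) {} Conf {} (prod.swap \<circ> id) x"
    unfolding \<iota>_def tau_def by (rule hom_induced_compose'[OF continuous_incl _ continuous_swap_Conf]) auto
  ultimately show ?thesis by simp
qed

text \<open>
  Excision, the connecting homomorphism and the inclusion into \<open>F\<close> all commute with the involution.
\<close>
lemma beta_swap_N:
  shows "\<beta> (swap_N w) = tau 1 Conf (\<beta> w)"
proof -
  let ?N = "subtopology Sq (diag_nbhd K)"
  let ?sR = "hom_induced 2 Sq (disc_conf2 K) Sq (disc_conf2 K) prod.swap"
  have sd: "prod.swap \<in> disc_conf2 K \<rightarrow> disc_conf2 K" using disc_conf2_swap[OF K] by auto
  have cN: "continuous_map ?N ?N prod.swap" by (rule continuous_swap_subtopology) (rule diag_nbhd_swap[OF K])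
  have cI: "continuous_map ?N Sq id" "id \<in> diag_bdry K \<rightarrow> disc_conf2 K" by (auto simp: diag_bdry_def)
  have "excise K (swap_N w) = hom_induced 2 ?N (diag_bdry K) Sq (disc_conf2 K) (id \<circ> prod.swap) w"
    unfolding excise_def swap_N_def by (rule hom_induced_compose'[OF cN swap_bdry cI])
  moreover have "?sR (excise K w) = hom_induced 2 ?N (diag_bdry K) Sq (disc_conf2 K) (prod.swap \<circ> id) w"
    unfolding excise_def by (rule hom_induced_compose'[OF cI continuous_map_square_swap sd])
  ultimately have 1: "excise K (swap_N w) = ?sR (excise K w)" by simp
  have 2: "bd (?sR y) = hom_induced 1 (disc_space K) {} (disc_space K) {} prod.swap (bd y)" for y
    using naturality_hom_induced[OF continuous_map_square_swap sd, of 2]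
    by (simp add: bd_def disc_space_def fun_eq_iff)
  show ?thesis unfolding \<beta>_def 1 2 iota_swap ..
qed

lemma Q_tau:
  assumes q: "q \<in> carrier (Q_group K)"
  shows "Q_tau K q \<in> carrier (Q_group K)" "Q_boundary K (Q_tau K q) = tau 1 Conf (Q_boundary K q)"
proof -
  interpret b: group_hom N2 H1C \<beta> by (rule beta_hom)
  interpret s: group_hom N2 N2 swap_N by (rule swap_N_hom)
  interpret t: group_hom H1C H1C "tau 1 Conf" by (simp add: tau_def)
  obtain w where w: "w \<in> carrier N2" "q = intersection_image K #>\<^bsub>N2\<^esub> w" using q carrier_Q_group by auto
  have ker: "swap_N k \<in> kernel N2 H1C \<beta>" if "k \<in> kernel N2 H1C \<beta>" for k
    using that by (auto simp: kernel_def beta_swap_N)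
  have "swap_N ` (kernel N2 H1C \<beta> #>\<^bsub>N2\<^esub> w) = kernel N2 H1C \<beta> #>\<^bsub>N2\<^esub> swap_N w"
  proof (intro equalityI subsetI)
    fix y assume "y \<in> swap_N ` (kernel N2 H1C \<beta> #>\<^bsub>N2\<^esub> w)"
    then obtain k where "k \<in> kernel N2 H1C \<beta>" "y = swap_N (k \<otimes>\<^bsub>N2\<^esub> w)" by (auto simp: r_coset_def)
    then show "y \<in> kernel N2 H1C \<beta> #>\<^bsub>N2\<^esub> swap_N w"
      using ker[of k] w(1) by (auto simp: r_coset_def kernel_def)
  next
    fix y assume "y \<in> kernel N2 H1C \<beta> #>\<^bsub>N2\<^esub> swap_N w"
    then obtain k where k: "k \<in> kernel N2 H1C \<beta>" "y = k \<otimes>\<^bsub>N2\<^esub> swap_N w" by (auto simp: r_coset_def)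
    then have "y = swap_N (swap_N k \<otimes>\<^bsub>N2\<^esub> w)" using w(1) by (simp add: kernel_def swap_N_swap_N)
    moreover have "swap_N k \<otimes>\<^bsub>N2\<^esub> w \<in> kernel N2 H1C \<beta> #>\<^bsub>N2\<^esub> w"
      using ker[OF k(1)] by (auto simp: r_coset_def)
    ultimately show "y \<in> swap_N ` (kernel N2 H1C \<beta> #>\<^bsub>N2\<^esub> w)" by blast
  qed
  then have e: "Q_tau K q = intersection_image K #>\<^bsub>N2\<^esub> swap_N w"
    unfolding Q_tau_def w(2) kernel_beta by (simp add: swap_N_def)
  show "Q_tau K q \<in> carrier (Q_group K)" unfolding e carrier_Q_group using w(1) by simp
  show "Q_boundary K (Q_tau K q) = tau 1 Conf (Q_boundary K q)"
  proof -
    have "Q_boundary K (Q_tau K q) = \<beta> (swap_N w)" unfolding e using w(1) by (simp add: Q_boundary_coset)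
    moreover have "Q_boundary K q = \<beta> w" unfolding w(2) using w(1) by (simp add: Q_boundary_coset)
    ultimately show ?thesis by (simp add: beta_swap_N)
  qed
qed

end

section \<open>The linking homomorphism and the exact sequences\<close>

sublocale added_edge \<subseteq> finite_graph K
  by standard (rule K)

sublocale added_edge \<subseteq> Lg: finite_graph "add_edge K u v"
  by standard (rule L)

context added_edge
begin

lemma group_H0: "group (H0 p \<times>\<times> H0 p)" "comm_group (H0 p \<times>\<times> H0 p)"
proof -
  show g: "group (H0 p \<times>\<times> H0 p)" by (simp add: DirProd_group)
  interpret H: comm_group "H0 p" by simp
  show "comm_group (H0 p \<times>\<times> H0 p)"
    by (rule group.group_comm_groupI[OF g]) (auto simp: H.m_comm)
qed

lemma link_map_eq_boundary:
  assumes "x \<in> carrier (H0 p \<times>\<times> H0 p)"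
  shows "link_map p x = hom_boundary (p+1) (disc_space L) (disc_conf2 K) (attach (p+1) x)"
  using hom_boundary_attach[of x "p+1"] assms by simp

lemma group_hom_attach: "group_hom (H0 p \<times>\<times> H0 p) (relative_homology_group (p+1) (disc_space L) (disc_conf2 K)) (attach (p+1))"
  using iso_attach[of "p+1"] group_H0 by (simp add: group_hom_def group_hom_axioms_def iso_def)

lemma link_map_hom: "group_hom (H0 p \<times>\<times> H0 p) (HD p) (link_map p)"
proof -
  interpret a: group_hom "H0 p \<times>\<times> H0 p" "relative_homology_group (p+1) (disc_space L) (disc_conf2 K)" "attach (p+1)"
    by (rule group_hom_attach)
  interpret b: group_hom "relative_homology_group (p+1) (disc_space L) (disc_conf2 K)" "HD p" "hom_boundary (p+1) (disc_space L) (disc_conf2 K)"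
    using group_hom_hom_boundary[of "p+1" "disc_space L" "disc_conf2 K"] by (simp add: subtopology_disc)
  have "link_map p \<in> hom (H0 p \<times>\<times> H0 p) (HD p)"
  proof (rule homI)
    fix x assume "x \<in> carrier (H0 p \<times>\<times> H0 p)"
    then show "link_map p x \<in> carrier (HD p)"
      by (simp only: link_map_eq_boundary a.hom_closed b.hom_closed)
  next
    fix x y assume xy: "x \<in> carrier (H0 p \<times>\<times> H0 p)" "y \<in> carrier (H0 p \<times>\<times> H0 p)"
    then have "x \<otimes>\<^bsub>H0 p \<times>\<times> H0 p\<^esub> y \<in> carrier (H0 p \<times>\<times> H0 p)" by (rule a.G.m_closed)
    with xy show "link_map p (x \<otimes>\<^bsub>H0 p \<times>\<times> H0 p\<^esub> y) = link_map p x \<otimes>\<^bsub>HD p\<^esub> link_map p y"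
      by (simp only: link_map_eq_boundary a.hom_mult b.hom_mult a.hom_closed)
  qed
  then show ?thesis using group_H0 by (simp add: group_hom_def group_hom_axioms_def)
qed

definition swap_D :: "int \<Rightarrow> (('a \<Rightarrow> real) \<times> ('a \<Rightarrow> real)) chain set \<Rightarrow> (('a \<Rightarrow> real) \<times> ('a \<Rightarrow> real)) chain set" where
  "swap_D p = hom_induced p (disc_space K) {} (disc_space K) {} prod.swap"

lemma swap_D_left:
  assumes "w = u \<or> w = v"
  shows "swap_D p (left_map p w z) = right_map p w z"
proof -
  have "swap_D p (left_map p w z) = hom_induced p (realization K0) {} (disc_space K) {} (prod.swap \<circ> (\<lambda>y. (vertex_point w, y))) z"
    unfolding swap_D_def left_map_def by (rule hom_induced_compose'[OF slices_continuous(1)[OF assms] _ continuous_swap_disc]) auto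
  then show ?thesis by (simp add: right_map_def o_def)
qed

lemma left_right_carrier: "left_map p w z \<in> carrier (HD p)" "right_map p w z \<in> carrier (HD p)"
  by (auto simp: left_map_def right_map_def hom_induced_carrier)

definition left_link :: "int \<Rightarrow> ('a \<Rightarrow> real) chain set \<Rightarrow> (('a \<Rightarrow> real) \<times> ('a \<Rightarrow> real)) chain set" where
  "left_link p z = left_map p u z \<otimes>\<^bsub>HD p\<^esub> inv\<^bsub>HD p\<^esub> left_map p v z"

lemma left_link_carrier: "left_link p z \<in> carrier (HD p)"
proof -
  interpret D: comm_group "HD p" by simp
  show ?thesis by (simp add: left_link_def left_right_carrier)
qed

lemma link_map_left_link: "link_map p (z, z') = left_link p z \<otimes>\<^bsub>HD p\<^esub> swap_D p (left_link p z')"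
proof -
  interpret D: comm_group "HD p" by simp
  interpret s: group_hom "HD p" "HD p" "swap_D p" by (simp add: swap_D_def)
  show ?thesis by (simp add: link_map_def left_link_def swap_D_left left_right_carrier)
qed

text \<open>
  The boundary of \<open>a \<times> c\<close> is \<open>u \<times> c - v \<times> c\<close>, which only depends on the class of \<open>c\<close>.
\<close>
lemma linking_chain:
  assumes z: "z \<in> carrier (H0 1)" and c: "c \<in> z"
    and a: "singular_chain 1 (realization K) a" "chain_boundary 1 a = point_chain (vertex_point u) - point_chain (vertex_point v)"
  defines "q \<equiv> intersection_image K #>\<^bsub>H2_nbhd K\<^esub>
           excise_inv K (homologous_rel_set 2 (square (realization K)) (disc_conf2 K) (product_chain a c))"
  shows "q \<in> carrier (Q_group K)" "Q_boundary K q = \<iota> 1 (left_link 1 z)"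
proof -
  obtain c0 where c0: "singular_relcycle 1 (realization K0) {} c0" "z = homologous_rel_set 1 (realization K0) {} c0"
    using z carrier_relative_homology_group[of 1 "realization K0" "{}"] by auto
  have hc: "homologous_rel 1 (realization K0) {} c0 c" using c c0 by simp
  have cc: "singular_relcycle 1 (realization K0) {} c" using homologous_rel_singular_relcycle[OF hc] c0 by simp
  have zc: "z = homologous_rel_set 1 (realization K0) {} c" using c0(2) homologous_rel_set_eq[of 1 "realization K0" "{}" c0 c] hc by simp
  have c1: "singular_chain 1 (realization K0) c" "chain_boundary 1 c = 0" using cc by (auto simp: singular_cycle)
  have cK: "singular_chain 1 (realization K) c"
    using singular_chain_chain_map[OF c1(1) continuous_map_realization_mono[of K0 K]] chain_map_ident[OF c1(1)]
    by (simp add: remove_vertices_def)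
  let ?w = "product_chain a c" and ?l = "\<lambda>x. chain_map 1 (\<lambda>y. (vertex_point x, y)) c"
  have bdw: "chain_boundary 2 ?w = ?l u - ?l v"
    unfolding chain_boundary_product_chain a(2) c1(2) by (simp add: slice_left_diff)
  have l: "singular_relcycle 1 (disc_space K) {} (?l x)" if "x = u \<or> x = v" for x
    by (rule singular_relcycle_chain_map[OF cc slices_continuous(1)[OF that]]) auto
  have lm: "left_map 1 x z = homologous_rel_set 1 (disc_space K) {} (?l x)" if "x = u \<or> x = v" for x
    unfolding left_map_def zc using hom_induced_chain_map[OF slices_continuous(1)[OF that] _ cc, of "{}"] by simp
  have rc: "singular_relcycle 2 Sq (disc_conf2 K) ?w"
    unfolding singular_relcycle bdw
    using singular_chain_product_chain[OF a(1) cK] l[of u] l[of v]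
    by (auto simp: square_def singular_cycle disc_space_def singular_chain_diff)
  let ?W = "homologous_rel_set 2 Sq (disc_conf2 K) ?w"
  have W: "?W \<in> carrier R2" using homology_class_in_carrier[OF rc] by (simp add: H2_square_rel_def)
  have "bd ?W = homologous_rel_set 1 (disc_space K) {} (?l u - ?l v)"
    using hom_boundary_chain_boundary[OF rc] bdw by (simp add: bd_def disc_space_def)
  also have "\<dots> = left_link 1 z"
    using homology_class_diff[OF l[of u] l[of v]] by (simp add: left_link_def lm)
  finally have b: "bd ?W = left_link 1 z" .
  show "q \<in> carrier (Q_group K)" unfolding q_def carrier_Q_group using excise_inv[OF W] by simp
  show "Q_boundary K q = \<iota> 1 (left_link 1 z)"
    unfolding q_def Q_boundary_coset[OF excise_inv(1)[OF W]] \<beta>_def using excise_inv(2)[OF W] b by simp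
qed

end

locale linking = added_edge +
  assumes path_connected: "path_connected_space (conf2 (realization K))"
    and reachable: "(adjacent K)\<^sup>*\<^sup>* v u"
begin

text \<open>
  There is a chain from \<open>v\<close> to \<open>u\<close>, and any two choices of chain and cycle give the same coset
  because they have the same boundary.
\<close>
lemma Lk:
  assumes z: "z \<in> carrier (H0 1)"
  shows "Lk K v u z \<in> carrier (Q_group K)" "Q_boundary K (Lk K v u z) = \<iota> 1 (left_link 1 z)"
proof -
  let ?P = "\<lambda>q. \<exists>c\<in>z. \<exists>a. singular_chain 1 (realization K) a \<and>
     chain_boundary 1 a = point_chain (vertex_point u) - point_chain (vertex_point v) \<and>
     q = intersection_image K #>\<^bsub>H2_nbhd K\<^esub>
           excise_inv K (homologous_rel_set 2 (square (realization K)) (disc_conf2 K) (product_chain a c))"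
  have props: "q \<in> carrier (Q_group K) \<and> Q_boundary K q = \<iota> 1 (left_link 1 z)" if "?P q" for q
    using that linking_chain[OF z] by auto
  obtain a where a: "singular_chain 1 (realization K) a" "chain_boundary 1 a = point_chain (vertex_point u) - point_chain (vertex_point v)"
    using reachable_chain[OF K reachable] .
  obtain c where "z = homologous_rel_set 1 (realization K0) {} c"
    using z carrier_relative_homology_group[of 1 "realization K0" "{}"] by auto
  then have "c \<in> z" by simp
  with a have "\<exists>q. ?P q" by blast
  moreover have "q = q'" if "?P q" "?P q'" for q q'
    using props[OF that(1)] props[OF that(2)] inj_on_Q_boundary by (simp add: inj_on_def)
  ultimately have "\<exists>!q. ?P q" by (intro ex_ex1I)
  then have "?P (Lk K v u z)" unfolding Lk_def by (rule theI')
  from props[OF this] show "Lk K v u z \<in> carrier (Q_group K)" "Q_boundary K (Lk K v u z) = \<iota> 1 (left_link 1 z)"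
    by (rule conjunct1, rule conjunct2)
qed

lemma iota_group_hom: "group_hom (HD p) (homology_group p Conf) (\<iota> p)"
  using iso_iota[of p] by (simp add: group_hom_def group_hom_axioms_def iso_def)

lemma F_map_eq:
  assumes "x \<in> carrier (H0 1 \<times>\<times> H0 1)"
  shows "F_map K u v x = \<iota> 1 (link_map 1 x)"
proof -
  obtain z z' where x: "x = (z, z')" "z \<in> carrier (H0 1)" "z' \<in> carrier (H0 1)" using assms by auto
  interpret i: group_hom "HD 1" H1C "\<iota> 1" by (rule iota_group_hom)
  interpret s: group_hom "HD 1" "HD 1" "swap_D 1" by (simp add: swap_D_def)
  show ?thesis
    using x by (simp add: F_map_def Lk link_map_left_link left_link_carrier iota_swap[symmetric] swap_D_def[symmetric])
qed

text \<open>
  Injectivity on \<open>Q\<close> turns the defining equation of \<open>X\<close> into one in \<open>H\<^sub>1(D(\<Gamma>, 2))\<close>.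
\<close>
lemma X_set_eq: "X_set K u v = {x \<in> carrier (H0 1 \<times>\<times> H0 1). link_map 1 x = \<one>\<^bsub>HD 1\<^esub>}"
proof -
  interpret Q: group_hom "Q_group K" H1C "Q_boundary K" by (rule Q_boundary_hom)
  interpret i: group_hom "HD 1" H1C "\<iota> 1" by (rule iota_group_hom)
  interpret l: group_hom "H0 1 \<times>\<times> H0 1" "HD 1" "link_map 1" by (rule link_map_hom)
  have inj_i: "\<iota> 1 y = \<one>\<^bsub>H1C\<^esub> \<longleftrightarrow> y = \<one>\<^bsub>HD 1\<^esub>" if "y \<in> carrier (HD 1)" for y
    using i.inj_on_one_iff iso_iota[of 1] that by (auto simp: iso_def bij_betw_def)
  have "Lk K v u z \<otimes>\<^bsub>Q_group K\<^esub> Q_tau K (Lk K v u z') = \<one>\<^bsub>Q_group K\<^esub> \<longleftrightarrow> link_map 1 (z, z') = \<one>\<^bsub>HD 1\<^esub>"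
    if zz: "z \<in> carrier (H0 1)" "z' \<in> carrier (H0 1)" for z z'
  proof -
    let ?q = "Lk K v u z \<otimes>\<^bsub>Q_group K\<^esub> Q_tau K (Lk K v u z')"
    have c: "Lk K v u z \<in> carrier (Q_group K)" "Q_tau K (Lk K v u z') \<in> carrier (Q_group K)"
      using Lk(1) Q_tau(1) zz by auto
    have "?q = \<one>\<^bsub>Q_group K\<^esub> \<longleftrightarrow> Q_boundary K ?q = \<one>\<^bsub>H1C\<^esub>"
      using Q.inj_on_one_iff inj_on_Q_boundary Q.G.m_closed[OF c] by auto
    also have "Q_boundary K ?q = F_map K u v (z, z')"
      using Q.hom_mult[OF c] Q_tau(2)[OF Lk(1)[OF zz(2)]] by (simp add: F_map_def)
    also have "\<dots> = \<iota> 1 (link_map 1 (z, z'))" using zz by (intro F_map_eq) simp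
    also have "\<dots> = \<one>\<^bsub>H1C\<^esub> \<longleftrightarrow> link_map 1 (z, z') = \<one>\<^bsub>HD 1\<^esub>"
      using inj_i l.hom_closed[of "(z, z')"] zz by simp
    finally show ?thesis .
  qed
  then show ?thesis by (auto simp: X_set_def)
qed

definition incl_D :: "int \<Rightarrow> (('a \<Rightarrow> real) \<times> ('a \<Rightarrow> real)) chain set \<Rightarrow> (('a \<Rightarrow> real) \<times> ('a \<Rightarrow> real)) chain set" where
  "incl_D p = hom_induced p (disc_space K) {} (disc_space L) {} id"

lemma incl_D_hom: "group_hom (HD p) (homology_group p (disc_space L)) (incl_D p)"
  by (simp add: incl_D_def)

lemma kernel_incl_D: "kernel (HD p) (homology_group p (disc_space L)) (incl_D p) = link_map p ` carrier (H0 p \<times>\<times> H0 p)"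
proof -
  let ?R = "relative_homology_group (p+1) (disc_space L) (disc_conf2 K)"
  have "carrier ?R = attach (p+1) ` carrier (H0 p \<times>\<times> H0 p)"
    using iso_attach[of "p+1"] by (simp add: iso_def bij_betw_def)
  then have "hom_boundary (p+1) (disc_space L) (disc_conf2 K) ` carrier ?R = link_map p ` carrier (H0 p \<times>\<times> H0 p)"
    using link_map_eq_boundary by (simp add: image_image del: carrier_DirProd cong: image_cong)
  then show ?thesis
    using kernel_hom_induced_subspace[of p "disc_space L" "disc_conf2 K"] by (simp add: subtopology_disc incl_D_def)
qed

abbreviation "i p \<equiv> conf2_incl p K u v"
abbreviation "ConfL \<equiv> conf2 (realization L)"

lemma i_hom: "group_hom (homology_group p Conf) (homology_group p ConfL) (i p)"
  by (simp add: conf2_incl_def)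

lemma continuous_Conf_incl: "continuous_map Conf ConfL id"
  by (auto simp: conf2_realization conf_points_def points_L)

lemma incl_square: "Lg.\<iota> p (incl_D p x) = i p (\<iota> p x)"
proof -
  have c: "continuous_map (disc_space K) (disc_space L) id"
    using disc_K_sub by (auto simp: disc_space_eq[OF K] disc_space_eq[OF L])
  have "Lg.\<iota> p (incl_D p x) = hom_induced p (disc_space K) {} ConfL {} (id \<circ> id) x"
    unfolding Lg.\<iota>_def incl_D_def by (rule hom_induced_compose'[OF c _ Lg.continuous_incl]) auto
  moreover have "i p (\<iota> p x) = hom_induced p (disc_space K) {} ConfL {} (id \<circ> id) x"
    unfolding \<iota>_def conf2_incl_def by (rule hom_induced_compose'[OF continuous_incl _ continuous_Conf_incl]) auto
  ultimately show ?thesis by simp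
qed

lemma carrier_Conf: "carrier (homology_group p Conf) = \<iota> p ` carrier (HD p)"
  "carrier (homology_group p ConfL) = Lg.\<iota> p ` carrier (homology_group p (disc_space L))"
  using iso_iota[of p] Lg.iso_iota[of p] by (simp_all add: iso_def bij_betw_def)

lemma iota_one_iff:
  "y \<in> carrier (HD p) \<Longrightarrow> \<iota> p y = \<one>\<^bsub>homology_group p Conf\<^esub> \<longleftrightarrow> y = \<one>\<^bsub>HD p\<^esub>"
  "x \<in> carrier (homology_group p (disc_space L)) \<Longrightarrow> Lg.\<iota> p x = \<one>\<^bsub>homology_group p ConfL\<^esub> \<longleftrightarrow> x = \<one>\<^bsub>homology_group p (disc_space L)\<^esub>"
proof -
  interpret i: group_hom "HD p" "homology_group p Conf" "\<iota> p" by (rule iota_group_hom)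
  interpret j: group_hom "homology_group p (disc_space L)" "homology_group p ConfL" "Lg.\<iota> p"
    using Lg.iso_iota[of p] by (simp add: group_hom_def group_hom_axioms_def iso_def)
  show "y \<in> carrier (HD p) \<Longrightarrow> \<iota> p y = \<one>\<^bsub>homology_group p Conf\<^esub> \<longleftrightarrow> y = \<one>\<^bsub>HD p\<^esub>"
    using i.inj_on_one_iff iso_iota[of p] by (auto simp: iso_def bij_betw_def)
  show "x \<in> carrier (homology_group p (disc_space L)) \<Longrightarrow> Lg.\<iota> p x = \<one>\<^bsub>homology_group p ConfL\<^esub> \<longleftrightarrow> x = \<one>\<^bsub>homology_group p (disc_space L)\<^esub>"
    using j.inj_on_one_iff Lg.iso_iota[of p] by (auto simp: iso_def bij_betw_def)
qed

lemma kernel_i: "kernel (homology_group p Conf) (homology_group p ConfL) (i p) = \<iota> p ` link_map p ` carrier (H0 p \<times>\<times> H0 p)"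
proof -
  interpret d: group_hom "HD p" "homology_group p (disc_space L)" "incl_D p" by (rule incl_D_hom)
  have "\<iota> p y \<in> kernel (homology_group p Conf) (homology_group p ConfL) (i p) \<longleftrightarrow> y \<in> kernel (HD p) (homology_group p (disc_space L)) (incl_D p)"
    if y: "y \<in> carrier (HD p)" for y
    using iota_one_iff(2)[OF d.hom_closed[OF y]] y carrier_Conf(1) by (auto simp: kernel_def incl_square)
  then have "kernel (homology_group p Conf) (homology_group p ConfL) (i p) = \<iota> p ` kernel (HD p) (homology_group p (disc_space L)) (incl_D p)"
    using carrier_Conf(1)[of p] by (auto simp: kernel_def)
  then show ?thesis by (simp add: kernel_incl_D)
qed

text \<open>
  Intersects a cycle with the middle of the added edge: pass to \<open>D\<close>, take the class relative to the
  old discrete configuration space, and read off the suspended class.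
\<close>
definition cut :: "int \<Rightarrow> (('a \<Rightarrow> real) \<times> ('a \<Rightarrow> real)) chain set \<Rightarrow> ('a \<Rightarrow> real) chain set \<times> ('a \<Rightarrow> real) chain set" where
  "cut p x = inv_into (carrier (H0 (p-1) \<times>\<times> H0 (p-1))) (attach p)
     (hom_induced p (disc_space L) {} (disc_space L) (disc_conf2 K) id
       (inv_into (carrier (homology_group p (disc_space L))) (Lg.\<iota> p) x))"

abbreviation "RL p \<equiv> relative_homology_group p (disc_space L) (disc_conf2 K)"
abbreviation "rel p \<equiv> hom_induced p (disc_space L) {} (disc_space L) (disc_conf2 K) id"

lemma cut_iota:
  assumes x: "x \<in> carrier (homology_group p (disc_space L))"
  shows "cut p (Lg.\<iota> p x) \<in> carrier (H0 (p-1) \<times>\<times> H0 (p-1))" "attach p (cut p (Lg.\<iota> p x)) = rel p x"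
proof -
  have "inv_into (carrier (homology_group p (disc_space L))) (Lg.\<iota> p) (Lg.\<iota> p x) = x"
    using Lg.iso_iota[of p] x by (intro inv_into_f_f) (auto simp: iso_def bij_betw_def)
  moreover have "rel p x \<in> carrier (RL p)" by (rule hom_induced_carrier)
  ultimately show "cut p (Lg.\<iota> p x) \<in> carrier (H0 (p-1) \<times>\<times> H0 (p-1))" "attach p (cut p (Lg.\<iota> p x)) = rel p x"
    using inv_into_iso[OF iso_attach[of p]] by (simp_all add: cut_def del: carrier_DirProd)
qed

lemma inj_attach: "inj_on (attach p) (carrier (H0 (p-1) \<times>\<times> H0 (p-1)))"
  using iso_attach[of p] by (simp add: iso_def bij_betw_def)

lemma attach_group_hom: "group_hom (H0 (p-1) \<times>\<times> H0 (p-1)) (RL p) (attach p)"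
  using group_hom_attach[of "p-1"] by simp

lemma cut_hom: "group_hom (homology_group p ConfL) (H0 (p-1) \<times>\<times> H0 (p-1)) (cut p)"
proof -
  let ?B = "H0 (p-1) \<times>\<times> H0 (p-1)"
  have 1: "inv_into (carrier (homology_group p (disc_space L))) (Lg.\<iota> p) \<in> hom (homology_group p ConfL) (homology_group p (disc_space L))"
    using group.iso_set_sym[OF _ Lg.iso_iota[of p]] by (simp add: iso_def)
  have 2: "inv_into (carrier ?B) (attach p) \<in> hom (RL p) ?B"
    using group.iso_set_sym[OF group_H0(1) iso_attach[of p]] by (simp add: iso_def)
  have "inv_into (carrier ?B) (attach p) \<circ> (rel p \<circ> inv_into (carrier (homology_group p (disc_space L))) (Lg.\<iota> p)) \<in> hom (homology_group p ConfL) ?B"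
    by (rule hom_compose[OF hom_compose[OF 1 hom_induced_hom] 2])
  then have "cut p \<in> hom (homology_group p ConfL) ?B" by (simp add: cut_def[abs_def] o_def del: carrier_DirProd)
  then show ?thesis using group_H0 by (simp add: group_hom_def group_hom_axioms_def)
qed

lemma kernel_cut: "kernel (homology_group p ConfL) (H0 (p-1) \<times>\<times> H0 (p-1)) (cut p) = i p ` carrier (homology_group p Conf)"
proof -
  let ?B = "H0 (p-1) \<times>\<times> H0 (p-1)"
  interpret a: group_hom ?B "RL p" "attach p" by (rule attach_group_hom)
  have "cut p (Lg.\<iota> p x) = \<one>\<^bsub>?B\<^esub> \<longleftrightarrow> rel p x = \<one>\<^bsub>RL p\<^esub>" if x: "x \<in> carrier (homology_group p (disc_space L))" for x
  proof -
    have "cut p (Lg.\<iota> p x) = \<one>\<^bsub>?B\<^esub> \<longleftrightarrow> attach p (cut p (Lg.\<iota> p x)) = attach p \<one>\<^bsub>?B\<^esub>"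
      using inj_on_eq_iff[OF inj_attach[of p] cut_iota(1)[OF x] a.G.one_closed] by simp
    then show ?thesis by (simp only: cut_iota(2)[OF x] a.hom_one)
  qed
  then have "kernel (homology_group p ConfL) ?B (cut p) = Lg.\<iota> p ` kernel (homology_group p (disc_space L)) (RL p) (rel p)"
    unfolding kernel_def carrier_Conf(2) by blast
  also have "kernel (homology_group p (disc_space L)) (RL p) (rel p) = incl_D p ` carrier (HD p)"
    using kernel_hom_induced_relativization[of p "disc_space L" "disc_conf2 K"] by (simp add: subtopology_disc incl_D_def)
  also have "Lg.\<iota> p ` incl_D p ` carrier (HD p) = i p ` carrier (homology_group p Conf)"
    by (simp add: carrier_Conf(1) image_image incl_square)
  finally show ?thesis .
qed

lemma image_cut: "cut p ` carrier (homology_group p ConfL) = {x \<in> carrier (H0 (p-1) \<times>\<times> H0 (p-1)). link_map (p-1) x = \<one>\<^bsub>HD (p-1)\<^esub>}"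
proof (intro equalityI subsetI)
  let ?d = "hom_boundary p (disc_space L) (disc_conf2 K)"
  have k: "kernel (RL p) (HD (p-1)) ?d = rel p ` carrier (homology_group p (disc_space L))"
    using kernel_hom_boundary[of p "disc_space L" "disc_conf2 K"] by (simp add: subtopology_disc)
  {
    fix y assume "y \<in> cut p ` carrier (homology_group p ConfL)"
    then obtain x where x: "x \<in> carrier (homology_group p (disc_space L))" "y = cut p (Lg.\<iota> p x)"
      using carrier_Conf(2) by auto
    have "?d (rel p x) = \<one>\<^bsub>HD (p-1)\<^esub>" using k x(1) by (auto simp: kernel_def)
    then show "y \<in> {x \<in> carrier (H0 (p-1) \<times>\<times> H0 (p-1)). link_map (p-1) x = \<one>\<^bsub>HD (p-1)\<^esub>}"
      using cut_iota[OF x(1)] hom_boundary_attach[OF cut_iota(1)[OF x(1)]] x(2) by (simp del: carrier_DirProd)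
  next
    fix y assume "y \<in> {x \<in> carrier (H0 (p-1) \<times>\<times> H0 (p-1)). link_map (p-1) x = \<one>\<^bsub>HD (p-1)\<^esub>}"
    then have y: "y \<in> carrier (H0 (p-1) \<times>\<times> H0 (p-1))" "link_map (p-1) y = \<one>\<^bsub>HD (p-1)\<^esub>" by blast+
    interpret a: group_hom "H0 (p-1) \<times>\<times> H0 (p-1)" "RL p" "attach p" by (rule attach_group_hom)
    have "attach p y \<in> kernel (RL p) (HD (p-1)) ?d"
      using hom_boundary_attach[OF y(1)] y a.hom_closed[OF y(1)] by (simp add: kernel_def)
    then obtain x where x: "x \<in> carrier (homology_group p (disc_space L))" "attach p y = rel p x" unfolding k by blast
    then have "cut p (Lg.\<iota> p x) = y"
      using inj_onD[OF inj_attach _ cut_iota(1)[OF x(1)] y(1)] cut_iota(2)[OF x(1)] by simp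
    then show "y \<in> cut p ` carrier (homology_group p ConfL)"
      using x(1) carrier_Conf(2) by blast
  }
qed

lemma cut_tau:
  assumes x: "x \<in> carrier (homology_group p ConfL)"
  shows "cut p (tau p ConfL x) = prod.swap (cut p x)"
proof -
  obtain y where y: "y \<in> carrier (homology_group p (disc_space L))" "x = Lg.\<iota> p y" using x carrier_Conf(2) by auto
  let ?s = "hom_induced p (disc_space L) {} (disc_space L) {} prod.swap"
  have sy: "?s y \<in> carrier (homology_group p (disc_space L))" by (rule hom_induced_carrier)
  have sD: "prod.swap \<in> disc_conf2 K \<rightarrow> disc_conf2 K" using disc_conf2_swap[OF K] by auto
  have "rel p (?s y) = hom_induced p (disc_space L) {} (disc_space L) (disc_conf2 K) (id \<circ> prod.swap) y"
    by (rule hom_induced_compose'[OF Lg.continuous_swap_disc]) auto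
  also have "\<dots> = hom_induced p (disc_space L) {} (disc_space L) (disc_conf2 K) (prod.swap \<circ> id) y" by simp
  also have "\<dots> = hom_induced p (disc_space L) (disc_conf2 K) (disc_space L) (disc_conf2 K) prod.swap (rel p y)"
    by (rule hom_induced_compose'[symmetric, OF _ _ Lg.continuous_swap_disc sD]) auto
  finally have "attach p (cut p (Lg.\<iota> p (?s y))) = attach p (prod.swap (cut p x))"
    using swap_attach[OF cut_iota(1)[OF y(1)]] by (simp only: cut_iota(2)[OF sy] cut_iota(2)[OF y(1)] y(2))
  moreover have "prod.swap (cut p x) \<in> carrier (H0 (p-1) \<times>\<times> H0 (p-1))" using cut_iota(1)[OF y(1)] y(2) by auto
  ultimately have "cut p (Lg.\<iota> p (?s y)) = prod.swap (cut p x)"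
    using inj_onD[OF inj_attach _ cut_iota(1)[OF sy]] by blast
  then show ?thesis by (simp only: Lg.iota_swap y(2))
qed

lemma path_connected_disc: "path_connected_space (disc_space K)"
  using path_connected_space_retraction_map_image retraction_separate[OF K] path_connected
  unfolding retraction_map_def by blast

text \<open>
  In degree 0 the positions \<open>u\<close> and \<open>v\<close> cannot be told apart in a path connected space.
\<close>
lemma link_map_0:
  assumes x: "x \<in> carrier (H0 0 \<times>\<times> H0 0)"
  shows "link_map 0 x = \<one>\<^bsub>HD 0\<^esub>"
proof -
  obtain z z' where z: "x = (z, z')" "z \<in> carrier (H0 0)" "z' \<in> carrier (H0 0)" using x by auto
  interpret D: comm_group "HD 0" by simp
  have "left_map 0 u z = left_map 0 v z" "right_map 0 u z' = right_map 0 v z'"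
    unfolding left_map_def right_map_def
    by (intro hom_induced_0_path_connected[OF path_connected_disc] slices_continuous z; simp)+
  then show ?thesis by (simp add: link_map_def z left_right_carrier)
qed

text \<open>
  The kernel is the image of \<open>H\<^sub>2(\<Gamma>\<^sub>0)\<^sup>2\<close>, which is zero because \<open>\<Gamma>\<^sub>0\<close> is a graph.
\<close>
lemma inj_i_2: "inj_on (i 2) (carrier (homology_group 2 Conf))"
proof -
  interpret i: group_hom "homology_group 2 Conf" "homology_group 2 ConfL" "i 2" by (rule i_hom)
  interpret l: group_hom "H0 2 \<times>\<times> H0 2" "HD 2" "link_map 2" by (rule link_map_hom)
  have "carrier (H0 2 \<times>\<times> H0 2) = {\<one>\<^bsub>H0 2 \<times>\<times> H0 2\<^esub>}"
    using trivial_homology_graph[OF K0, of 2] by (simp add: trivial_group_def)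
  then have "link_map 2 ` carrier (H0 2 \<times>\<times> H0 2) = {\<one>\<^bsub>HD 2\<^esub>}" using l.hom_one by (simp del: one_DirProd carrier_DirProd)
  then have "kernel (homology_group 2 Conf) (homology_group 2 ConfL) (i 2) = {\<one>\<^bsub>homology_group 2 Conf\<^esub>}"
    unfolding kernel_i by (simp add: iota_one_iff(1)[THEN iffD2])
  then show ?thesis by (rule i.trivial_ker_imp_inj)
qed

end

lemma tau_module:
  "Z2_module (homology_group p (conf2 X)) (tau p (conf2 X))"
proof -
  have c: "continuous_map (conf2 X) (conf2 X) prod.swap"
    unfolding conf2_def using continuous_map_square_swap[of X]
    by (auto simp: continuous_map_in_subtopology intro: continuous_map_from_subtopology)
  have "tau p (conf2 X) (tau p (conf2 X) x) = x" if x: "x \<in> carrier (homology_group p (conf2 X))" for x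
  proof -
    have "tau p (conf2 X) (tau p (conf2 X) x) = hom_induced p (conf2 X) {} (conf2 X) {} (prod.swap \<circ> prod.swap) x"
      unfolding tau_def by (rule hom_induced_compose'[OF c _ c]) auto
    then show ?thesis using hom_induced_id[OF x] by simp
  qed
  then show ?thesis by (simp add: Z2_module_def tau_def hom_induced_hom)
qed


lemma connected_reachable:
  assumes K: "graph K" and conn: "connected_space (realization K)"
    and uv: "u \<in> vertices K" "v \<in> vertices K"
  shows "(adjacent K)\<^sup>*\<^sup>* v u"
proof (rule ccontr)
  assume no: "\<not> (adjacent K)\<^sup>*\<^sup>* v u"
  let ?W = "{w \<in> vertices K. (adjacent K)\<^sup>*\<^sup>* v w}"
  have "v \<in> ?W" "u \<notin> ?W" using uv no by auto
  then have "?W \<noteq> {}" "?W \<noteq> vertices K" using uv by blast+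
  then obtain a w where aw: "a \<in> ?W" "w \<in> vertices K - ?W" "adjacent K w a"
    using connected_adjacent[OF K conn, of ?W] by blast
  then have "(adjacent K)\<^sup>*\<^sup>* v w"
    using adjacent_sym by (metis (no_types, lifting) mem_Collect_eq rtranclp.rtrancl_into_rtrancl)
  then show False using aw by blast
qed

context linking
begin

lemma X_set_eq_kernel: "X_set K u v = kernel (H0 1 \<times>\<times> H0 1) (HD 1) (link_map 1)"
  by (simp add: X_set_eq kernel_def)

lemma X_set_eq_image: "X_set K u v = cut 2 ` carrier (homology_group 2 ConfL)"
  using image_cut[of 2] by (simp add: X_set_eq)

lemma subgroup_X: "subgroup (X_set K u v) (H0 1 \<times>\<times> H0 1)"
  unfolding X_set_eq_kernel by (rule group_hom.subgroup_kernel[OF link_map_hom])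

text \<open>
  \<open>X\<close> is the image of the equivariant map \<open>cut\<close>, hence closed under the exchange.
\<close>
lemma X_module: "Z2_module (X_group K u v) prod.swap"
proof -
  interpret G: comm_group "H0 1 \<times>\<times> H0 1" by (rule group_H0(2))
  interpret X: subgroup "X_set K u v" "H0 1 \<times>\<times> H0 1" by (rule subgroup_X)
  have g: "group (X_group K u v)" by (rule X.subgroup_is_group[OF G.is_group])
  have c: "comm_group (X_group K u v)"
    by (rule group.group_comm_groupI[OF g]) (use X.subset G.m_comm in \<open>simp add: subset_eq\<close>)
  have sw: "prod.swap x \<in> X_set K u v" if x: "x \<in> X_set K u v" for x
  proof -
    obtain y where y: "y \<in> carrier (homology_group 2 ConfL)" "x = cut 2 y" using x X_set_eq_image by blast
    have "prod.swap x = cut 2 (tau 2 ConfL y)" using cut_tau[OF y(1)] y(2) by simp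
    moreover have "tau 2 ConfL y \<in> carrier (homology_group 2 ConfL)" by (simp add: tau_def hom_induced_carrier)
    ultimately show ?thesis unfolding X_set_eq_image by blast
  qed
  have "prod.swap \<in> hom (X_group K u v) (X_group K u v)"
    by (rule homI) (use sw in \<open>auto simp: mult_DirProd'\<close>)
  with c show ?thesis by (simp add: Z2_module_def)
qed

lemma i_equivariant: "i p \<in> Z2_hom (homology_group p Conf) (tau p Conf) (homology_group p ConfL) (tau p ConfL)"
proof -
  have "i p (tau p Conf x) = tau p ConfL (i p x)" for x
  proof -
    have "i p (tau p Conf x) = hom_induced p Conf {} ConfL {} (id \<circ> prod.swap) x"
      unfolding conf2_incl_def tau_def by (rule hom_induced_compose'[OF continuous_swap_Conf _ continuous_Conf_incl]) auto
    moreover have "tau p ConfL (i p x) = hom_induced p Conf {} ConfL {} (prod.swap \<circ> id) x"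
      unfolding conf2_incl_def tau_def by (rule hom_induced_compose'[OF continuous_Conf_incl _ Lg.continuous_swap_Conf]) auto
    ultimately show ?thesis by simp
  qed
  then show ?thesis using group_hom.homh[OF i_hom] by (simp add: Z2_hom_def)
qed

lemma cut_equivariant: "cut 2 \<in> Z2_hom (homology_group 2 ConfL) (tau 2 ConfL) (X_group K u v) prod.swap"
proof -
  interpret c: group_hom "homology_group 2 ConfL" "H0 1 \<times>\<times> H0 1" "cut 2" using cut_hom[of 2] by simp
  have "cut 2 \<in> hom (homology_group 2 ConfL) (X_group K u v)"
    using X_set_eq_image c.hom_mult by (auto simp: hom_def)
  then show ?thesis using cut_tau by (simp add: Z2_hom_def)
qed

lemma exact_at_cut_2: "exact_at (homology_group 2 Conf) (i 2) (homology_group 2 ConfL) (cut 2) (X_group K u v)"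
proof -
  have "comm_group (X_group K u v)" using X_module by (simp add: Z2_module_def)
  then have "group_hom (homology_group 2 ConfL) (X_group K u v) (cut 2)"
    using cut_equivariant by (simp add: Z2_hom_def group_hom_def group_hom_axioms_def comm_group_def)
  moreover have "kernel (homology_group 2 ConfL) (X_group K u v) (cut 2) = i 2 ` carrier (homology_group 2 Conf)"
    using kernel_cut[of 2] by (simp add: kernel_def)
  ultimately show ?thesis by (simp add: exact_at_def i_hom)
qed

lemma F_map_hom: "group_hom (H0 1 \<times>\<times> H0 1) (homology_group 1 Conf) (F_map K u v)"
proof -
  interpret l: group_hom "H0 1 \<times>\<times> H0 1" "HD 1" "link_map 1" by (rule link_map_hom)
  interpret j: group_hom "HD 1" "homology_group 1 Conf" "\<iota> 1" by (rule iota_group_hom)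
  have "F_map K u v \<in> hom (H0 1 \<times>\<times> H0 1) (homology_group 1 Conf)"
  proof (rule homI)
    fix x y assume xy: "x \<in> carrier (H0 1 \<times>\<times> H0 1)" "y \<in> carrier (H0 1 \<times>\<times> H0 1)"
    have "x \<otimes>\<^bsub>H0 1 \<times>\<times> H0 1\<^esub> y \<in> carrier (H0 1 \<times>\<times> H0 1)" using xy by (rule l.G.m_closed)
    with xy show "F_map K u v (x \<otimes>\<^bsub>H0 1 \<times>\<times> H0 1\<^esub> y) = F_map K u v x \<otimes>\<^bsub>homology_group 1 Conf\<^esub> F_map K u v y"
      by (simp only: F_map_eq l.hom_mult j.hom_mult l.hom_closed)
  qed (simp only: F_map_eq l.hom_closed j.hom_closed)
  then show ?thesis using group_H0 by (simp add: group_hom_def group_hom_axioms_def)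
qed

lemma exact_at_F_map: "exact_at (H0 1 \<times>\<times> H0 1) (F_map K u v) (homology_group 1 Conf) (i 1) (homology_group 1 ConfL)"
proof -
  have "F_map K u v ` carrier (H0 1 \<times>\<times> H0 1) = \<iota> 1 ` link_map 1 ` carrier (H0 1 \<times>\<times> H0 1)"
    unfolding image_image by (rule image_cong[OF refl F_map_eq])
  then show ?thesis unfolding exact_at_def kernel_i by (simp only: F_map_hom i_hom simp_thms)
qed

lemma exact_at_cut_1:
  "exact_at (homology_group 1 Conf) (i 1) (homology_group 1 ConfL) (cut 1) (H0 0 \<times>\<times> H0 0)"
  "cut 1 ` carrier (homology_group 1 ConfL) = carrier (H0 0 \<times>\<times> H0 0)"
proof -
  show "exact_at (homology_group 1 Conf) (i 1) (homology_group 1 ConfL) (cut 1) (H0 0 \<times>\<times> H0 0)"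
    using cut_hom[of 1] kernel_cut[of 1] i_hom by (simp add: exact_at_def)
  show "cut 1 ` carrier (homology_group 1 ConfL) = carrier (H0 0 \<times>\<times> H0 0)"
    using image_cut[of 1] link_map_0 by (auto simp del: carrier_DirProd)
qed

end

text \<open>
  The map \<open>r\<close> of the first part is \<open>cut 2\<close> and the map \<open>k\<close> of the second part is \<open>cut 1\<close>.
\<close>
theorem theorem12:
  fixes K :: "'a set set" and u v :: 'a
  assumes "graph K"
    and "connected_space (realization K)"
    and "\<not> realization K homeomorphic_space top_of_set {0..1::real}"
    and "{u} \<in> K" and "{v} \<in> K" and "u \<noteq> v" and "{u, v} \<notin> K"
  shows
    "(let F = conf2 (realization K); F' = conf2 (realization (add_edge K u v));
          i = conf2_incl 2 K u v; X = X_group K u v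
      in subgroup (X_set K u v) (H_Gamma0_sq 1 K u v) \<and>
         Z2_module (homology_group 2 F) (tau 2 F) \<and>
         Z2_module (homology_group 2 F') (tau 2 F') \<and>
         Z2_module X prod.swap \<and>
         i \<in> Z2_hom (homology_group 2 F) (tau 2 F) (homology_group 2 F') (tau 2 F') \<and>
         (\<exists>r \<in> Z2_hom (homology_group 2 F') (tau 2 F') X prod.swap.
            inj_on i (carrier (homology_group 2 F)) \<and>
            exact_at (homology_group 2 F) i (homology_group 2 F') r X \<and>
            r ` carrier (homology_group 2 F') = carrier X)) \<and>
     (let F = conf2 (realization K); F' = conf2 (realization (add_edge K u v));
          i = conf2_incl 1 K u v; H0 = H_Gamma0_sq 0 K u v
      in \<exists>k. exact_at (H_Gamma0_sq 1 K u v) (F_map K u v) (homology_group 1 F)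
                i (homology_group 1 F') \<and>
             exact_at (homology_group 1 F) i (homology_group 1 F') k H0 \<and>
             k ` carrier (homology_group 1 F') = carrier H0)"
proof -
  interpret added_edge K u v
    by standard (use assms in auto)
  have uv: "u \<in> vertices K" "v \<in> vertices K" using assms by (auto simp: vertices_def)
  interpret linking K u v
    by standard (rule path_connected_conf2[OF assms(1-3) uv assms(6)] connected_reachable[OF assms(1,2) uv])+
  show ?thesis
    unfolding Let_def
    using subgroup_X tau_module[of 2] X_module i_equivariant[of 2] cut_equivariant inj_i_2 exact_at_cut_2
      X_set_eq_image exact_at_F_map exact_at_cut_1
    by (intro conjI bexI[of _ "cut 2"] exI[of _ "cut 1"]) simp_all
qed

end
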